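(* Let $\kappa$ be an uncountable regular cardinal and let $X$ be a real WLD Banach space with $\operatorname{dens}(X)=\kappa$ satisfying the following condition (d-d): for every closed subspace $Y\subset X$ with $\operatorname{dens}(Y)<\operatorname{dens}(X)$ there is a closed subspace $Z\subset X$ with $Z\subset\Psi(Y^\perp)$ and $\operatorname{codens}(Z)\le\operatorname{dens}(Y)$. Then: (1) $X$ has the bicontractive Separable Complementation Property. Moreover, for every subspace $Y\subset X$ with $\operatorname{dens}(Y)<\operatorname{dens}(X)$ there is a bicontractively complemented subspace $Z\subset X$ with $Y\subset Z$ and $\operatorname{dens}(Z)=\operatorname{dens}(Y)$. (2) Any Markushevich basis of $X$ is, up to a permutation, subordinated to a bimonotone PRI on $X$. (3) If $\operatorname{dens}(X)=\aleph_1$, then given any Markushevich basis on $X$, any PRI on $X$ admits a bimonotone coarsening to which the Markushevich basis is subordinated.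
   Context: $[\,\cdot\,]$ denotes closed linear span, $\operatorname{codens}(Z)=\operatorname{dens}(X/Z)$, and $Y^\perp\subset X^*$ is the annihilator. For $U\subset X^*$, $\Psi(U)=\{x\in X:\sup_{f\in U\setminus\{0\}}|f(x)|/\|f\|=\|x\|\}$, $\Psi(\emptyset)=\Psi(\{0\})=\{0\}$. Markushevich basis (M-basis): a biorthogonal system $\{(x_\alpha,f_\alpha)\}$ in $X\times X^*$ with $[x_\alpha]_\alpha=X$ and the $w^*$-closed span of $\{f_\alpha\}$ equal to $X^*$. Property (C): for any $\Gamma\subset X^*$ and $f\in\overline{\Gamma}^{w^*}$ there is a countable $\Gamma_0\subset\Gamma$ with $f\in\overline{\mathrm{conv}}^{w^*}(\Gamma_0)$. $X$ is WLD iff it has an M-basis and property (C); equivalently, it has an M-basis such that $\{\alpha:f(x_\alpha)\ne0\}$ is countable for each $f\in X^*$. PRI (projectional resolution of the identity) on $X$, $\operatorname{dens}(X)=\kappa$: a family $\{P_\alpha\}_{\alpha<\kappa}$ of norm-one linear projections on $X$ with $P_\alpha P_\beta=P_\beta P_\alpha=P_{\min(\alpha,\beta)}$, $\operatorname{dens}(P_\alpha(X))\le|\alpha|\vee\aleph_0$, $P_\lambda(X)=\overline{\bigcup_{\alpha<\lambda}P_\alpha(X)}$ for limit ordinals $\lambda<\kappa$, and $X=\overline{\bigcup_{\alpha<\kappa}P_\alpha(X)}$. An M-basis $\{(x_\beta,f_\beta)\}_{\beta<\kappa}$ is subordinated to the PRI if there is a continuous strictly increasing map $\kappa\to\kappa$,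 $\alpha\mapsto\theta_\alpha$, with $|\theta_\alpha|=|\alpha|\vee\aleph_0$ and $P_\alpha(X)=[x_\beta:\beta<\theta_\alpha]$ for each $\alpha<\kappa$. "Up to a permutation" means after re-indexing the M-basis by a bijection of the index set. A coarsening of a PRI $\{P_\alpha\}_{\alpha<\kappa}$ is a subsequence $\{P_{\alpha_\beta}\}_{\beta<\kappa}$ (with $\beta\mapsto\alpha_\beta$ strictly increasing) that is also a PRI on $X$. A projection $P$ is bicontractive if both $P$ and $I-P$ have norm $1$. A PRI is bimonotone if all its projections are bicontractive. A subspace is bicontractively complemented if it is the image of a bicontractive linear projection on $X$. The bicontractive Separable Complementation Property: every separable subspace of $X$ is contained in a separable subspace which is complemented by a bicontractive linear projection. *)

theory Defs
  imports "HOL-Analysis.Analysis"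
begin

unbundle cardinal_syntax

section \<open>Density character\<close>

definition metric_dense :: "'b set \<Rightarrow> ('b \<Rightarrow> 'b \<Rightarrow> real) \<Rightarrow> 'b set \<Rightarrow> bool" where
  "metric_dense M d D \<longleftrightarrow> D \<subseteq> M \<and> (\<forall>x\<in>M. \<forall>e>0. \<exists>y\<in>D. d x y < e)"

text \<open>
  The least cardinality of a dense subset, determined up to \<open>=o\<close>. As usual for cardinal functions
  the value is taken to be infinite, which is what adding \<open>natLeq\<close> (that is, aleph-zero) does: the
  sum is the maximum of the two cardinals. This matters only for the zero space, whose least dense
  subset is a singleton; all other normed spaces have no finite dense subset.
\<close>

definition density :: "'b set \<Rightarrow> ('b \<Rightarrow> 'b \<Rightarrow> real) \<Rightarrow> ('b + nat) rel" where
  "density M d =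
     |SOME D. metric_dense M d D \<and> (\<forall>D'. metric_dense M d D' \<longrightarrow> |D| \<le>o |D'| )| +c natLeq"

definition dens :: "'a::real_normed_vector set \<Rightarrow> ('a + nat) rel" where
  "dens S = density S dist"

text \<open>The quotient of the whole space by a subspace, as a set of cosets with the quotient norm.\<close>

definition quotient_space :: "'a::real_normed_vector set \<Rightarrow> 'a set set" where
  "quotient_space Z = range (\<lambda>x. (\<lambda>z. x + z) ` Z)"

definition quotient_norm :: "'a::real_normed_vector set \<Rightarrow> real" where
  "quotient_norm C = (INF x\<in>C. norm x)"

definition quotient_dist :: "'a::real_normed_vector set \<Rightarrow> 'a set \<Rightarrow> real" where
  "quotient_dist C C' = quotient_norm {x - y |x y. x \<in> C \<and> y \<in> C'}"

definition codens :: "'a::real_normed_vector set \<Rightarrow> ('a set + nat) rel" where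
  "codens Z = density (quotient_space Z) quotient_dist"


section \<open>Duality, Markushevich bases and WLD spaces\<close>

text \<open>For real-valued functionals the strong operator topology is the weak-star topology.\<close>

abbreviation weak_star_topology :: "('a::real_normed_vector \<Rightarrow>\<^sub>L real) topology" where
  "weak_star_topology \<equiv> strong_operator_topology"

definition annihilator :: "'a::real_normed_vector set \<Rightarrow> ('a \<Rightarrow>\<^sub>L real) set" where
  "annihilator Y = {f. \<forall>y\<in>Y. blinfun_apply f y = 0}"

definition Psi :: "('a::real_normed_vector \<Rightarrow>\<^sub>L real) set \<Rightarrow> 'a set" where
  "Psi U = (if U \<subseteq> {0} then {0}
            else {x. (SUP f\<in>U - {0}. \<bar>blinfun_apply f x\<bar> / norm f) = norm x})"

definition closed_span :: "'a::real_normed_vector set \<Rightarrow> 'a set" where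
  "closed_span S = closure (span S)"

definition M_basis ::
  "'i set \<Rightarrow> ('i \<Rightarrow> 'a::real_normed_vector) \<Rightarrow> ('i \<Rightarrow> 'a \<Rightarrow>\<^sub>L real) \<Rightarrow> bool" where
  "M_basis I x f \<longleftrightarrow>
     (\<forall>i\<in>I. \<forall>j\<in>I. blinfun_apply (f i) (x j) = (if i = j then 1 else 0)) \<and>
     closed_span (x ` I) = UNIV \<and>
     weak_star_topology closure_of (span (f ` I)) = UNIV"

definition property_C :: "'a::real_normed_vector itself \<Rightarrow> bool" where
  "property_C TYPE('a) \<longleftrightarrow>
     (\<forall>(\<Gamma> :: ('a \<Rightarrow>\<^sub>L real) set) f. f \<in> weak_star_topology closure_of \<Gamma> \<longrightarrow>
        (\<exists>\<Gamma>\<^sub>0\<subseteq>\<Gamma>. countable \<Gamma>\<^sub>0 \<and> f \<in> weak_star_topology closure_of (convex hull \<Gamma>\<^sub>0)))"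

text \<open>
  Since the vectors of an M-basis are pairwise distinct, every M-basis can be indexed by a set of
  elements of the space; so nothing is lost by taking the index set there.
\<close>

definition WLD :: "'a::real_normed_vector itself \<Rightarrow> bool" where
  "WLD TYPE('a) \<longleftrightarrow>
     (\<exists>(I :: 'a set) (x :: 'a \<Rightarrow> 'a) f. M_basis I x f) \<and> property_C TYPE('a)"

definition condition_dd :: "'a::real_normed_vector itself \<Rightarrow> bool" where
  "condition_dd TYPE('a) \<longleftrightarrow>
     (\<forall>Y :: 'a set. subspace Y \<and> closed Y \<and> dens Y <o dens (UNIV :: 'a set) \<longrightarrow>
        (\<exists>Z. subspace Z \<and> closed Z \<and> Z \<subseteq> Psi (annihilator Y) \<and> codens Z \<le>o dens Y))"


section \<open>Bicontractive projections\<close>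

definition projection :: "('a::real_normed_vector \<Rightarrow>\<^sub>L 'a) \<Rightarrow> bool" where
  "projection P \<longleftrightarrow> P o\<^sub>L P = P"

definition bicontractive :: "('a::real_normed_vector \<Rightarrow>\<^sub>L 'a) \<Rightarrow> bool" where
  "bicontractive P \<longleftrightarrow> projection P \<and> norm P = 1 \<and> norm (id_blinfun - P) = 1"

definition bicontractively_complemented :: "'a::real_normed_vector set \<Rightarrow> bool" where
  "bicontractively_complemented Z \<longleftrightarrow> (\<exists>P. bicontractive P \<and> range (blinfun_apply P) = Z)"

definition bicontractive_SCP :: "'a::real_normed_vector itself \<Rightarrow> bool" where
  "bicontractive_SCP TYPE('a) \<longleftrightarrow>
     (\<forall>Y :: 'a set. subspace Y \<and> separable_space (top_of_set Y) \<longrightarrow>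
        (\<exists>Z. subspace Z \<and> separable_space (top_of_set Z) \<and> Y \<subseteq> Z \<and>
             bicontractively_complemented Z))"


section \<open>Projectional resolutions of the identity\<close>

text \<open>
  A cardinal is a cardinal well-order \<open>\<kappa>\<close>; the ordinals below it are the elements of \<open>Field \<kappa>\<close>.
  For such an element \<open>\<alpha>\<close>, the set of smaller ordinals is \<open>underS \<kappa> \<alpha>\<close>, so the cardinality of the
  ordinal \<open>\<alpha>\<close> is that of \<open>underS \<kappa> \<alpha>\<close>, and its maximum with aleph-zero is obtained by adding
  \<open>natLeq\<close>.
\<close>

definition ord_card :: "'k rel \<Rightarrow> 'k \<Rightarrow> ('k + nat) rel" where
  "ord_card \<kappa> \<alpha> = |underS \<kappa> \<alpha>| +c natLeq"

definition ord_min :: "'k rel \<Rightarrow> 'k \<Rightarrow> 'k \<Rightarrow> 'k" where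
  "ord_min \<kappa> \<alpha> \<beta> = (if (\<alpha>, \<beta>) \<in> \<kappa> then \<alpha> else \<beta>)"

definition limit_ord :: "'k rel \<Rightarrow> 'k \<Rightarrow> bool" where
  "limit_ord \<kappa> l \<longleftrightarrow> l \<in> Field \<kappa> \<and> underS \<kappa> l \<noteq> {} \<and>
     (\<forall>\<alpha>\<in>underS \<kappa> l. \<exists>\<beta>\<in>underS \<kappa> l. \<alpha> \<in> underS \<kappa> \<beta>)"

definition ord_strict_mono :: "'k rel \<Rightarrow> ('k \<Rightarrow> 'k) \<Rightarrow> bool" where
  "ord_strict_mono \<kappa> \<theta> \<longleftrightarrow>
     (\<forall>\<alpha>\<in>Field \<kappa>. \<theta> \<alpha> \<in> Field \<kappa>) \<and>
     (\<forall>\<beta>\<in>Field \<kappa>. \<forall>\<alpha>\<in>underS \<kappa> \<beta>. \<theta> \<alpha> \<in> underS \<kappa> (\<theta> \<beta>))"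

definition ord_continuous :: "'k rel \<Rightarrow> ('k \<Rightarrow> 'k) \<Rightarrow> bool" where
  "ord_continuous \<kappa> \<theta> \<longleftrightarrow> (\<forall>l. limit_ord \<kappa> l \<longrightarrow> \<theta> l = wo_rel.supr \<kappa> (\<theta> ` underS \<kappa> l))"

definition PRI :: "'k rel \<Rightarrow> ('k \<Rightarrow> 'a::real_normed_vector \<Rightarrow>\<^sub>L 'a) \<Rightarrow> bool" where
  "PRI \<kappa> P \<longleftrightarrow>
     dens (UNIV :: 'a set) =o \<kappa> \<and>
     (\<forall>\<alpha>\<in>Field \<kappa>. projection (P \<alpha>) \<and> norm (P \<alpha>) = 1) \<and>
     (\<forall>\<alpha>\<in>Field \<kappa>. \<forall>\<beta>\<in>Field \<kappa>.
        P \<alpha> o\<^sub>L P \<beta> = P (ord_min \<kappa> \<alpha> \<beta>) \<and> P \<beta> o\<^sub>L P \<alpha> = P (ord_min \<kappa> \<alpha> \<beta>)) \<and>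
     (\<forall>\<alpha>\<in>Field \<kappa>. dens (range (blinfun_apply (P \<alpha>))) \<le>o ord_card \<kappa> \<alpha>) \<and>
     (\<forall>l. limit_ord \<kappa> l \<longrightarrow>
        range (blinfun_apply (P l)) = closure (\<Union>\<alpha>\<in>underS \<kappa> l. range (blinfun_apply (P \<alpha>)))) \<and>
     closure (\<Union>\<alpha>\<in>Field \<kappa>. range (blinfun_apply (P \<alpha>))) = UNIV"

definition bimonotone_PRI :: "'k rel \<Rightarrow> ('k \<Rightarrow> 'a::real_normed_vector \<Rightarrow>\<^sub>L 'a) \<Rightarrow> bool" where
  "bimonotone_PRI \<kappa> P \<longleftrightarrow> PRI \<kappa> P \<and> (\<forall>\<alpha>\<in>Field \<kappa>. bicontractive (P \<alpha>))"

text \<open>The functionals of the M-basis play no role in subordination, so only its vectors occur.\<close>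

definition subordinated ::
  "'k rel \<Rightarrow> ('k \<Rightarrow> 'a::real_normed_vector) \<Rightarrow> ('k \<Rightarrow> 'a \<Rightarrow>\<^sub>L 'a) \<Rightarrow> bool" where
  "subordinated \<kappa> x P \<longleftrightarrow>
     (\<exists>\<theta>. ord_strict_mono \<kappa> \<theta> \<and> ord_continuous \<kappa> \<theta> \<and>
        (\<forall>\<alpha>\<in>Field \<kappa>. |underS \<kappa> (\<theta> \<alpha>)| =o ord_card \<kappa> \<alpha>) \<and>
        (\<forall>\<alpha>\<in>Field \<kappa>. range (blinfun_apply (P \<alpha>)) = closed_span (x ` underS \<kappa> (\<theta> \<alpha>))))"

definition coarsening ::
  "'k rel \<Rightarrow> ('k \<Rightarrow> 'a::real_normed_vector \<Rightarrow>\<^sub>L 'a) \<Rightarrow> ('k \<Rightarrow> 'a \<Rightarrow>\<^sub>L 'a) \<Rightarrow> bool" where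
  "coarsening \<kappa> P Q \<longleftrightarrow>
     (\<exists>\<sigma>. ord_strict_mono \<kappa> \<sigma> \<and> (\<forall>\<beta>\<in>Field \<kappa>. Q \<beta> = P (\<sigma> \<beta>))) \<and> PRI \<kappa> Q"

end

theory Submission
  imports Defs
begin

text \<open>
  By property (C) every functional is non-zero at only countably many vectors of an M-basis. Hence for
  each finite set \<open>F\<close> of indices there is a countable set \<open>H\<close> such that \<open>y \<in> span {x\<^sub>i. i \<in> F}\<close> and
  \<open>z \<in> span {x\<^sub>i. i \<notin> H}\<close> satisfy both \<open>\<parallel>y\<parallel> \<le> \<parallel>y + z\<parallel>\<close> and \<open>\<parallel>z\<parallel> \<le> \<parallel>y + z\<parallel>\<close>: for the first inequality
  \<open>H\<close> must contain the supports of functionals norming a countable dense subset of the span; for the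
  second one, the supports of countably many functionals separating the points of \<open>X / Z\<close>, where \<open>Z\<close> is
  provided by (d-d) for the separable subspace \<open>[x\<^sub>i : i \<in> F]\<close>. A set \<open>A\<close> of indices that is closed
  under \<open>F \<mapsto> H\<close> therefore yields the bicontractive projection onto \<open>[x\<^sub>i : i \<in> A]\<close> along
  \<open>[x\<^sub>i : i \<notin> A]\<close>. As this closure is finitary with countable values, it does not raise infinite
  cardinalities and it commutes with unions of chains, so closed sets can be arranged in a continuous
  increasing filtration of the index set. For \<open>\<aleph>\<^sub>1\<close> the filtration is by initial segments, and on a club of
  indices the projections of the given PRI agree with those belonging to it.
\<close>


section \<open>Hahn-Banach and complementary projections\<close>

text \<open>An operator is determined by its values on the basis vectors, so commutation of
  projections and the comparison with a given PRI become statements about nested sets of indices.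
  The direction of (d-d) is decisive: functionals annihilating \<open>Y\<close> do not distinguish
  \<open>z\<close> from \<open>y + z\<close>, so \<open>z \<in> Psi (annihilator Y)\<close> means
  that adding \<open>y \<in> Y\<close> cannot shorten \<open>z\<close>. This controls
  \<open>id_blinfun - P\<close>, while norming functionals control \<open>P\<close>. In both
  inequalities the vector \<open>y\<close> uses only finitely many indices, which is why the hull
  closes up over finite sets. Closing up over countable sets could raise a cardinality to its
  countable power and could fail to commute with unions of countable chains, destroying the
  continuity demanded of a PRI.\<close>

definition sublinear :: "('a::real_vector \<Rightarrow> real) \<Rightarrow> bool" where
  "sublinear p \<longleftrightarrow> (\<forall>x y. p (x + y) \<le> p x + p y) \<and> (\<forall>c>0. \<forall>x. p (c *\<^sub>R x) = c * p x)"

lemma sublinear_add: "sublinear p \<Longrightarrow> p (x + y) \<le> p x + p y"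
  and sublinear_scale: "sublinear p \<Longrightarrow> c > 0 \<Longrightarrow> p (c *\<^sub>R x) = c * p x"
  by (auto simp: sublinear_def)

lemma sublinear_zero: "sublinear p \<Longrightarrow> p 0 = 0"
  using sublinear_scale[of p 2 0] by simp

lemma sublinear_minus: "sublinear p \<Longrightarrow> - p (- x) \<le> p x"
  using sublinear_add[of p x "- x"] sublinear_zero[of p] by simp

text \<open>The infimum chosen for \<open>q\<close> forces the value at \<open>- v\<close> that a
  linear \<open>g \<le> p\<close> with \<open>g v = p v\<close> must have there. It is finite since
  subadditivity bounds all its terms below by \<open>- p (- x)\<close>.\<close>

lemma sublinear_directional:
  fixes p :: "'a::real_vector \<Rightarrow> real"
  assumes p: "sublinear p"
  obtains q where "sublinear q" "\<And>x. q x \<le> p x" "q (- v) = - p v"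
proof
  define q where "q x = (INF t\<in>{0..}. p (x + t *\<^sub>R v) - t * p v)" for x
  have low: "- p (- x) \<le> p (x + t *\<^sub>R v) - t * p v" if "t \<ge> 0" for x t
  proof -
    have "p (t *\<^sub>R v) = t * p v"
      using that sublinear_scale[OF p, of t v] sublinear_zero[OF p] by (cases "t = 0") auto
    moreover have "p (t *\<^sub>R v) \<le> p (x + t *\<^sub>R v) + p (- x)"
      using sublinear_add[OF p, of "x + t *\<^sub>R v" "- x"] by simp
    ultimately show ?thesis by simp
  qed
  have bdd: "bdd_below ((\<lambda>t. p (x + t *\<^sub>R v) - t * p v) ` {0..})" for x
    using low by (intro bdd_belowI2[of _ "- p (- x)"]) auto
  have upper: "q x \<le> p (x + t *\<^sub>R v) - t * p v" if "t \<ge> 0" for x t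
    unfolding q_def using that bdd by (intro cINF_lower) auto
  have approx: "\<exists>t\<ge>0. p (x + t *\<^sub>R v) - t * p v < q x + e" if "e > 0" for x e
  proof -
    have "\<exists>t\<in>{0..}. p (x + t *\<^sub>R v) - t * p v < q x + e"
      using that bdd by (subst cINF_less_iff[symmetric]) (auto simp: q_def)
    then show ?thesis by auto
  qed
  show le: "q x \<le> p x" for x
    using upper[of 0 x] by simp
  have "q (- v) \<le> - p v"
    using upper[of 1 "- v"] sublinear_zero[OF p] by simp
  moreover have "- p v \<le> q (- v)"
    unfolding q_def using low[of _ "- v"] by (intro cINF_greatest) auto
  ultimately show "q (- v) = - p v" by simp
  show "sublinear q"
    unfolding sublinear_def
  proof (intro conjI allI impI)
    fix x y
    show "q (x + y) \<le> q x + q y"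
    proof (rule field_le_epsilon)
      fix e :: real assume "e > 0"
      then have "e / 2 > 0" by simp
      from approx[OF this, of x] approx[OF this, of y]
      obtain s t where "s \<ge> 0" "p (x + s *\<^sub>R v) - s * p v < q x + e / 2"
        and "t \<ge> 0" "p (y + t *\<^sub>R v) - t * p v < q y + e / 2"
        by blast
      moreover have "q (x + y) \<le> p ((x + s *\<^sub>R v) + (y + t *\<^sub>R v)) - (s + t) * p v"
        using upper[of "s + t" "x + y"] \<open>s \<ge> 0\<close> \<open>t \<ge> 0\<close> by (simp add: algebra_simps)
      ultimately show "q (x + y) \<le> q x + q y + e"
        using sublinear_add[OF p, of "x + s *\<^sub>R v" "y + t *\<^sub>R v"] by (simp add: algebra_simps)
    qed
  next
    \<comment> \<open>One inequality suffices, as the other is this one for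
      \<open>inverse c\<close>. It comes from replacing the parameter \<open>t\<close> by
      \<open>c * t\<close>.\<close>
    have scale: "q (c *\<^sub>R x) \<le> c * q x" if "c > 0" for c :: real and x
    proof -
      have "q (c *\<^sub>R x) / c \<le> q x"
        unfolding q_def[of x]
      proof (rule cINF_greatest)
        fix t :: real assume "t \<in> {0..}"
        then have "q (c *\<^sub>R x) \<le> p (c *\<^sub>R (x + t *\<^sub>R v)) - c * t * p v"
          using upper[of "c * t" "c *\<^sub>R x"] that by (simp add: algebra_simps)
        also have "\<dots> = c * (p (x + t *\<^sub>R v) - t * p v)"
          unfolding sublinear_scale[OF p that] by (simp add: algebra_simps)
        finally show "q (c *\<^sub>R x) / c \<le> p (x + t *\<^sub>R v) - t * p v"
          using that by (simp add: divide_le_eq mult.commute)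
      qed simp
      then show ?thesis
        using that by (simp add: field_simps)
    qed
    fix c :: real and x assume c: "c > 0"
    have "q x \<le> inverse c * q (c *\<^sub>R x)"
      using scale[of "inverse c" "c *\<^sub>R x"] c by simp
    with scale[OF c, of x] c show "q (c *\<^sub>R x) = c * q x"
      by (simp add: field_simps)
  qed
qed

text \<open>Zorn's lemma for the reversed pointwise order. The infimum of a chain is sublinear
  because the smaller of two members serves both arguments, and the common bound
  \<open>- p (- x)\<close> keeps it finite.\<close>

lemma sublinear_minimal:
  fixes p :: "'a::real_vector \<Rightarrow> real"
  assumes p: "sublinear p"
  obtains q where "sublinear q" "\<And>x. q x \<le> p x"
    "\<And>q'. sublinear q' \<Longrightarrow> (\<And>x. q' x \<le> q x) \<Longrightarrow> q' = q"
proof -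
  define A where "A = {q. sublinear q \<and> q \<le> p}"
  have "\<exists>m\<in>A. \<forall>a\<in>A. m \<ge> a \<longrightarrow> a = m"
  proof (rule predicate_Zorn)
    show "partial_order_on A (relation_of (\<ge>) A)"
      by (auto simp: partial_order_on_def preorder_on_def relation_of_def refl_on_def trans_def
          antisym_def)
    fix C assume C: "C \<in> Chains (relation_of (\<ge>) A)"
    then have CA: "C \<subseteq> A"
      by (auto simp: Chains_def relation_of_def)
    have tot: "f \<le> g \<or> g \<le> f" if "f \<in> C" "g \<in> C" for f g
      using C that by (auto simp: Chains_def relation_of_def)
    show "\<exists>u\<in>A. \<forall>a\<in>C. a \<ge> u"
    proof (cases "C = {}")
      case True
      then show ?thesis using p by (auto simp: A_def)
    next
      case False
      define u where "u x = (INF f\<in>C. f x)" for x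
      have low: "- p (- x) \<le> f x" if "f \<in> C" for f x
      proof -
        have "- f (- x) \<le> f x" "f (- x) \<le> p (- x)"
          using CA that sublinear_minus[of f] by (auto simp: A_def le_fun_def)
        then show ?thesis by linarith
      qed
      have bdd: "bdd_below ((\<lambda>f. f x) ` C)" for x
        using low by (intro bdd_belowI2[of _ "- p (- x)"]) auto
      have upper: "u x \<le> f x" if "f \<in> C" for f x
        unfolding u_def using that bdd by (intro cINF_lower) auto
      have approx: "\<exists>f\<in>C. f x < u x + e" if "e > 0" for x e
        using that bdd False by (subst cINF_less_iff[symmetric]) (auto simp: u_def)
      have "sublinear u"
        unfolding sublinear_def
      proof (intro conjI allI impI)
        fix x y
        show "u (x + y) \<le> u x + u y"
        proof (rule field_le_epsilon)
          fix e :: real assume "e > 0"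
          then have "e / 2 > 0" by simp
          from approx[OF this, of x] approx[OF this, of y]
          obtain f g where f: "f \<in> C" "f x < u x + e / 2" and g: "g \<in> C" "g y < u y + e / 2"
            by blast
          obtain h where h: "h \<in> C" "h \<le> f" "h \<le> g"
            using tot[OF f(1) g(1)] f(1) g(1) by blast
          have "u (x + y) \<le> h x + h y"
            using upper[OF h(1), of "x + y"] sublinear_add[of h x y] h(1) CA by (force simp: A_def)
          also have "\<dots> \<le> f x + g y"
            using h by (intro add_mono) (auto simp: le_fun_def)
          finally show "u (x + y) \<le> u x + u y + e"
            using f g by simp
        qed
      next
        have scale: "u (c *\<^sub>R x) \<le> c * u x" if "c > 0" for c :: real and x
        proof -
          have "u (c *\<^sub>R x) / c \<le> u x"
            unfolding u_def[of x]
          proof (rule cINF_greatest)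
            fix f assume f: "f \<in> C"
            then have "f (c *\<^sub>R x) = c * f x"
              using CA that by (auto simp: A_def sublinear_scale)
            then show "u (c *\<^sub>R x) / c \<le> f x"
              using upper[OF f, of "c *\<^sub>R x"] that by (simp add: field_simps)
          qed (rule False)
          then show ?thesis
            using that by (simp add: field_simps)
        qed
        fix c :: real and x assume c: "c > 0"
        have "u x \<le> inverse c * u (c *\<^sub>R x)"
          using scale[of "inverse c" "c *\<^sub>R x"] c by simp
        with scale[OF c, of x] c show "u (c *\<^sub>R x) = c * u x"
          by (simp add: field_simps)
      qed
      moreover obtain f where "f \<in> C"
        using False by blast
      then have "u \<le> p"
        using upper CA by (force simp: A_def le_fun_def intro: order_trans)
      ultimately show ?thesis
        using upper by (auto simp: A_def le_fun_def intro!: bexI[of _ u])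
    qed
  qed
  then obtain m where m: "sublinear m" "m \<le> p" and min: "\<And>a. a \<in> A \<Longrightarrow> a \<le> m \<Longrightarrow> a = m"
    by (auto simp: A_def)
  show ?thesis
  proof
    fix q' assume "sublinear q'" "\<And>x. q' x \<le> m x"
    then show "q' = m"
      using m by (intro min) (auto simp: A_def le_fun_def intro: order_trans)
  qed (use m in \<open>auto simp: le_fun_def\<close>)
qed

text \<open>A minimal sublinear functional is linear: otherwise its directional version is smaller.\<close>

theorem Hahn_Banach_sublinear:
  fixes p :: "'a::real_vector \<Rightarrow> real"
  assumes p: "sublinear p"
  obtains g where "linear g" "\<And>x. g x \<le> p x" "g v = p v"
proof -
  obtain p' where p': "sublinear p'" "\<And>x. p' x \<le> p x" "p' (- v) = - p v"
    using sublinear_directional[OF p] by metis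
  obtain g where g: "sublinear g" "\<And>x. g x \<le> p' x"
    and min: "\<And>q. sublinear q \<Longrightarrow> (\<And>x. q x \<le> g x) \<Longrightarrow> q = g"
    using sublinear_minimal[OF p'(1)] by metis
  have odd: "g (- x) = - g x" for x
  proof -
    obtain q where q: "sublinear q" "\<And>y. q y \<le> g y" "q (- x) = - g x"
      using sublinear_directional[OF g(1)] by metis
    with min have "q = g" by blast
    with q(3) show ?thesis by simp
  qed
  have add: "g (x + y) = g x + g y" for x y
    using sublinear_add[OF g(1), of x y] sublinear_add[OF g(1), of "- x" "- y"] odd[of x] odd[of y]
      odd[of "x + y"] by simp
  have scale: "g (c *\<^sub>R x) = c * g x" for c x
  proof (cases c "0 :: real" rule: linorder_cases)
    case less
    then have "g ((- c) *\<^sub>R x) = (- c) * g x"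
      by (intro sublinear_scale[OF g(1)]) simp
    with odd[of "c *\<^sub>R x"] show ?thesis by simp
  qed (use g(1) in \<open>auto simp: sublinear_zero sublinear_scale\<close>)
  show ?thesis
  proof
    show "linear g"
      by (rule linearI) (auto simp: add scale)
    show le: "g x \<le> p x" for x
      using g(2) p'(2) order_trans by blast
    \<comment> \<open>The missing inequality is
      \<open>- g v = g (- v) \<le> p' (- v) = - p v\<close>.\<close>
    show "g v = p v"
      using g(2)[of "- v"] p'(3) odd[of v] le[of v] by simp
  qed
qed

section \<open>The distance to a subspace and its Hahn-Banach functionals\<close>

lemma infdist_subspace_le:
  assumes "z \<in> Z"
  shows "infdist x Z \<le> norm (x - z)"
  using infdist_le[OF assms, of x] by (simp add: dist_norm)

lemma infdist_subspace_approx: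
  fixes Z :: "'a::real_normed_vector set"
  assumes "subspace Z" "e > 0"
  obtains z where "z \<in> Z" "norm (x - z) < infdist x Z + e"
proof -
  have "Z \<noteq> {}"
    using assms subspace_0 by blast
  then have "\<exists>z\<in>Z. dist x z < infdist x Z + e"
    using assms(2) by (subst cINF_less_iff[symmetric]) (auto simp: infdist_def)
  with that show thesis
    by (auto simp: dist_norm)
qed

lemma sublinear_infdist:
  fixes Z :: "'a::real_normed_vector set"
  assumes Z: "subspace Z"
  shows "sublinear (\<lambda>x. infdist x Z)"
  unfolding sublinear_def
proof (intro conjI allI impI)
  fix x y
  show "infdist (x + y) Z \<le> infdist x Z + infdist y Z"
  proof (rule field_le_epsilon)
    fix e :: real assume "e > 0"
    then have "e / 2 > 0" by simp
    obtain w where w: "w \<in> Z" "norm (x - w) < infdist x Z + e / 2"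
      using infdist_subspace_approx[OF Z \<open>e / 2 > 0\<close>] .
    obtain z where z: "z \<in> Z" "norm (y - z) < infdist y Z + e / 2"
      using infdist_subspace_approx[OF Z \<open>e / 2 > 0\<close>] .
    have "infdist (x + y) Z \<le> norm ((x + y) - (w + z))"
      using w z Z by (intro infdist_subspace_le) (auto simp: subspace_add)
    also have "\<dots> = norm ((x - w) + (y - z))"
      by (simp add: algebra_simps)
    also have "\<dots> \<le> norm (x - w) + norm (y - z)"
      by (rule norm_triangle_ineq)
    finally show "infdist (x + y) Z \<le> infdist x Z + infdist y Z + e"
      using w z by simp
  qed
next
  have scale: "infdist (c *\<^sub>R x) Z \<le> c * infdist x Z" if c: "c > 0" for c :: real and x
  proof (rule field_le_epsilon)
    fix e :: real assume "e > 0"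
    with c have "e / c > 0" by simp
    then obtain z where z: "z \<in> Z" "norm (x - z) < infdist x Z + e / c"
      using infdist_subspace_approx[OF Z] by blast
    have "infdist (c *\<^sub>R x) Z \<le> norm (c *\<^sub>R x - c *\<^sub>R z)"
      using z Z by (intro infdist_subspace_le) (auto simp: subspace_scale)
    also have "\<dots> = c * norm (x - z)"
      using c by (simp flip: scaleR_diff_right)
    also have "\<dots> \<le> c * (infdist x Z + e / c)"
      using z c by (intro mult_left_mono) auto
    also have "\<dots> = c * infdist x Z + e"
      using c by (simp add: distrib_left)
    finally show "infdist (c *\<^sub>R x) Z \<le> c * infdist x Z + e" .
  qed
  fix c :: real and x :: 'a assume c: "c > 0"
  have "infdist x Z \<le> inverse c * infdist (c *\<^sub>R x) Z"
    using scale[of "inverse c" "c *\<^sub>R x"] c by simp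
  with scale[OF c, of x] c show "infdist (c *\<^sub>R x) Z = c * infdist x Z"
    by (simp add: field_simps)
qed

text \<open>The distance to \<open>Z\<close> is the quotient seminorm, hence sublinear, and a linear
  functional below it vanishes on \<open>Z\<close>. For \<open>Z = {0}\<close> this gives norming
  functionals, for general \<open>Z\<close> functionals that separate points modulo
  \<open>Z\<close>.\<close>

corollary Hahn_Banach_infdist:
  fixes Z :: "'a::real_normed_vector set"
  assumes Z: "subspace Z"
  obtains g :: "'a \<Rightarrow>\<^sub>L real"
    where "\<And>x. \<bar>blinfun_apply g x\<bar> \<le> infdist x Z" "blinfun_apply g v = infdist v Z"
proof -
  obtain g where g: "linear g" "\<And>x. g x \<le> infdist x Z" "g v = infdist v Z"
    using Hahn_Banach_sublinear[OF sublinear_infdist[OF Z]] by metis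
  have abs: "\<bar>g x\<bar> \<le> infdist x Z" for x
  proof -
    have "infdist (- x) Z \<le> infdist x Z"
    proof (rule field_le_epsilon)
      fix e :: real assume "e > 0"
      then obtain z where z: "z \<in> Z" "norm (x - z) < infdist x Z + e"
        using infdist_subspace_approx[OF Z] by blast
      have "infdist (- x) Z \<le> norm (- x - (- z))"
        using z Z by (intro infdist_subspace_le) (auto simp: subspace_neg)
      also have "\<dots> = norm (x - z)"
        by (simp add: norm_minus_commute)
      finally show "infdist (- x) Z \<le> infdist x Z + e"
        using z by simp
    qed
    then show ?thesis
      using g(2)[of x] g(2)[of "- x"] linear_neg[OF g(1), of x] by (auto simp: abs_le_iff)
  qed
  have "\<bar>g x\<bar> \<le> norm x * 1" for x
    using abs[of x] infdist_subspace_le[OF subspace_0[OF Z], of x] by simp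
  then have "bounded_linear g"
    using g(1) by (intro bounded_linear_intro[of _ 1]) (auto simp: linear_add linear_scale)
  then show thesis
    using abs g(3) by (intro that[of "Blinfun g"]) (auto simp: bounded_linear_Blinfun_apply)
qed

corollary Hahn_Banach_norm:
  fixes v :: "'a::real_normed_vector"
  obtains g :: "'a \<Rightarrow>\<^sub>L real"
    where "\<And>x. \<bar>blinfun_apply g x\<bar> \<le> norm x" "blinfun_apply g v = norm v"
proof -
  have "subspace {0 :: 'a}" "\<And>x :: 'a. infdist x {0} = norm x"
    by (auto simp: subspace_def dist_norm)
  then show thesis
    using Hahn_Banach_infdist[of "{0}" v] that by metis
qed

text \<open>The two inequalities do everything: they make the decomposition unique, they turn a
  convergent sequence of sums into Cauchy sequences of summands, so that the dense sum is the whole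
  space, and they bound \<open>P\<close> and \<open>id_blinfun - P\<close>.\<close>

lemma complementary_projection:
  fixes M N :: "'a::banach set"
  assumes M: "subspace M" "closed M" and N: "subspace N" "closed N"
    and le: "\<And>y z. y \<in> M \<Longrightarrow> z \<in> N \<Longrightarrow> norm y \<le> norm (y + z) \<and> norm z \<le> norm (y + z)"
    and dense: "closure {y + z |y z. y \<in> M \<and> z \<in> N} = UNIV"
  obtains P :: "'a \<Rightarrow>\<^sub>L 'a" where "\<And>y. y \<in> M \<Longrightarrow> P y = y" "\<And>z. z \<in> N \<Longrightarrow> P z = 0"
    "range P = M" "projection P" "norm P \<le> 1" "norm (id_blinfun - P) \<le> 1"
proof -
  have uniq: "y = y' \<and> z = z'" if "y \<in> M" "z \<in> N" "y' \<in> M" "z' \<in> N" "y + z = y' + z'" for y z y' z'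
    using le[of "y - y'" "z - z'"] that M N by (auto simp: subspace_diff algebra_simps)
  have ex: "\<exists>y z. y \<in> M \<and> z \<in> N \<and> v = y + z" for v
  proof -
    have "v \<in> closure {y + z |y z. y \<in> M \<and> z \<in> N}"
      using dense by simp
    then obtain u where u: "\<And>n::nat. u n \<in> {y + z |y z. y \<in> M \<and> z \<in> N}" "u \<longlonglongrightarrow> v"
      unfolding closure_sequential by blast
    then have "\<forall>n. \<exists>y z. y \<in> M \<and> z \<in> N \<and> u n = y + z"
      by blast
    then obtain y z where yz: "\<And>n. y n \<in> M" "\<And>n. z n \<in> N" "\<And>n. u n = y n + z n"
      by metis
    have "Cauchy u"
      using u(2) LIMSEQ_imp_Cauchy by blast
    have "norm (y m - y n) \<le> norm (u m - u n)" for m n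
      using le[of "y m - y n" "z m - z n"] yz M N by (auto simp: subspace_diff algebra_simps)
    with \<open>Cauchy u\<close> have "Cauchy y"
      unfolding Cauchy_def dist_norm by (meson le_less_trans)
    then obtain l where l: "y \<longlonglongrightarrow> l"
      using Cauchy_convergent convergent_def by blast
    have "(\<lambda>n. u n - y n) \<longlonglongrightarrow> v - l"
      using u(2) l by (rule tendsto_diff)
    then have "z \<longlonglongrightarrow> v - l"
      using yz(3) by simp
    then have "v - l \<in> N"
      using closed_sequentially[OF N(2)] yz(2) by blast
    moreover have "l \<in> M"
      using closed_sequentially[OF M(2)] yz(1) l by blast
    ultimately show ?thesis
      by (metis add.commute diff_add_cancel)
  qed
  then obtain p q where pq: "\<And>v. p v \<in> M" "\<And>v. q v \<in> N" "\<And>v. v = p v + q v"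
    by metis
  have eq: "p v = y" if "y \<in> M" "z \<in> N" "v = y + z" for v y z
    using uniq[OF pq(1,2) that(1,2)] pq(3) that(3) by metis
  have add: "p (v + w) = p v + p w" for v w
    using pq(1-2)[of v] pq(1-2)[of w] pq(3)[of v] pq(3)[of w] M N
    by (intro eq[of _ "q v + q w"]) (auto simp: subspace_add algebra_simps)
  have scale: "p (c *\<^sub>R v) = c *\<^sub>R p v" for c v
    using pq(1-2)[of v] pq(3)[of v] M N
    by (intro eq[of _ "c *\<^sub>R q v"]) (auto simp: subspace_scale simp flip: scaleR_right_distrib)
  have nrm: "norm (p v) \<le> norm v" "norm (v - p v) \<le> norm v" for v
  proof -
    show "norm (p v) \<le> norm v"
      using le[OF pq(1,2), of v v] pq(3)[of v] by simp
    have "v - p v = q v"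
      using pq(3)[of v] by (metis add_diff_cancel_left')
    then show "norm (v - p v) \<le> norm v"
      using le[OF pq(1,2), of v v] pq(3)[of v] by simp
  qed
  have "bounded_linear p"
    by (rule bounded_linear_intro[of _ 1]) (use add scale nrm in auto)
  then have P[simp]: "blinfun_apply (Blinfun p) = p"
    by (rule bounded_linear_Blinfun_apply)
  have fixM: "p y = y" if "y \<in> M" for y
    using that N by (intro eq[of _ 0]) (auto simp: subspace_0)
  show thesis
  proof (rule that[of "Blinfun p"])
    show "range (Blinfun p) = M"
      using pq(1) fixM by (auto simp: image_iff) metis
    show "projection (Blinfun p)"
      unfolding projection_def by (rule blinfun_eqI) (simp add: fixM pq(1))
    show "norm (Blinfun p) \<le> 1" "norm (id_blinfun - Blinfun p) \<le> 1"
      using nrm by (auto intro!: norm_blinfun_bound simp: blinfun.diff_left)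
    show "blinfun_apply (Blinfun p) z = 0" if "z \<in> N" for z
      using that M by (simp, intro eq[of _ z]) (auto simp: subspace_0)
  qed (use fixM in auto)
qed

text \<open>A projection fixes the nonzero vector \<open>P v\<close>, so its norm cannot be less
  than 1.\<close>

lemma norm_projection_eq_1:
  fixes P :: "'a::real_normed_vector \<Rightarrow>\<^sub>L 'a"
  assumes "projection P" "norm P \<le> 1" "P v \<noteq> 0"
  shows "norm P = 1"
proof -
  have "norm (P v) = norm (P (P v))"
    using assms(1) unfolding projection_def by (metis blinfun_apply_blinfun_compose)
  also have "\<dots> \<le> norm P * norm (P v)"
    by (rule norm_blinfun)
  finally show ?thesis
    using assms(2,3) by simp
qed


section \<open>Density characters\<close>

lemma countable_iff_card_of: "countable A \<longleftrightarrow> |A| \<le>o natLeq"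
proof -
  have "countable A \<longleftrightarrow> |A| \<le>o |UNIV :: nat set|"
    by (simp add: countable_def flip: card_of_ordLeq)
  then show ?thesis
    using card_of_nat ordLeq_ordIso_trans ordIso_symmetric by blast
qed

lemma countable_card_of_le: "countable A \<Longrightarrow> Cinfinite r \<Longrightarrow> |A| \<le>o r"
  using countable_iff_card_of natLeq_ordLeq_cinfinite ordLeq_transitive by blast

lemma Times_Cinfinite_bound:
  assumes "|A| \<le>o r" "|B| \<le>o r" "Cinfinite r"
  shows "|A \<times> B| \<le>o r"
  using assms by (intro card_of_Times_ordLeq_infinite_Field) (auto simp: cinfinite_def)

text \<open>Lists stand in for finite subsets and for finite linear combinations. Each length adds
  one factor \<open>A\<close>, and there are countably many lengths.\<close>

lemma lists_Cinfinite_bound: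
  assumes A: "|A| \<le>o r" and r: "Cinfinite r"
  shows "|lists A| \<le>o r"
proof -
  have len: "|{l \<in> lists A. length l = n}| \<le>o r" for n
  proof (induction n)
    case 0
    have "countable {l \<in> lists A. length l = 0}"
      by (rule countable_subset[of _ "{[]}"]) auto
    then show ?case
      using r by (rule countable_card_of_le)
  next
    case (Suc n)
    have "{l \<in> lists A. length l = Suc n} \<subseteq> (\<lambda>(a, l). a # l) ` (A \<times> {l \<in> lists A. length l = n})"
      by (fastforce simp: length_Suc_conv)
    then have "|{l \<in> lists A. length l = Suc n}| \<le>o |A \<times> {l \<in> lists A. length l = n}|"
      by (rule surj_imp_ordLeq)
    then show ?case
      using Times_Cinfinite_bound[OF A Suc r] ordLeq_transitive by blast
  qed
  have "lists A = (\<Union>n. {l \<in> lists A. length l = n})"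
    by auto
  moreover have "|\<Union>n. {l \<in> lists A. length l = n}| \<le>o r"
    using len r by (intro UNION_Cinfinite_bound countable_card_of_le) auto
  ultimately show ?thesis by simp
qed

lemma Cinfinite_csum_natLeq: "Cinfinite (r +c natLeq)"
  using natLeq_Cinfinite by (rule Cinfinite_csum[OF disjI2])

lemma csum_natLeq_le: "|A| \<le>o r \<Longrightarrow> Cinfinite r \<Longrightarrow> |A| +c natLeq \<le>o r"
  by (intro csum_cinfinite_bound natLeq_ordLeq_cinfinite) (auto simp: card_of_Card_order natLeq_Card_order)

section \<open>Dense subsets of least cardinality\<close>

lemma Cinfinite_density: "Cinfinite (density M d)"
  unfolding density_def by (rule Cinfinite_csum_natLeq)

text \<open>Cardinals are well-ordered, so once some dense set exists, the choice in the definition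
  of \<open>density\<close> has a witness.\<close>

lemma density_minimal:
  assumes "metric_dense M d D"
  obtains D\<^sub>0 where "metric_dense M d D\<^sub>0" "density M d = |D\<^sub>0| +c natLeq" "|D\<^sub>0| \<le>o |D|"
proof -
  let ?P = "\<lambda>D. metric_dense M d D \<and> (\<forall>D'. metric_dense M d D' \<longrightarrow> |D| \<le>o |D'| )"
  have "\<exists>r\<in>card_of ` {D. metric_dense M d D}. \<forall>r'\<in>card_of ` {D. metric_dense M d D}. r \<le>o r'"
    using assms by (intro exists_minim_Card_order) (auto simp: card_of_Card_order)
  then have "\<exists>D. ?P D" by auto
  then have "?P (SOME D. ?P D)" by (rule someI_ex)
  with assms that show thesis
    unfolding density_def by blast
qed

lemma density_le: "metric_dense M d D \<Longrightarrow> density M d \<le>o |D| +c natLeq"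
  by (rule density_minimal) (auto intro: csum_mono1)

lemma density_dense_subset:
  assumes "metric_dense M d D"
  obtains D\<^sub>0 where "metric_dense M d D\<^sub>0" "|D\<^sub>0| \<le>o density M d"
proof (rule density_minimal[OF assms])
  fix D\<^sub>0 assume "metric_dense M d D\<^sub>0" "density M d = |D\<^sub>0| +c natLeq"
  then show thesis
    using that ordLeq_csum1[OF card_of_Card_order, of D\<^sub>0 natLeq] by simp
qed

lemma metric_dense_dist_iff: "metric_dense S dist D \<longleftrightarrow> D \<subseteq> S \<and> S \<subseteq> closure D"
  by (auto simp: metric_dense_def closure_approachable subset_iff dist_commute)

lemma Cinfinite_dens: "Cinfinite (dens S)"
  unfolding dens_def by (rule Cinfinite_density)

lemma dens_dense_subset:
  obtains D where "D \<subseteq> S" "S \<subseteq> closure D" "|D| \<le>o dens S"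
proof -
  have "metric_dense S dist S"
    by (simp add: metric_dense_dist_iff closure_subset)
  then show thesis
    by (rule density_dense_subset) (use that in \<open>auto simp: dens_def metric_dense_dist_iff\<close>)
qed

text \<open>The approximating set \<open>D\<close> may lie outside \<open>S\<close>. Each of its
  points is replaced, for every radius \<open>1 / (n + 1)\<close>, by a point of \<open>S\<close>
  within that radius if there is one; this costs only a factor \<aleph>0. Monotonicity of
  \<open>dens\<close> depends on this freedom.\<close>

lemma dens_le:
  fixes S :: "'a::real_normed_vector set"
  assumes S: "S \<subseteq> closure D" and D: "|D| \<le>o r" and r: "Cinfinite r"
  shows "dens S \<le>o r"
proof -
  define near where "near = (\<lambda>(c, n :: nat). SOME y. y \<in> S \<and> dist y c < inverse (real (Suc n)))"
  define E where "E = near ` {(c, n) \<in> D \<times> UNIV. \<exists>y\<in>S. dist y c < inverse (real (Suc n))}"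
  have near: "near (c, n) \<in> S \<and> dist (near (c, n)) c < inverse (real (Suc n))"
    if "\<exists>y\<in>S. dist y c < inverse (real (Suc n))" for c n
    using someI_ex[of "\<lambda>y. y \<in> S \<and> dist y c < inverse (real (Suc n))"] that
    by (auto simp: near_def)
  have "metric_dense S dist E"
    unfolding metric_dense_def
  proof (intro conjI ballI allI impI)
    show "E \<subseteq> S"
      using near by (auto simp: E_def)
    fix s and e :: real assume s: "s \<in> S" "e > 0"
    then obtain n :: nat where n: "inverse (real (Suc n)) < e / 2"
      using reals_Archimedean[of "e / 2"] by auto
    obtain c where c: "c \<in> D" "dist c s < inverse (real (Suc n))"
      using s S by (metis closure_approachable inverse_positive_iff_positive of_nat_0_less_iff
          subset_iff zero_less_Suc)
    then have ex: "\<exists>y\<in>S. dist y c < inverse (real (Suc n))"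
      using s by (auto simp: dist_commute)
    have "near (c, n) \<in> E"
      using ex c by (auto simp: E_def)
    moreover have "dist s (near (c, n)) < e"
      using near[OF ex] c n dist_triangle[of s "near (c, n)" c] by (simp add: dist_commute)
    ultimately show "\<exists>y\<in>E. dist s y < e" by blast
  qed
  then have "dens S \<le>o |E| +c natLeq"
    unfolding dens_def by (rule density_le)
  moreover have "|E| \<le>o r"
  proof -
    have "|E| \<le>o |D \<times> (UNIV :: nat set)|"
      unfolding E_def by (rule surj_imp_ordLeq[of _ near]) auto
    also have "|D \<times> (UNIV :: nat set)| \<le>o r"
      by (rule Times_Cinfinite_bound[OF D countable_card_of_le[OF _ r] r]) simp
    finally show ?thesis .
  qed
  ultimately show ?thesis
    using csum_natLeq_le r ordLeq_transitive by blast
qed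

lemma dens_mono: "S \<subseteq> T \<Longrightarrow> dens S \<le>o dens T"
proof (rule dens_dense_subset[of T])
  fix D assume "S \<subseteq> T" "T \<subseteq> closure D" "|D| \<le>o dens T"
  then show "dens S \<le>o dens T"
    by (intro dens_le[of S D] Cinfinite_dens) auto
qed

lemma closure_of_top_of_set: "D \<subseteq> S \<Longrightarrow> top_of_set S closure_of D = S \<inter> closure D"
  by (simp add: closure_of_subtopology inf.absorb2)

lemma separable_dens_le:
  assumes "separable_space (top_of_set S)"
  shows "dens S \<le>o natLeq"
proof -
  obtain D where "countable D" "D \<subseteq> S" "top_of_set S closure_of D = S"
    using assms by (auto simp: separable_space_def)
  then have "S \<subseteq> closure D"
    using closure_of_top_of_set[of D S] by blast
  then show ?thesis
    using \<open>countable D\<close> by (intro dens_le natLeq_Cinfinite) (auto simp: countable_iff_card_of)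
qed

lemma countable_dense_subset:
  assumes "dens S \<le>o natLeq"
  obtains D where "countable D" "D \<subseteq> S" "S \<subseteq> closure D"
proof (rule dens_dense_subset[of S])
  fix D assume D: "D \<subseteq> S" "S \<subseteq> closure D" "|D| \<le>o dens S"
  then have "countable D"
    using assms ordLeq_transitive countable_iff_card_of by metis
  then show thesis
    using D that by simp
qed

lemma separable_spaceI_dens:
  assumes "dens S \<le>o natLeq"
  shows "separable_space (top_of_set S)"
proof -
  obtain D where D: "countable D" "D \<subseteq> S" "S \<subseteq> closure D"
    using assms by (rule countable_dense_subset)
  then have "top_of_set S closure_of D = S"
    using closure_of_top_of_set[of D S] by blast
  then show ?thesis
    using D by (auto simp: separable_space_def)
qed

text \<open>Joint continuity of scalar multiplication recovers real scalars from rational ones, so a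
  dense set can be kept small.\<close>

lemma subspace_closure_rat:
  fixes D :: "'a::real_normed_vector set"
  assumes "0 \<in> D" and add: "\<And>v w. v \<in> D \<Longrightarrow> w \<in> D \<Longrightarrow> v + w \<in> D"
    and scale_rat: "\<And>q v. q \<in> \<rat> \<Longrightarrow> v \<in> D \<Longrightarrow> q *\<^sub>R v \<in> D"
  shows "subspace (closure D)"
  unfolding subspace_def
proof (intro conjI ballI allI)
  show "0 \<in> closure D"
    using assms(1) closure_subset by blast
next
  fix v w assume "v \<in> closure D" "w \<in> closure D"
  then obtain a b where "\<And>n::nat. a n \<in> D" "a \<longlonglongrightarrow> v" "\<And>n::nat. b n \<in> D" "b \<longlonglongrightarrow> w"
    unfolding closure_sequential by blast
  then have "(\<lambda>n. a n + b n) \<longlonglongrightarrow> v + w" "\<And>n. a n + b n \<in> D"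
    by (auto intro: tendsto_add add)
  then show "v + w \<in> closure D"
    unfolding closure_sequential by (intro exI[of _ "\<lambda>n. a n + b n"]) simp
next
  fix c :: real and v assume "v \<in> closure D"
  then obtain a where a: "\<And>n::nat. a n \<in> D" "a \<longlonglongrightarrow> v"
    unfolding closure_sequential by blast
  have "c \<in> closure \<rat>"
    using Rats_dense_in_real[of c "c + e" for e]
    by (auto simp: closure_approachable dist_real_def) (metis abs_of_pos add_less_cancel_left
        diff_add_cancel diff_gt_0_iff_gt add.commute)
  then obtain q where q: "\<And>n::nat. q n \<in> \<rat>" "q \<longlonglongrightarrow> c"
    unfolding closure_sequential by blast
  have "(\<lambda>n. q n *\<^sub>R a n) \<longlonglongrightarrow> c *\<^sub>R v" "\<And>n. q n *\<^sub>R a n \<in> D"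
    using a q by (auto intro: tendsto_scaleR scale_rat)
  then show "c *\<^sub>R v \<in> closure D"
    unfolding closure_sequential by (intro exI[of _ "\<lambda>n. q n *\<^sub>R a n"]) simp
qed

text \<open>Rational combinations are coded by lists of pairs: appending lists adds the sums, and
  the bound for lists counts them.\<close>

lemma span_dense_subset:
  fixes S :: "'a::real_normed_vector set"
  assumes S: "|S| \<le>o r" and r: "Cinfinite r"
  obtains D where "D \<subseteq> span S" "span S \<subseteq> closure D" "|D| \<le>o r"
proof
  define comb :: "(real \<times> 'a) list \<Rightarrow> 'a" where "comb l = (\<Sum>(q, s)\<leftarrow>l. q *\<^sub>R s)" for l
  define D where "D = comb ` lists (\<rat> \<times> S)"
  have comb_simps: "comb [] = 0" "comb (p # l) = fst p *\<^sub>R snd p + comb l"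
    "comb (l @ m) = comb l + comb m" for p l m
    by (auto simp: comb_def split: prod.splits)
  show "D \<subseteq> span S"
  proof
    fix v assume "v \<in> D"
    then obtain l where "l \<in> lists (\<rat> \<times> S)" "v = comb l"
      by (auto simp: D_def)
    moreover have "l \<in> lists (\<rat> \<times> S) \<Longrightarrow> comb l \<in> span S" for l
      by (induction l) (auto simp: comb_simps span_zero span_base intro!: span_add span_scale)
    ultimately show "v \<in> span S" by simp
  qed
  have "|\<rat> \<times> S| \<le>o r"
    using Times_Cinfinite_bound[OF countable_card_of_le[OF countable_rat r] S r] .
  then show "|D| \<le>o r"
    unfolding D_def by (intro ordLeq_transitive[OF card_of_image] lists_Cinfinite_bound r)
  have zero: "0 \<in> D"
    unfolding D_def by (intro image_eqI[of _ _ "[]"]) (auto simp: comb_simps)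
  have add: "v + w \<in> D" if vw: "v \<in> D" "w \<in> D" for v w
  proof -
    obtain l m where "l \<in> lists (\<rat> \<times> S)" "v = comb l" "m \<in> lists (\<rat> \<times> S)" "w = comb m"
      using vw unfolding D_def by blast
    then have "v + w = comb (l @ m)" "l @ m \<in> lists (\<rat> \<times> S)"
      by (auto simp: comb_simps)
    then show ?thesis
      unfolding D_def by (rule image_eqI)
  qed
  have scale_rat: "q *\<^sub>R v \<in> D" if qv: "q \<in> \<rat>" "v \<in> D" for q v
  proof -
    obtain l where l: "l \<in> lists (\<rat> \<times> S)" "v = comb l"
      using qv unfolding D_def by blast
    have "comb (map (\<lambda>(p, s). (q * p, s)) l) = q *\<^sub>R comb l" for l
      by (induction l) (auto simp: comb_simps algebra_simps)
    moreover have "map (\<lambda>(p, s). (q * p, s)) l \<in> lists (\<rat> \<times> S)"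
      using l qv(1) by (auto simp: lists_eq_set)
    ultimately show ?thesis
      using l unfolding D_def by (metis imageI)
  qed
  have base: "s \<in> D" if "s \<in> S" for s
    unfolding D_def using that by (intro image_eqI[of _ _ "[(1, s)]"]) (auto simp: comb_simps)
  have "subspace (closure D)"
    using zero add scale_rat by (rule subspace_closure_rat)
  then show "span S \<subseteq> closure D"
    using base closure_subset by (intro span_minimal) auto
qed

section \<open>Closed linear spans and the size of biorthogonal systems\<close>

lemma subspace_closed_span: "subspace (closed_span S)"
  unfolding closed_span_def
  by (rule subspace_closure_rat) (auto simp: span_zero span_add span_scale)

lemma closed_closed_span: "closed (closed_span S)"
  by (simp add: closed_span_def)

lemma span_le_closed_span: "span S \<subseteq> closed_span S"
  by (simp add: closed_span_def closure_subset)

lemma closed_span_base: "S \<subseteq> closed_span S"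
  using span_le_closed_span span_superset by blast

lemma closed_span_mono: "S \<subseteq> T \<Longrightarrow> closed_span S \<subseteq> closed_span T"
  unfolding closed_span_def by (intro closure_mono span_mono)

lemma closed_span_minimal: "S \<subseteq> T \<Longrightarrow> subspace T \<Longrightarrow> closed T \<Longrightarrow> closed_span S \<subseteq> T"
  unfolding closed_span_def by (intro closure_minimal span_minimal)

lemma dens_closed_span:
  fixes S :: "'a::real_normed_vector set"
  assumes "|S| \<le>o r" "Cinfinite r"
  shows "dens (closed_span S) \<le>o r"
proof -
  obtain D where D: "span S \<subseteq> closure D" "|D| \<le>o r"
    using span_dense_subset[OF assms] by metis
  then have "closed_span S \<subseteq> closure D"
    unfolding closed_span_def by (simp add: closure_minimal)
  then show ?thesis
    using D assms by (intro dens_le)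
qed

text \<open>The vectors are separated, though not uniformly: \<open>f i\<close> keeps
  \<open>x i\<close> at distance at least \<open>1 / norm (f i)\<close> from the others. With radii
  adapted to \<open>i\<close>, points of a dense set chosen near the vectors are distinct.\<close>

lemma biorthogonal_card_le_dens:
  fixes x :: "'i \<Rightarrow> 'a::real_normed_vector" and f :: "'i \<Rightarrow> 'a \<Rightarrow>\<^sub>L real"
  assumes bi: "\<And>i j. i \<in> I \<Longrightarrow> j \<in> I \<Longrightarrow> f i (x j) = (if i = j then 1 else 0)"
  shows "|I| \<le>o dens (UNIV :: 'a set)"
proof -
  obtain D :: "'a set" where D: "UNIV \<subseteq> closure D" "|D| \<le>o dens (UNIV :: 'a set)"
    using dens_dense_subset by metis
  \<comment> \<open>The summand 1 keeps the radius positive also for indices outside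
    \<open>I\<close>, where \<open>f i\<close> may be zero.\<close>
  define e where "e i = inverse (norm (f i) + 1) / 2" for i
  have e_pos: "e i > 0" for i
    by (simp add: e_def add_nonneg_pos)
  have "\<forall>i. \<exists>y\<in>D. dist y (x i) < e i"
    using D(1) e_pos by (auto simp: closure_approachable subset_iff)
  then obtain y where y: "\<And>i. y i \<in> D" "\<And>i. dist (y i) (x i) < e i"
    by metis
  have far: "2 * e i \<le> norm (x i - x j)" if "i \<in> I" "j \<in> I" "i \<noteq> j" for i j
  proof -
    have "1 = \<bar>f i (x i - x j)\<bar>"
      using bi that by (simp add: blinfun.diff_right)
    also have "\<dots> \<le> norm (f i) * norm (x i - x j)"
      using norm_blinfun[of "f i" "x i - x j"] by simp
    also have "\<dots> \<le> (norm (f i) + 1) * norm (x i - x j)"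
      by (intro mult_right_mono) auto
    finally have "inverse (norm (f i) + 1) \<le> norm (x i - x j)"
      by (simp add: inverse_eq_divide divide_le_eq add_nonneg_pos mult.commute)
    moreover have "2 * e i = inverse (norm (f i) + 1)"
      by (simp add: e_def)
    ultimately show ?thesis by simp
  qed
  have "inj_on y I"
  proof (rule inj_onI, rule ccontr)
    fix i j assume ij: "i \<in> I" "j \<in> I" "y i = y j" "i \<noteq> j"
    have "norm (x i - x j) < e i + e j"
      using y(2)[of i] y(2)[of j] dist_triangle3[of "x i" "x j" "y i"] ij(3)
      by (simp add: dist_norm)
    moreover have "2 * e i \<le> norm (x i - x j)" "2 * e j \<le> norm (x i - x j)"
      using far[of i j] far[of j i] ij by (auto simp: norm_minus_commute)
    ultimately show False by linarith
  qed
  then have "|I| \<le>o |D|"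
    using y(1) by (intro card_of_ordLeqI) auto
  then show ?thesis
    using D(2) ordLeq_transitive by blast
qed


section \<open>Decoupled sets of indices\<close>

lemma span_image_finite:
  assumes "v \<in> span (h ` I)"
  obtains F where "finite F" "F \<subseteq> I" "v \<in> span (h ` F)"
proof -
  obtain t r where t: "finite t" "t \<subseteq> h ` I" "v = (\<Sum>a\<in>t. r a *\<^sub>R a)"
    using assms unfolding span_explicit by blast
  then obtain F where "F \<subseteq> I" "finite F" "t = h ` F"
    using finite_subset_image[OF t(1,2)] by blast
  then show thesis
    using t by (intro that[of F]) (auto intro: span_sum span_scale span_base)
qed

lemma weak_star_closure_zero:
  fixes g :: "'a::real_normed_vector \<Rightarrow>\<^sub>L real"
  assumes "g \<in> weak_star_topology closure_of S" "\<And>h. h \<in> S \<Longrightarrow> blinfun_apply h v = 0"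
  shows "g v = 0"
proof -
  have "closedin weak_star_topology {h \<in> topspace weak_star_topology. blinfun_apply h v \<in> {0 :: real}}"
    by (rule closedin_continuous_map_preimage[OF strong_operator_topology_continuous_evaluation]) simp
  then have "closedin weak_star_topology {h. blinfun_apply h v = (0 :: real)}"
    by (simp add: strong_operator_topology_topspace)
  then have "weak_star_topology closure_of S \<subseteq> {h. blinfun_apply h v = 0}"
    using assms(2) by (intro closure_of_minimal) auto
  then show ?thesis
    using assms(1) by blast
qed

text \<open>Property (C) places \<open>g\<close> in the weak-star closed convex hull of countably
  many functionals, each a combination of finitely many \<open>f j\<close>. At an index that none of
  them uses, the whole hull vanishes, and so does \<open>g\<close> because evaluation is weak-star
  continuous.\<close>

lemma M_basis_countable_support:
  fixes x :: "'i \<Rightarrow> 'a::real_normed_vector" and g :: "'a \<Rightarrow>\<^sub>L real"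
  assumes M: "M_basis I x f" and C: "property_C TYPE('a)"
  shows "countable {i \<in> I. g (x i) \<noteq> 0}"
proof -
  have "g \<in> weak_star_topology closure_of span (f ` I)"
    using M by (simp add: M_basis_def)
  then have "\<exists>\<Gamma>\<subseteq>span (f ` I). countable \<Gamma> \<and> g \<in> weak_star_topology closure_of (convex hull \<Gamma>)"
    by (rule C[unfolded property_C_def, rule_format])
  then obtain \<Gamma> where \<Gamma>: "\<Gamma> \<subseteq> span (f ` I)" "countable \<Gamma>"
    "g \<in> weak_star_topology closure_of (convex hull \<Gamma>)"
    by (elim exE conjE)
  have "\<exists>F. finite F \<and> F \<subseteq> I \<and> \<gamma> \<in> span (f ` F)" if "\<gamma> \<in> \<Gamma>" for \<gamma>
    using span_image_finite[OF subsetD[OF \<Gamma>(1) that]] by metis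
  then obtain F where F: "\<And>\<gamma>. \<gamma> \<in> \<Gamma> \<Longrightarrow> finite (F \<gamma>) \<and> F \<gamma> \<subseteq> I \<and> \<gamma> \<in> span (f ` F \<gamma>)"
    by metis
  have "g (x i) = 0" if i: "i \<in> I" "i \<notin> \<Union>(F ` \<Gamma>)" for i
  proof (rule weak_star_closure_zero[OF \<Gamma>(3)])
    let ?K = "{h. blinfun_apply h (x i) = 0}"
    have K: "subspace ?K"
      by (auto simp: subspace_def blinfun.add_left blinfun.scaleR_left)
    have "\<Gamma> \<subseteq> ?K"
    proof
      fix \<gamma> assume \<gamma>: "\<gamma> \<in> \<Gamma>"
      have "blinfun_apply (f j) (x i) = 0" if "j \<in> F \<gamma>" for j
      proof -
        have "j \<in> I" "j \<noteq> i"
          using F[OF \<gamma>] \<gamma> i that by blast+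
        then show ?thesis
          using M i(1) by (simp add: M_basis_def)
      qed
      then have "f ` F \<gamma> \<subseteq> ?K" by blast
      then have "span (f ` F \<gamma>) \<subseteq> ?K"
        using K by (rule span_minimal)
      then show "\<gamma> \<in> ?K"
        using F[OF \<gamma>] by blast
    qed
    then have "convex hull \<Gamma> \<subseteq> ?K"
      using K by (intro hull_minimal subspace_imp_convex)
    then show "blinfun_apply h (x i) = 0" if "h \<in> convex hull \<Gamma>" for h
      using that by blast
  qed
  then have "{i \<in> I. g (x i) \<noteq> 0} \<subseteq> \<Union>(F ` \<Gamma>)" by blast
  moreover have "countable (\<Union>(F ` \<Gamma>))"
    using \<Gamma>(2) F by (intro countable_UN) (auto intro: countable_finite)
  ultimately show ?thesis
    by (rule countable_subset)
qed

text \<open>Every \<open>f\<close> in the annihilator satisfies \<open>f z = f (y + z)\<close>, so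
  the supremum that equals \<open>norm z\<close> is at most \<open>norm (y + z)\<close>. If the
  annihilator is trivial, then \<open>z = 0\<close> by the convention for
  \<open>Psi\<close>.\<close>

lemma norm_le_Psi_annihilator:
  assumes z: "z \<in> Psi (annihilator Y)" and y: "y \<in> Y"
  shows "norm z \<le> norm (y + z)"
proof (cases "annihilator Y \<subseteq> {0}")
  case True
  then show ?thesis using z by (simp add: Psi_def)
next
  case False
  have "norm z = (SUP f\<in>annihilator Y - {0}. \<bar>blinfun_apply f z\<bar> / norm f)"
    using z False by (simp add: Psi_def)
  also have "\<dots> \<le> norm (y + z)"
  proof (rule cSUP_least)
    fix f assume f: "f \<in> annihilator Y - {0}"
    then have "blinfun_apply f z = blinfun_apply f (y + z)"
      using y by (simp add: annihilator_def blinfun.add_right)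
    then show "\<bar>blinfun_apply f z\<bar> / norm f \<le> norm (y + z)"
      using f norm_blinfun[of f "y + z"] by (simp add: divide_le_eq mult.commute)
  qed (use False in auto)
  finally show ?thesis .
qed

lemma quotient_dist_coset_less:
  assumes Z: "subspace Z" and less: "quotient_dist ((\<lambda>z. v + z) ` Z) ((\<lambda>z. w + z) ` Z) < e"
  shows "infdist (v - w) Z < e"
proof -
  let ?S = "{x - y |x y. x \<in> (\<lambda>z. v + z) ` Z \<and> y \<in> (\<lambda>z. w + z) ` Z}"
  have "?S \<noteq> {}"
    using subspace_0[OF Z] by blast
  then have "\<exists>u\<in>?S. norm u < e"
    using less unfolding quotient_dist_def quotient_norm_def
    by (subst cINF_less_iff[symmetric]) (auto intro!: bdd_belowI2[of _ 0])
  then obtain a b where ab: "a \<in> Z" "b \<in> Z" "norm ((v + a) - (w + b)) < e"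
    by auto
  then have "infdist (v - w) Z \<le> norm (v - w - (b - a))"
    using Z by (intro infdist_subspace_le) (auto simp: subspace_diff)
  also have "\<dots> < e"
    using ab(3) by (simp add: algebra_simps)
  finally show ?thesis .
qed

text \<open>Representatives turn a statement about cosets into one about vectors, to which
  Hahn-Banach functionals can be attached.\<close>

lemma quotient_space_countable_net:
  fixes Z :: "'a::real_normed_vector set"
  assumes Z: "subspace Z" and "codens Z \<le>o natLeq"
  obtains W where "countable W" "\<And>v e. e > 0 \<Longrightarrow> \<exists>w\<in>W. infdist (v - w) Z < e"
proof -
  \<comment> \<open>That a coset has distance 0 from itself makes the whole quotient dense in
    itself, so that a least dense set exists.\<close>
  have self: "quotient_dist C C < e" if C: "C \<in> quotient_space Z" and "e > 0" for C :: "'a set" and e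
  proof -
    obtain a where "a \<in> C"
      using C subspace_0[OF Z] by (auto simp: quotient_space_def)
    then have "0 \<in> {x - y |x y. x \<in> C \<and> y \<in> C}"
      by force
    then have "quotient_dist C C \<le> norm (0 :: 'a)"
      unfolding quotient_dist_def quotient_norm_def
      by (intro cINF_lower) (auto intro!: bdd_belowI2[of _ 0])
    then show ?thesis
      using \<open>e > 0\<close> by simp
  qed
  have "metric_dense (quotient_space Z) quotient_dist (quotient_space Z)"
    unfolding metric_dense_def using self by blast
  then obtain D where D: "metric_dense (quotient_space Z) quotient_dist D" "|D| \<le>o codens Z"
    unfolding codens_def by (rule density_dense_subset)
  have "\<forall>C\<in>D. \<exists>w. C = (\<lambda>z. w + z) ` Z"
    using D(1) unfolding metric_dense_def quotient_space_def by blast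
  then obtain rep where rep: "\<And>C. C \<in> D \<Longrightarrow> C = (\<lambda>z. rep C + z) ` Z"
    by metis
  show thesis
  proof
    have "countable D"
      using ordLeq_transitive[OF D(2) assms(2)] by (simp add: countable_iff_card_of)
    then show "countable (rep ` D)" by simp
    fix v :: 'a and e :: real assume "e > 0"
    moreover have "(\<lambda>z. v + z) ` Z \<in> quotient_space Z"
      unfolding quotient_space_def by (rule rangeI)
    ultimately obtain C where C: "C \<in> D" "quotient_dist ((\<lambda>z. v + z) ` Z) C < e"
      using D(1) unfolding metric_dense_def by blast
    then show "\<exists>w\<in>rep ` D. infdist (v - w) Z < e"
      using quotient_dist_coset_less[OF Z, of v "rep C" e] rep[OF C(1)] by auto
  qed
qed

text \<open>The index set stays arbitrary because the locale is used for a basis as given, for its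
  copy indexed by \<open>Field \<kappa>\<close>, and for permutations of that copy.\<close>

locale dd_basis =
  fixes I :: "'i set" and x :: "'i \<Rightarrow> 'a::banach" and f :: "'i \<Rightarrow> 'a \<Rightarrow>\<^sub>L real"
  assumes M_basis: "M_basis I x f"
    and property_C: "property_C TYPE('a)"
    and condition_dd: "condition_dd TYPE('a)"
    and nonseparable: "natLeq <o dens (UNIV :: 'a set)"
begin

section \<open>Norm inequalities between complementary spans\<close>

lemma countable_support:
  fixes g :: "'a \<Rightarrow>\<^sub>L real"
  shows "countable {i \<in> I. g (x i) \<noteq> 0}"
  by (rule M_basis_countable_support[OF M_basis property_C])

lemma basis_nonzero: "i \<in> I \<Longrightarrow> x i \<noteq> 0"
  using M_basis by (force simp: M_basis_def)

lemma closed_span_basis: "closed_span (x ` I) = UNIV"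
  using M_basis by (simp add: M_basis_def)

lemma blinfun_eq_on_basis:
  fixes P Q :: "'a \<Rightarrow>\<^sub>L 'b::real_normed_vector"
  assumes "\<And>i. i \<in> I \<Longrightarrow> P (x i) = Q (x i)"
  shows "P = Q"
proof -
  let ?K = "{v. P v - Q v = 0}"
  have "closed ?K"
    by (intro closed_Collect_eq continuous_intros)
  moreover have "subspace ?K"
    by (auto simp: subspace_def blinfun.add_right blinfun.scaleR_right)
  ultimately have "closed_span (x ` I) \<subseteq> ?K"
    using assms by (intro closed_span_minimal) auto
  then show ?thesis
    using closed_span_basis by (intro blinfun_eqI) auto
qed

text \<open>If \<open>g d\<close> norms \<open>d\<close> and vanishes at \<open>z\<close>, then
  \<open>norm d = g d (d + z) \<le> norm (d + z)\<close>. For fixed \<open>z\<close> this is a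
  closed condition on \<open>d\<close>, so a countable dense set of vectors \<open>d\<close>
  suffices.\<close>

lemma norming_support:
  assumes F: "countable F"
  obtains H where "countable H" "H \<subseteq> I"
    "\<And>y z. y \<in> span (x ` F) \<Longrightarrow> z \<in> span (x ` (I - H)) \<Longrightarrow> norm y \<le> norm (y + z)"
proof -
  have "|x ` F| \<le>o natLeq"
    using F by (simp flip: countable_iff_card_of)
  then obtain D where D: "span (x ` F) \<subseteq> closure D" "|D| \<le>o natLeq"
    by (rule span_dense_subset[OF _ natLeq_Cinfinite])
  have "\<exists>g :: 'a \<Rightarrow>\<^sub>L real. (\<forall>v. \<bar>g v\<bar> \<le> norm v) \<and> g d = norm d" for d :: 'a
    by (rule Hahn_Banach_norm[of d]) blast
  then obtain g :: "'a \<Rightarrow> 'a \<Rightarrow>\<^sub>L real" where g: "\<And>d v. \<bar>g d v\<bar> \<le> norm v" "\<And>d. g d d = norm d"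
    by metis
  define H where "H = (\<Union>d\<in>D. {i \<in> I. g d (x i) \<noteq> 0})"
  show thesis
  proof
    show "countable H" "H \<subseteq> I"
      using D(2) countable_support by (auto simp: H_def simp flip: countable_iff_card_of)
    fix y z assume y: "y \<in> span (x ` F)" and z: "z \<in> span (x ` (I - H))"
    have "norm d \<le> norm (d + z)" if d: "d \<in> D" for d
    proof -
      have "x ` (I - H) \<subseteq> {v. g d v = 0}"
        using d by (auto simp: H_def)
      moreover have "subspace {v. g d v = 0}"
        by (auto simp: subspace_def blinfun.add_right blinfun.scaleR_right)
      ultimately have "g d z = 0"
        using z span_minimal[of "x ` (I - H)" "{v. g d v = 0}"] by auto
      then show ?thesis
        using g(1)[of d "d + z"] g(2)[of d] by (simp add: blinfun.add_right)
    qed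
    moreover have "closed {d. norm d \<le> norm (d + z)}"
      by (intro closed_Collect_le continuous_intros)
    ultimately have "closure D \<subseteq> {d. norm d \<le> norm (d + z)}"
      by (intro closure_minimal) auto
    then show "norm y \<le> norm (y + z)"
      using y D(1) by blast
  qed
qed

lemma dd_support:
  assumes F: "countable F"
  obtains H where "countable H" "H \<subseteq> I"
    "\<And>y z. y \<in> span (x ` F) \<Longrightarrow> z \<in> span (x ` (I - H)) \<Longrightarrow> norm z \<le> norm (y + z)"
proof -
  let ?Y = "closed_span (x ` F)"
  have "|x ` F| \<le>o natLeq"
    using F by (simp flip: countable_iff_card_of)
  then have Y: "dens ?Y \<le>o natLeq"
    using natLeq_Cinfinite by (rule dens_closed_span)
  \<comment> \<open>Condition (d-d) applies because \<open>?Y\<close> is separable and the whole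
    space is not; its codensity bound then makes the quotient by \<open>Z\<close> separable.\<close>
  then have "dens ?Y <o dens (UNIV :: 'a set)"
    using nonseparable by (rule ordLeq_ordLess_trans)
  then have "\<exists>Z. subspace Z \<and> closed Z \<and> Z \<subseteq> Psi (annihilator ?Y) \<and> codens Z \<le>o dens ?Y"
    by (intro condition_dd[unfolded condition_dd_def, rule_format] conjI subspace_closed_span
        closed_closed_span)
  then obtain Z where Z: "subspace Z" "closed Z" "Z \<subseteq> Psi (annihilator ?Y)" "codens Z \<le>o dens ?Y"
    by blast
  have "codens Z \<le>o natLeq"
    using Z(4) Y by (rule ordLeq_transitive)
  then obtain W where W: "countable W" "\<And>v e. e > 0 \<Longrightarrow> \<exists>w\<in>W. infdist (v - w) Z < e"
    by (rule quotient_space_countable_net[OF Z(1)]) iprover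
  have "\<exists>g :: 'a \<Rightarrow>\<^sub>L real. (\<forall>v. \<bar>g v\<bar> \<le> infdist v Z) \<and> g w = infdist w Z" for w
    by (rule Hahn_Banach_infdist[OF Z(1), of w]) blast
  then obtain g :: "'a \<Rightarrow> 'a \<Rightarrow>\<^sub>L real"
    where g: "\<And>w v. \<bar>g w v\<bar> \<le> infdist v Z" "\<And>w. g w w = infdist w Z"
    by metis
  define H where "H = (\<Union>w\<in>W. {i \<in> I. g w (x i) \<noteq> 0})"
  show thesis
  proof
    show "countable H" "H \<subseteq> I"
      using W(1) countable_support by (auto simp: H_def)
    \<comment> \<open>If \<open>x i\<close> had distance \<delta> > 0 from \<open>Z\<close>, take
      \<open>w\<close> within \<delta>/2 of it modulo \<open>Z\<close>. As \<open>g w\<close>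
      vanishes at \<open>x i\<close>, the distance of \<open>w\<close> from \<open>Z\<close> is also
      below \<delta>/2, contradicting the triangle inequality.\<close>
    have "x i \<in> Z" if i: "i \<in> I - H" for i
    proof (rule ccontr)
      assume "x i \<notin> Z"
      then have pos: "infdist (x i) Z > 0"
        using in_closed_iff_infdist_zero[OF Z(2)] subspace_0[OF Z(1)] infdist_nonneg[of "x i" Z]
        by fastforce
      then obtain w where w: "w \<in> W" "infdist (x i - w) Z < infdist (x i) Z / 2"
        using W(2)[of "infdist (x i) Z / 2"] by auto
      have "g w (x i) = 0"
        using i w(1) by (auto simp: H_def)
      then have "infdist w Z \<le> infdist (x i - w) Z"
        using g(1)[of w "x i - w"] g(2)[of w] by (simp add: blinfun.diff_right)
      moreover have "infdist (x i) Z \<le> infdist (x i - w) Z + infdist w Z"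
        using sublinear_add[OF sublinear_infdist[OF Z(1)], of "x i - w" w] by simp
      ultimately show False
        using w(2) by simp
    qed
    then have sub: "span (x ` (I - H)) \<subseteq> Z"
      using Z(1) by (intro span_minimal) auto
    fix y z assume "y \<in> span (x ` F)" "z \<in> span (x ` (I - H))"
    then show "norm z \<le> norm (y + z)"
      using sub Z(3) span_le_closed_span by (intro norm_le_Psi_annihilator[of _ ?Y]) auto
  qed
qed

text \<open>Two sets are needed since a finite \<open>F\<close> need not be decoupled from its own
  complement, only from that of some larger \<open>H\<close>. Projections arise when both sets
  coincide.\<close>

definition decoupled :: "'i set \<Rightarrow> 'i set \<Rightarrow> bool" where
  "decoupled F H \<longleftrightarrow> (\<forall>y\<in>span (x ` F). \<forall>z\<in>span (x ` (I - H)).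
     norm y \<le> norm (y + z) \<and> norm z \<le> norm (y + z))"

lemma decoupled_countable:
  assumes "countable F"
  obtains H where "countable H" "H \<subseteq> I" "decoupled F H"
proof -
  obtain H1 where H1: "countable H1" "H1 \<subseteq> I"
    "\<And>y z. y \<in> span (x ` F) \<Longrightarrow> z \<in> span (x ` (I - H1)) \<Longrightarrow> norm y \<le> norm (y + z)"
    by (rule norming_support[OF assms]) iprover
  obtain H2 where H2: "countable H2" "H2 \<subseteq> I"
    "\<And>y z. y \<in> span (x ` F) \<Longrightarrow> z \<in> span (x ` (I - H2)) \<Longrightarrow> norm z \<le> norm (y + z)"
    by (rule dd_support[OF assms]) iprover
  have "span (x ` (I - (H1 \<union> H2))) \<subseteq> span (x ` (I - H1))"
    "span (x ` (I - (H1 \<union> H2))) \<subseteq> span (x ` (I - H2))"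
    by (intro span_mono image_mono; blast)+
  then have "decoupled F (H1 \<union> H2)"
    unfolding decoupled_def by (intro ballI conjI H1(3) H2(3)) auto
  with H1(1,2) H2(1,2) show thesis
    by (intro that[of "H1 \<union> H2"]) auto
qed

lemma decoupledI_closed:
  assumes h: "\<And>l. decoupled (set l) (h l)" and A: "\<And>l. l \<in> lists A \<Longrightarrow> h l \<subseteq> A"
  shows "decoupled A A"
  unfolding decoupled_def
proof (intro ballI)
  fix y z assume y: "y \<in> span (x ` A)" and z: "z \<in> span (x ` (I - A))"
  obtain F where F: "finite F" "F \<subseteq> A" "y \<in> span (x ` F)"
    using span_image_finite[OF y] .
  then obtain l where l: "set l = F"
    using finite_list by blast
  then have "h l \<subseteq> A"
    using F by (intro A) auto
  then have "z \<in> span (x ` (I - h l))"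
    using z span_mono[of "x ` (I - A)" "x ` (I - h l)"] by blast
  then show "norm y \<le> norm (y + z) \<and> norm z \<le> norm (y + z)"
    using h[of l] F l by (auto simp: decoupled_def)
qed

lemma decoupled_closed_span:
  assumes "decoupled F H" "y \<in> closed_span (x ` F)" "z \<in> closed_span (x ` (I - H))"
  shows "norm y \<le> norm (y + z) \<and> norm z \<le> norm (y + z)"
proof -
  obtain a where a: "\<And>n::nat. a n \<in> span (x ` F)" "a \<longlonglongrightarrow> y"
    using assms(2) unfolding closed_span_def closure_sequential by blast
  obtain b where b: "\<And>n::nat. b n \<in> span (x ` (I - H))" "b \<longlonglongrightarrow> z"
    using assms(3) unfolding closed_span_def closure_sequential by blast
  have le: "norm (a n) \<le> norm (a n + b n)" "norm (b n) \<le> norm (a n + b n)" for n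
    using assms(1) a(1)[of n] b(1)[of n] by (auto simp: decoupled_def)
  have sum: "(\<lambda>n. norm (a n + b n)) \<longlonglongrightarrow> norm (y + z)"
    by (intro tendsto_norm tendsto_add a b)
  show ?thesis
    using LIMSEQ_le[OF tendsto_norm[OF a(2)] sum] LIMSEQ_le[OF tendsto_norm[OF b(2)] sum] le
    by blast
qed

lemma decoupled_projection:
  assumes A: "decoupled A A" "A \<subseteq> I"
  obtains P :: "'a \<Rightarrow>\<^sub>L 'a" where "\<And>i. i \<in> I \<Longrightarrow> P (x i) = (if i \<in> A then x i else 0)"
    "range P = closed_span (x ` A)" "projection P" "norm P \<le> 1" "norm (id_blinfun - P) \<le> 1"
proof (rule complementary_projection[of "closed_span (x ` A)" "closed_span (x ` (I - A))"])
  let ?S = "{y + z |y z. y \<in> closed_span (x ` A) \<and> z \<in> closed_span (x ` (I - A))}"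
  have "subspace ?S"
    by (intro subspace_sums subspace_closed_span)
  moreover have "x i \<in> ?S" if "i \<in> I" for i
  proof (cases "i \<in> A")
    case True
    then have "x i \<in> closed_span (x ` A)" "0 \<in> closed_span (x ` (I - A))"
      using closed_span_base[of "x ` A"] subspace_0[OF subspace_closed_span] by auto
    then show ?thesis by force
  next
    case False
    then have "x i \<in> closed_span (x ` (I - A))" "0 \<in> closed_span (x ` A)"
      using closed_span_base[of "x ` (I - A)"] subspace_0[OF subspace_closed_span] that by auto
    then show ?thesis by force
  qed
  ultimately have "span (x ` I) \<subseteq> ?S"
    by (intro span_minimal) auto
  then have "closed_span (x ` I) \<subseteq> closure ?S"
    unfolding closed_span_def by (rule closure_mono)
  then show "closure ?S = UNIV"
    using closed_span_basis by auto
next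
  fix P :: "'a \<Rightarrow>\<^sub>L 'a"
  assume P: "\<And>y. y \<in> closed_span (x ` A) \<Longrightarrow> P y = y"
    "\<And>z. z \<in> closed_span (x ` (I - A)) \<Longrightarrow> P z = 0"
    "range P = closed_span (x ` A)" "projection P" "norm P \<le> 1" "norm (id_blinfun - P) \<le> 1"
  have "P (x i) = (if i \<in> A then x i else 0)" if "i \<in> I" for i
    using that P(1,2)[of "x i"] closed_span_base[of "x ` A"] closed_span_base[of "x ` (I - A)"] by auto
  then show thesis
    by (rule that[OF _ P(3-6)])
qed (use A decoupled_closed_span in \<open>auto simp: subspace_closed_span closed_closed_span\<close>)

text \<open>As \<open>A\<close> is neither empty nor everything, both \<open>P\<close> and
  \<open>id_blinfun - P\<close> move some basis vector to a nonzero vector, which lifts the bounds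
  to norm exactly 1. Prescribing \<open>P\<close> by its basis values allows projections from a
  given PRI.\<close>

lemma decoupled_bicontractive:
  assumes A: "decoupled A A" "A \<subseteq> I" "A \<noteq> {}" "A \<noteq> I"
    and P: "\<And>i. i \<in> I \<Longrightarrow> blinfun_apply P (x i) = (if i \<in> A then x i else 0)"
  shows "bicontractive P" "range P = closed_span (x ` A)"
proof -
  obtain Q :: "'a \<Rightarrow>\<^sub>L 'a" where Q: "\<And>i. i \<in> I \<Longrightarrow> Q (x i) = (if i \<in> A then x i else 0)"
    "range Q = closed_span (x ` A)" "projection Q" "norm Q \<le> 1" "norm (id_blinfun - Q) \<le> 1"
    by (rule decoupled_projection[OF A(1,2)]) iprover
  have "P = Q"
    using P Q(1) by (intro blinfun_eq_on_basis) auto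
  obtain i j where ij: "i \<in> A" "j \<in> I" "j \<notin> A"
    using A by blast
  have QQ: "Q (Q v) = Q v" for v
    using Q(3) unfolding projection_def by (metis blinfun_apply_blinfun_compose)
  have QQ': "projection (id_blinfun - Q)"
    using QQ unfolding projection_def
    by (intro blinfun_eqI) (simp add: blinfun.diff_left blinfun.diff_right)
  have "Q (x i) \<noteq> 0" "(id_blinfun - Q) (x j) \<noteq> 0"
    using ij A(2) Q(1)[of i] Q(1)[of j] basis_nonzero[of i] basis_nonzero[of j]
    by (auto simp: blinfun.diff_left)
  then have "norm Q = 1" "norm (id_blinfun - Q) = 1"
    using norm_projection_eq_1[OF Q(3,4)] norm_projection_eq_1[OF QQ' Q(5)] by blast+
  then show "bicontractive P" "range P = closed_span (x ` A)"
    using Q(2,3) \<open>P = Q\<close> by (simp_all add: bicontractive_def)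
qed

end


section \<open>Finitary closures\<close>

text \<open>Rules with lists as premises depend on finitely many elements at a time; commuting with
  unions of chains rests on this.\<close>

inductive_set fin_closure :: "('i list \<Rightarrow> 'i set) \<Rightarrow> 'i set \<Rightarrow> 'i set"
  for h :: "'i list \<Rightarrow> 'i set" and A :: "'i set" where
  base: "a \<in> A \<Longrightarrow> a \<in> fin_closure h A"
| step: "l \<in> lists (fin_closure h A) \<Longrightarrow> b \<in> h l \<Longrightarrow> b \<in> fin_closure h A"
monos lists_mono

lemma fin_closure_least:
  assumes "A \<subseteq> B" and B: "\<And>l. l \<in> lists B \<Longrightarrow> h l \<subseteq> B"
  shows "fin_closure h A \<subseteq> B"
proof
  fix b assume "b \<in> fin_closure h A"
  then show "b \<in> B"
  proof (induction rule: fin_closure.induct)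
    case (base a)
    then show ?case using assms(1) by blast
  next
    case (step l b)
    then have "l \<in> lists B" by auto
    then show ?case using B step by blast
  qed
qed

lemma fin_closure_closed: "l \<in> lists (fin_closure h A) \<Longrightarrow> h l \<subseteq> fin_closure h A"
  by (intro subsetI fin_closure.step)

lemma subset_fin_closure: "A \<subseteq> fin_closure h A"
  by (auto intro: fin_closure.base)

lemma fin_closure_mono: "A \<subseteq> B \<Longrightarrow> fin_closure h A \<subseteq> fin_closure h B"
  by (intro fin_closure_least fin_closure_closed order_trans[OF _ subset_fin_closure])

text \<open>Of the finitely many members needed for the entries, the largest contains them all. The
  empty list is why the chain must be nonempty.\<close>

lemma lists_Union_chain:
  assumes "\<A> \<noteq> {}" and chain: "\<And>A B. A \<in> \<A> \<Longrightarrow> B \<in> \<A> \<Longrightarrow> A \<subseteq> B \<or> B \<subseteq> A"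
    and "l \<in> lists (\<Union>\<A>)"
  obtains A where "A \<in> \<A>" "l \<in> lists A"
proof -
  have "\<exists>A\<in>\<A>. l \<in> lists A"
    using assms(3)
  proof (induction l)
    case Nil
    then show ?case using assms(1) by auto
  next
    case (Cons a l)
    then obtain A B where AB: "A \<in> \<A>" "l \<in> lists A" "B \<in> \<A>" "a \<in> B"
      by auto
    from chain[OF AB(1,3)] show ?case
    proof
      assume "A \<subseteq> B"
      then have "a # l \<in> lists B"
        using AB lists_mono[of A B] by auto
      with AB(3) show ?case by blast
    next
      assume "B \<subseteq> A"
      then have "a # l \<in> lists A"
        using AB by auto
      with AB(1) show ?case by blast
    qed
  qed
  with that show thesis by blast
qed

text \<open>A list from the union of the closures already lies in one of them, so this union is
  closed under \<open>h\<close>.\<close>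

lemma fin_closure_Union_chain:
  assumes "\<A> \<noteq> {}" and chain: "\<And>A B. A \<in> \<A> \<Longrightarrow> B \<in> \<A> \<Longrightarrow> A \<subseteq> B \<or> B \<subseteq> A"
  shows "fin_closure h (\<Union>\<A>) = \<Union>(fin_closure h ` \<A>)"
proof
  show "\<Union>(fin_closure h ` \<A>) \<subseteq> fin_closure h (\<Union>\<A>)"
    by (intro UN_least fin_closure_mono Union_upper)
  show "fin_closure h (\<Union>\<A>) \<subseteq> \<Union>(fin_closure h ` \<A>)"
  proof (rule fin_closure_least)
    show "\<Union>\<A> \<subseteq> \<Union>(fin_closure h ` \<A>)"
      using subset_fin_closure[of _ h] by blast
    fix l assume l: "l \<in> lists (\<Union>(fin_closure h ` \<A>))"
    have ne: "fin_closure h ` \<A> \<noteq> {}"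
      using assms(1) by simp
    have chain': "A \<subseteq> B \<or> B \<subseteq> A" if AB: "A \<in> fin_closure h ` \<A>" "B \<in> fin_closure h ` \<A>" for A B
    proof -
      obtain A' B' where "A' \<in> \<A>" "A = fin_closure h A'" "B' \<in> \<A>" "B = fin_closure h B'"
        using AB by blast
      then show ?thesis
        using chain[of A' B'] fin_closure_mono[of A' B' h] fin_closure_mono[of B' A' h] by blast
    qed
    obtain B where "B \<in> fin_closure h ` \<A>" "l \<in> lists B"
      by (rule lists_Union_chain[OF ne chain' l])
    then obtain A where "A \<in> \<A>" "l \<in> lists (fin_closure h A)"
      by blast
    then show "h l \<subseteq> \<Union>(fin_closure h ` \<A>)"
      using fin_closure_closed[of l h A] by blast
  qed
qed

lemma UNION_countable_bound:
  assumes "|I| \<le>o r" "Cinfinite r" "\<And>i. countable (A i)"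
  shows "|\<Union>i\<in>I. A i| \<le>o r"
  using assms by (intro UNION_Cinfinite_bound) (auto intro: countable_card_of_le)

text \<open>The closure is exhausted after \<omega> rounds, since the entries of a list appear
  together in one round. Each round adds a countable set for every list over the previous one, which
  keeps an infinite bound.\<close>

lemma card_fin_closure:
  assumes h: "\<And>l. countable (h l)"
  shows "|fin_closure h A| \<le>o |A| +c natLeq"
proof -
  let ?r = "|A| +c natLeq"
  define B where "B = rec_nat A (\<lambda>_ C. C \<union> (\<Union>l\<in>lists C. h l))"
  have B_simps: "B 0 = A" "B (Suc n) = B n \<union> (\<Union>l\<in>lists (B n). h l)" for n
    by (simp_all add: B_def)
  have card: "|B n| \<le>o ?r" for n
  proof (induction n)
    case 0
    show ?case
      using ordLeq_csum1[OF card_of_Card_order] by (simp add: B_simps)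
  next
    case (Suc n)
    have "|\<Union>l\<in>lists (B n). h l| \<le>o ?r"
      using lists_Cinfinite_bound[OF Suc Cinfinite_csum_natLeq] Cinfinite_csum_natLeq h
      by (rule UNION_countable_bound)
    with Suc show ?case
      unfolding B_simps by (intro Un_Cinfinite_bound Cinfinite_csum_natLeq)
  qed
  have mono: "m \<le> n \<Longrightarrow> B m \<subseteq> B n" for m n
    by (rule lift_Suc_mono_le[of B]) (auto simp: B_simps)
  have "fin_closure h A \<subseteq> (\<Union>n. B n)"
  proof (rule fin_closure_least)
    show "A \<subseteq> (\<Union>n. B n)"
      using B_simps(1) by blast
    fix l assume l: "l \<in> lists (\<Union>n. B n)"
    have ne: "range B \<noteq> {}"
      by simp
    have chain: "C \<subseteq> D \<or> D \<subseteq> C" if CD: "C \<in> range B" "D \<in> range B" for C D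
    proof -
      obtain m n where "C = B m" "D = B n"
        using CD by blast
      then show ?thesis
        using mono[of m n] mono[of n m] nat_le_linear[of m n] by blast
    qed
    obtain C where "C \<in> range B" "l \<in> lists C"
      by (rule lists_Union_chain[OF ne chain l])
    then obtain n where "l \<in> lists (B n)"
      by blast
    then have "h l \<subseteq> B (Suc n)"
      by (auto simp: B_simps)
    then show "h l \<subseteq> (\<Union>n. B n)" by blast
  qed
  moreover have "|\<Union>n. B n| \<le>o ?r"
    using card by (intro UNION_Cinfinite_bound[OF countable_card_of_le] ballI Cinfinite_csum_natLeq) auto
  ultimately show ?thesis
    by (rule ordLeq_transitive[OF card_of_mono1])
qed

section \<open>Decoupled hulls and bicontractively complemented subspaces\<close>

context dd_basis
begin

lemma decoupling_hull:
  obtains cl :: "'i set \<Rightarrow> 'i set" where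
    "\<And>A. A \<subseteq> cl A" "\<And>A. A \<subseteq> I \<Longrightarrow> cl A \<subseteq> I" "\<And>A B. A \<subseteq> B \<Longrightarrow> cl A \<subseteq> cl B"
    "\<And>A. decoupled (cl A) (cl A)" "\<And>A. |cl A| \<le>o |A| +c natLeq"
    "\<And>\<A>. \<A> \<noteq> {} \<Longrightarrow> (\<And>A B. A \<in> \<A> \<Longrightarrow> B \<in> \<A> \<Longrightarrow> A \<subseteq> B \<or> B \<subseteq> A) \<Longrightarrow> cl (\<Union>\<A>) = \<Union>(cl ` \<A>)"
proof -
  have "\<exists>H. countable H \<and> H \<subseteq> I \<and> decoupled (set l) H" for l :: "'i list"
    by (rule decoupled_countable[of "set l"]) (auto intro: countable_finite)
  then obtain h where h: "\<And>l. countable (h l)" "\<And>l. h l \<subseteq> I" "\<And>l. decoupled (set l) (h l)"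
    by metis
  show thesis
  proof (rule that[of "fin_closure h"])
    show "decoupled (fin_closure h A) (fin_closure h A)" for A
      by (rule decoupledI_closed[of h]) (rule h(3), rule fin_closure_closed)
    show "fin_closure h A \<subseteq> I" if "A \<subseteq> I" for A
      using that h(2) by (rule fin_closure_least)
    show "|fin_closure h A| \<le>o |A| +c natLeq" for A
      using h(1) by (rule card_fin_closure)
  qed (fact subset_fin_closure fin_closure_mono fin_closure_Union_chain)+
qed

lemma dens_le_basis: "dens (UNIV :: 'a set) \<le>o |I| +c natLeq"
proof -
  have "|x ` I| \<le>o |I| +c natLeq"
    using card_of_image ordLeq_csum1[OF card_of_Card_order] by (rule ordLeq_transitive)
  then show ?thesis
    using dens_closed_span[OF _ Cinfinite_csum_natLeq, of "x ` I" "|I|"] closed_span_basis by simp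
qed

text \<open>Biorthogonality bounds the number of indices by the density; rational combinations give
  the converse up to the summand \<aleph>0. That summand is absorbed because a finite basis would
  make the space separable.\<close>

lemma card_basis: "|I| =o dens (UNIV :: 'a set)"
proof -
  have le: "|I| \<le>o dens (UNIV :: 'a set)"
    using M_basis by (intro biorthogonal_card_le_dens[of I f x]) (auto simp: M_basis_def)
  have "infinite I"
  proof
    assume "finite I"
    then have "|I| +c natLeq \<le>o natLeq"
      by (intro csum_natLeq_le natLeq_Cinfinite) (simp add: countable_finite flip: countable_iff_card_of)
    with dens_le_basis have "dens (UNIV :: 'a set) \<le>o natLeq"
      by (rule ordLeq_transitive)
    with nonseparable show False
      using not_ordLess_ordLeq[of natLeq] by blast
  qed
  then have "Cinfinite |I|"
    by (simp add: cinfinite_def Field_card_of card_of_card_order_on)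
  then have "|I| +c natLeq \<le>o |I|"
    by (intro csum_natLeq_le ordLeq_refl card_of_Card_order)
  with dens_le_basis have "dens (UNIV :: 'a set) \<le>o |I|"
    by (rule ordLeq_transitive)
  with le show ?thesis
    by (simp add: ordIso_iff_ordLeq)
qed

lemma countable_closed_span_support:
  obtains C where "countable C" "C \<subseteq> I" "v \<in> closed_span (x ` C)"
proof -
  have "v \<in> closure (span (x ` I))"
    using closed_span_basis by (simp add: closed_span_def)
  then obtain u where u: "\<And>n::nat. u n \<in> span (x ` I)" "u \<longlonglongrightarrow> v"
    unfolding closure_sequential by blast
  have "\<exists>F. finite F \<and> F \<subseteq> I \<and> u n \<in> span (x ` F)" for n
    by (rule span_image_finite[OF u(1)]) blast
  then obtain F where F: "\<And>n. finite (F n)" "\<And>n. F n \<subseteq> I" "\<And>n. u n \<in> span (x ` F n)"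
    by metis
  show thesis
  proof (rule that[of "\<Union>n. F n"])
    have "span (x ` F n) \<subseteq> span (x ` (\<Union>n. F n))" for n
      by (intro span_mono) blast
    then have "u n \<in> span (x ` (\<Union>n. F n))" for n
      using F(3) by blast
    then show "v \<in> closed_span (x ` (\<Union>n. F n))"
      unfolding closed_span_def closure_sequential using u(2) by blast
  qed (use F in \<open>auto intro: countable_finite\<close>)
qed

text \<open>Each vector of a dense subset of \<open>Y\<close> lies in the closed span of countably
  many basis vectors. The hull of all their indices has at most \<open>dens Y\<close> elements, and
  its closed span contains \<open>Y\<close>.\<close>

lemma bicontractively_complemented_superspace:
  fixes Y :: "'a set"
  assumes Y: "dens Y <o dens (UNIV :: 'a set)"
  obtains Z where "bicontractively_complemented Z" "Y \<subseteq> Z" "dens Z =o dens Y" "subspace Z"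
proof -
  obtain D where D: "Y \<subseteq> closure D" "|D| \<le>o dens Y"
    by (rule dens_dense_subset)
  have "\<exists>C. countable C \<and> C \<subseteq> I \<and> d \<in> closed_span (x ` C)" for d :: 'a
    by (rule countable_closed_span_support[of d]) blast
  then obtain C where C: "\<And>d. countable (C d)" "\<And>d. C d \<subseteq> I" "\<And>d. d \<in> closed_span (x ` C d)"
    by metis
  have "I \<noteq> {}"
  proof
    assume "I = {}"
    then have "|I| \<le>o natLeq"
      by (simp flip: countable_iff_card_of)
    then have "dens (UNIV :: 'a set) \<le>o natLeq"
      using ordIso_ordLeq_trans[OF ordIso_symmetric[OF card_basis]] by blast
    with nonseparable show False
      using not_ordLess_ordLeq[of natLeq] by blast
  qed
  then obtain i where i: "i \<in> I" by blast
  \<comment> \<open>The extra index \<open>i\<close> makes the hull nonempty even if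
    \<open>Y\<close> is zero; a projection of norm 1 cannot have zero range.\<close>
  define A where "A = insert i (\<Union>d\<in>D. C d)"
  have "|\<Union>d\<in>D. C d| \<le>o dens Y"
    using D(2) Cinfinite_dens C(1) by (rule UNION_countable_bound)
  moreover have "|{i}| \<le>o dens Y"
    by (intro countable_card_of_le Cinfinite_dens) simp
  ultimately have A: "|A| \<le>o dens Y" "A \<subseteq> I"
    using Un_Cinfinite_bound[of "{i}" "dens Y" "\<Union>d\<in>D. C d"] Cinfinite_dens C(2) i
    by (auto simp: A_def)
  obtain cl :: "'i set \<Rightarrow> 'i set" where cl: "\<And>A. A \<subseteq> cl A" "\<And>A. A \<subseteq> I \<Longrightarrow> cl A \<subseteq> I"
    "\<And>A. decoupled (cl A) (cl A)" "\<And>A. |cl A| \<le>o |A| +c natLeq"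
    by (rule decoupling_hull) iprover
  define B where "B = cl A"
  have B: "A \<subseteq> B" "B \<subseteq> I" "decoupled B B" "|B| \<le>o |A| +c natLeq"
    unfolding B_def using cl A(2) by blast+
  have card_B: "|B| \<le>o dens Y"
    using B(4) csum_natLeq_le[OF A(1) Cinfinite_dens] by (rule ordLeq_transitive)
  \<comment> \<open>The hull is a proper subset of \<open>I\<close>, since \<open>I\<close> has as
    many elements as the density of the space.\<close>
  then have "|B| <o dens (UNIV :: 'a set)"
    using Y by (rule ordLeq_ordLess_trans)
  then have "B \<noteq> I"
    using card_basis not_ordLess_ordIso[of "|I|"] by blast
  have "B \<noteq> {}"
    using B(1) by (auto simp: A_def)
  obtain P :: "'a \<Rightarrow>\<^sub>L 'a" where P: "\<And>i. i \<in> I \<Longrightarrow> P (x i) = (if i \<in> B then x i else 0)"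
    by (rule decoupled_projection[OF B(3,2)]) iprover
  note bi = decoupled_bicontractive[OF B(3,2) \<open>B \<noteq> {}\<close> \<open>B \<noteq> I\<close> P]
  let ?Z = "closed_span (x ` B)"
  have "D \<subseteq> ?Z"
  proof
    fix d assume "d \<in> D"
    then have "x ` C d \<subseteq> x ` B"
      using B(1) by (auto simp: A_def)
    then show "d \<in> ?Z"
      using C(3)[of d] closed_span_mono by blast
  qed
  then have "closure D \<subseteq> ?Z"
    by (intro closure_minimal closed_closed_span)
  with D(1) have YZ: "Y \<subseteq> ?Z" by blast
  have "|x ` B| \<le>o dens Y"
    using card_of_image card_B by (rule ordLeq_transitive)
  then have "dens ?Z \<le>o dens Y"
    using Cinfinite_dens by (rule dens_closed_span)
  moreover have "dens Y \<le>o dens ?Z"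
    using YZ by (rule dens_mono)
  ultimately have "dens ?Z =o dens Y"
    by (simp add: ordIso_iff_ordLeq)
  moreover have "bicontractively_complemented ?Z"
    unfolding bicontractively_complemented_def using bi by blast
  ultimately show thesis
    using YZ subspace_closed_span by (intro that[of ?Z])
qed

lemma bicontractive_SCP: "bicontractive_SCP TYPE('a)"
  unfolding bicontractive_SCP_def
proof (intro allI impI, elim conjE)
  fix Y :: "'a set" assume "separable_space (top_of_set Y)"
  then have Y: "dens Y \<le>o natLeq"
    by (rule separable_dens_le)
  then have "dens Y <o dens (UNIV :: 'a set)"
    using nonseparable by (rule ordLeq_ordLess_trans)
  then obtain Z where Z: "bicontractively_complemented Z" "Y \<subseteq> Z" "dens Z =o dens Y" "subspace Z"
    by (rule bicontractively_complemented_superspace)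
  have "dens Z \<le>o natLeq"
    using Z(3) Y by (rule ordIso_ordLeq_trans)
  then have "separable_space (top_of_set Z)"
    by (rule separable_spaceI_dens)
  with Z show "\<exists>Z. subspace Z \<and> separable_space (top_of_set Z) \<and> Y \<subseteq> Z \<and> bicontractively_complemented Z"
    by blast
qed

end


section \<open>Filtrations of an uncountable cardinal\<close>

context wo_rel
begin

lemma underS_trans: "a \<in> underS b \<Longrightarrow> b \<in> underS c \<Longrightarrow> a \<in> underS c"
  using TRANS ANTISYM unfolding Order_Relation.underS_def trans_def antisym_def by blast

lemma underS_linear: "a \<in> Field r \<Longrightarrow> b \<in> Field r \<Longrightarrow> a \<in> underS b \<or> a = b \<or> b \<in> underS a"
  using TOTALS unfolding Order_Relation.underS_def by blast

lemma underS_asym: "a \<in> underS b \<Longrightarrow> b \<notin> underS a"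
  using underS_trans[of a b a] underS_notIn[of a r] by blast

lemma underS_imp_Field: "a \<in> underS b \<Longrightarrow> a \<in> Field r \<and> b \<in> Field r"
  by (auto simp: Order_Relation.underS_def Field_def)

lemma not_underS_iff: "a \<in> Field r \<Longrightarrow> b \<in> Field r \<Longrightarrow> a \<notin> underS b \<longleftrightarrow> (b, a) \<in> r"
  using TOTALS ANTISYM REFL
  unfolding Order_Relation.underS_def antisym_def refl_on_def by blast

lemma underS_subset_iff: "a \<in> Field r \<Longrightarrow> b \<in> Field r \<Longrightarrow> underS a \<subseteq> underS b \<longleftrightarrow> (a, b) \<in> r"
  using underS_incl_iff[OF LIN] by blast

lemma underS_mono: "a \<in> underS b \<Longrightarrow> underS a \<subseteq> underS b"
  by (auto intro: underS_trans)

lemma under_subset_underS: "a \<in> underS b \<Longrightarrow> under a \<subseteq> underS b"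
  using TRANS ANTISYM unfolding Order_Relation.underS_def Order_Relation.under_def trans_def antisym_def
  by blast

lemma minim_Collect:
  assumes "c \<in> Field r" "Q c"
  shows "minim {c \<in> Field r. Q c} \<in> Field r" "Q (minim {c \<in> Field r. Q c})"
  using minim_in[of "{c \<in> Field r. Q c}"] assms by auto

lemma minim_Collect_le:
  assumes "c \<in> Field r" "Q c"
  shows "(minim {c \<in> Field r. Q c}, c) \<in> r"
  using minim_least[of "{c \<in> Field r. Q c}" c] assms by auto

text \<open>The order is inclusion of strict initial segments, so suprema can be recognised from
  unions of segments. Continuity of the index maps is verified in this form.\<close>

lemma supr_eqI:
  assumes "A \<subseteq> Field r" "b \<in> Field r" and b: "underS b = (\<Union>a\<in>A. underS a)"
  shows "supr A = b"
proof -
  have "b = minim (Above A)"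
  proof (rule equals_minim)
    show "Above A \<subseteq> Field r"
      by (auto simp: Order_Relation.Above_def)
    have le: "(a, c) \<in> r" if "a \<in> A" "c \<in> Field r" "underS a \<subseteq> underS c" for a c
      using underS_subset_iff[of a c] that assms(1) by blast
    have "(a, b) \<in> r" if "a \<in> A" for a
      using that b by (intro le assms(2)) auto
    then show "b \<in> Above A"
      using assms(2) by (simp add: Order_Relation.Above_def)
    fix c assume "c \<in> Above A"
    then have "c \<in> Field r" "\<And>a. a \<in> A \<Longrightarrow> underS a \<subseteq> underS c"
      using underS_subset_iff assms(1) unfolding Order_Relation.Above_def by blast+
    then show "(b, c) \<in> r"
      using b underS_subset_iff[OF assms(2), of c] by blast
  qed
  then show ?thesis
    by (simp add: supr_def)
qed

text \<open>An element outside all the segments is itself an upper bound of \<open>A\<close>, hence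
  not below the supremum. The bound \<open>u\<close> ensures that the supremum is a minimum over a
  nonempty set.\<close>

lemma underS_supr:
  assumes A: "A \<subseteq> Field r" and "u \<in> Field r" "\<And>a. a \<in> A \<Longrightarrow> (a, u) \<in> r"
  shows "underS (supr A) = (\<Union>a\<in>A. underS a)"
proof
  have "Above A \<noteq> {}" "Above A \<subseteq> Field r"
    using assms by (auto simp: Order_Relation.Above_def)
  then have sup: "supr A \<in> Above A"
    unfolding supr_def by (intro minim_in)
  then have supF: "supr A \<in> Field r"
    by (simp add: Order_Relation.Above_def)
  show "(\<Union>a\<in>A. underS a) \<subseteq> underS (supr A)"
    using sup A underS_subset_iff[OF _ supF] unfolding Order_Relation.Above_def by blast
  show "underS (supr A) \<subseteq> (\<Union>a\<in>A. underS a)"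
  proof
    fix c assume c: "c \<in> underS (supr A)"
    then have cF: "c \<in> Field r"
      using underS_imp_Field by blast
    show "c \<in> (\<Union>a\<in>A. underS a)"
    proof (rule ccontr)
      assume no: "c \<notin> (\<Union>a\<in>A. underS a)"
      have "c \<in> Above A"
        unfolding Order_Relation.Above_def using not_underS_iff[OF cF] no cF A by blast
      then have "(supr A, c) \<in> r"
        unfolding supr_def using \<open>Above A \<subseteq> Field r\<close> by (intro minim_least)
      then show False
        using not_underS_iff[OF cF supF] c by blast
    qed
  qed
qed

text \<open>The enumerations below choose a least element subject to a condition on the set of
  earlier values, so a step that sees only this set is enough.\<close>

lemma recursion_underS:
  obtains s where "\<And>a. s a = G (s ` underS a)"
proof -
  let ?H = "\<lambda>s a. G (s ` underS a)"
  have "adm_wo ?H"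
    unfolding adm_wo_def by (metis image_cong)
  then have "worec ?H = ?H (worec ?H)"
    by (rule worec_fixpoint)
  then have "worec ?H a = G (worec ?H ` underS a)" for a
    by (rule fun_cong)
  then show thesis
    by (rule that)
qed

lemma inj_onI_underS:
  assumes "\<And>a b. b \<in> A \<Longrightarrow> a \<in> A \<Longrightarrow> a \<in> underS b \<Longrightarrow> s a \<noteq> s b" "A \<subseteq> Field r"
  shows "inj_on s A"
proof (rule inj_onI, rule ccontr)
  fix a b assume ab: "a \<in> A" "b \<in> A" "s a = s b" "a \<noteq> b"
  then show False
    using underS_linear[of a b] assms(1)[of a b] assms(1)[of b a] assms(2) by auto
qed

end

locale infinite_cardinal =
  fixes \<kappa> :: "'k rel"
  assumes Card_order: "Card_order \<kappa>" and infinite_Field: "infinite (Field \<kappa>)"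
begin

sublocale wo_rel \<kappa>
  using Card_order by unfold_locales (rule Card_order_wo_rel[THEN wo_rel.WELL])

lemma ex_greater: "a \<in> Field \<kappa> \<Longrightarrow> \<exists>b\<in>Field \<kappa>. a \<in> underS b"
  using infinite_Card_order_limit[OF Card_order infinite_Field]
  unfolding Order_Relation.underS_def by blast

lemma Cinfinite_ord_card: "Cinfinite (ord_card \<kappa> a)"
  unfolding ord_card_def by (rule Cinfinite_csum_natLeq)

end

locale uncountable_cardinal = infinite_cardinal \<kappa> for \<kappa> :: "'k rel" +
  assumes uncountable: "natLeq <o \<kappa>"
begin

text \<open>Uncountability of \<kappa> keeps every stage of a filtration, whose size involves
  \<aleph>0, strictly smaller than \<kappa>.\<close>

lemma csum_natLeq_less: "|A| <o \<kappa> \<Longrightarrow> |A| +c natLeq <o \<kappa>"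
  unfolding csum_def using uncountable
  by (intro card_of_Plus_ordLess_infinite_Field infinite_Field Card_order)
    (auto simp: Field_card_of intro: ordLess_Field)

lemma countable_less: "countable A \<Longrightarrow> |A| <o \<kappa>"
  unfolding countable_iff_card_of by (rule ordLeq_ordLess_trans[OF _ uncountable])

lemma card_of_under: "a \<in> Field \<kappa> \<Longrightarrow> |under a| <o \<kappa>"
proof -
  assume "a \<in> Field \<kappa>"
  then obtain b where b: "b \<in> Field \<kappa>" "a \<in> underS b"
    using ex_greater by blast
  have "|under a| \<le>o |underS b|"
    by (intro card_of_mono1 under_subset_underS b)
  then show ?thesis
    using card_of_underS[OF Card_order b(1)] by (rule ordLeq_ordLess_trans)
qed

lemma ex_not_in:
  assumes "|A| <o \<kappa>"
  obtains c where "c \<in> Field \<kappa>" "c \<notin> A"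
proof -
  have "\<not> Field \<kappa> \<subseteq> A"
  proof
    assume "Field \<kappa> \<subseteq> A"
    then have "|Field \<kappa>| \<le>o |A|"
      by (rule card_of_mono1)
    then have "|Field \<kappa>| <o \<kappa>"
      using assms by (rule ordLeq_ordLess_trans)
    then show False
      using card_of_Field_ordIso[OF Card_order] not_ordLess_ordIso by blast
  qed
  with that show thesis by blast
qed

text \<open>
  The sets \<open>A \<alpha> = cl (N \<union> {s \<beta>. \<beta> < \<alpha>})\<close>, where \<open>s \<alpha>\<close> is the first element outside \<open>A \<alpha>\<close>, form a strictly
  increasing continuous filtration. Sorting by the stage of entry and then by the given order makes every
  \<open>A \<alpha>\<close> an initial segment; all initial segments of this new well-order have fewer than \<open>\<kappa>\<close> elements, so
  its type is \<open>\<kappa>\<close>. The infinite set \<open>N\<close> gives \<open>A \<alpha>\<close> the cardinality \<open>|\<alpha>| + \<aleph>\<^sub>0\<close> for finite \<open>\<alpha>\<close>, too.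
\<close>

theorem filtration_enumeration:
  fixes cl :: "'k set \<Rightarrow> 'k set"
  assumes ext: "\<And>A. A \<subseteq> cl A" and closed: "\<And>A. A \<subseteq> Field \<kappa> \<Longrightarrow> cl A \<subseteq> Field \<kappa>"
    and mono: "\<And>A B. A \<subseteq> B \<Longrightarrow> cl A \<subseteq> cl B" and card: "\<And>A. |cl A| \<le>o |A| +c natLeq"
    and chain: "\<And>\<A>. \<A> \<noteq> {} \<Longrightarrow> (\<And>A B. A \<in> \<A> \<Longrightarrow> B \<in> \<A> \<Longrightarrow> A \<subseteq> B \<or> B \<subseteq> A) \<Longrightarrow> cl (\<Union>\<A>) = \<Union>(cl ` \<A>)"
  obtains \<pi> \<theta> where "bij_betw \<pi> (Field \<kappa>) (Field \<kappa>)" "ord_strict_mono \<kappa> \<theta>" "ord_continuous \<kappa> \<theta>"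
    "\<And>\<alpha>. \<alpha> \<in> Field \<kappa> \<Longrightarrow> |underS (\<theta> \<alpha>)| =o ord_card \<kappa> \<alpha>"
    "\<And>\<alpha>. \<alpha> \<in> Field \<kappa> \<Longrightarrow> \<exists>B. \<pi> ` underS (\<theta> \<alpha>) = cl B"
proof -
  obtain N where N: "countable N" "infinite N" "N \<subseteq> Field \<kappa>"
    using infinite_countable_subset'[OF infinite_Field] by blast
  obtain s where s: "\<And>\<alpha>. s \<alpha> = minim {c \<in> Field \<kappa>. c \<notin> cl (N \<union> s ` underS \<alpha>)}"
    using recursion_underS[of "\<lambda>S. minim {c \<in> Field \<kappa>. c \<notin> cl (N \<union> S)}"] by blast
  define A where "A \<alpha> = cl (N \<union> s ` underS \<alpha>)" for \<alpha>
  have card_gen: "|N \<union> s ` underS \<alpha>| \<le>o ord_card \<kappa> \<alpha>" for \<alpha>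
  proof (rule Un_Cinfinite_bound)
    show "|N| \<le>o ord_card \<kappa> \<alpha>"
      using N(1) Cinfinite_ord_card by (rule countable_card_of_le)
    show "|s ` underS \<alpha>| \<le>o ord_card \<kappa> \<alpha>"
      unfolding ord_card_def
      using card_of_image ordLeq_csum1[OF card_of_Card_order] by (rule ordLeq_transitive)
  qed (rule Cinfinite_ord_card)
  have card_A_le: "|A \<alpha>| \<le>o ord_card \<kappa> \<alpha>" for \<alpha>
    unfolding A_def using card csum_natLeq_le[OF card_gen Cinfinite_ord_card] by (rule ordLeq_transitive)
  have card_A_less: "|A \<alpha>| <o \<kappa>" if "\<alpha> \<in> Field \<kappa>" for \<alpha>
    using card_A_le csum_natLeq_less[OF card_of_underS[OF Card_order that]]
    unfolding ord_card_def by (rule ordLeq_ordLess_trans)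
  have s_in: "s \<alpha> \<in> Field \<kappa>" and s_notin: "s \<alpha> \<notin> A \<alpha>"
    and s_least: "\<And>c. c \<in> Field \<kappa> \<Longrightarrow> c \<notin> A \<alpha> \<Longrightarrow> (s \<alpha>, c) \<in> \<kappa>" if \<alpha>: "\<alpha> \<in> Field \<kappa>" for \<alpha>
  proof -
    have eq: "s \<alpha> = minim {c \<in> Field \<kappa>. c \<notin> A \<alpha>}"
      using s[of \<alpha>] by (simp add: A_def)
    obtain c where "c \<in> Field \<kappa>" "c \<notin> A \<alpha>"
      by (rule ex_not_in[OF card_A_less[OF \<alpha>]])
    then show "s \<alpha> \<in> Field \<kappa>" "s \<alpha> \<notin> A \<alpha>"
      unfolding eq by (rule minim_Collect)+
    fix c assume "c \<in> Field \<kappa>" "c \<notin> A \<alpha>"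
    then show "(s \<alpha>, c) \<in> \<kappa>"
      unfolding eq by (rule minim_Collect_le)
  qed
  have A_Field: "A \<alpha> \<subseteq> Field \<kappa>" for \<alpha>
    unfolding A_def using N(3) s_in underS_imp_Field by (intro closed) blast
  have A_mono: "A \<alpha> \<subseteq> A \<beta>" if "\<alpha> \<in> underS \<beta>" for \<alpha> \<beta>
    unfolding A_def using underS_mono[OF that] by (intro mono) blast
  have s_A: "s \<alpha> \<in> A \<beta>" if "\<alpha> \<in> underS \<beta>" for \<alpha> \<beta>
    unfolding A_def using that ext[of "N \<union> s ` underS \<beta>"] by blast
  have s_inj: "inj_on s B" if "B \<subseteq> Field \<kappa>" for B
  proof (rule inj_onI_underS)
    fix a b assume "a \<in> underS b"
    then show "s a \<noteq> s b"
      using s_A[of a b] s_notin[of b] underS_imp_Field[of a b] by auto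
  qed (rule that)
  \<comment> \<open>The points \<open>s \<beta>\<close> with \<beta> < \<alpha> are distinct members
    of \<open>A \<alpha>\<close>, and \<open>N\<close> makes this set infinite, so the summand
    \<aleph>0 is absorbed.\<close>
  have card_A: "|A \<alpha>| =o ord_card \<kappa> \<alpha>" if \<alpha>: "\<alpha> \<in> Field \<kappa>" for \<alpha>
  proof -
    have "|underS \<alpha>| \<le>o |A \<alpha>|"
      using s_A s_inj[OF Order_Relation.underS_Field] by (intro card_of_ordLeqI[of s])
    moreover have "infinite (A \<alpha>)"
      using N(2) ext[of "N \<union> s ` underS \<alpha>"] finite_subset[of N "A \<alpha>"]
      unfolding A_def by blast
    then have "Cinfinite |A \<alpha>|"
      by (simp add: cinfinite_def Field_card_of card_of_card_order_on)
    ultimately have "ord_card \<kappa> \<alpha> \<le>o |A \<alpha>|"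
      unfolding ord_card_def by (rule csum_natLeq_le)
    with card_A_le show ?thesis
      by (simp add: ordIso_iff_ordLeq)
  qed
  \<comment> \<open>The generating sets increase along the stages. A limit has no immediate
    predecessor, so those below \<open>l\<close> have the generating set of \<open>l\<close> as
    their union, and the hull commutes with this union.\<close>
  have A_limit: "A l = (\<Union>\<alpha>\<in>underS l. A \<alpha>)" if l: "limit_ord \<kappa> l" for l
  proof -
    let ?g = "\<lambda>\<alpha>. N \<union> s ` underS \<alpha>"
    have ne: "?g ` underS l \<noteq> {}"
      using l by (simp add: limit_ord_def)
    have "B \<subseteq> C \<or> C \<subseteq> B" if BC: "B \<in> ?g ` underS l" "C \<in> ?g ` underS l" for B C
    proof -
      obtain \<beta> \<gamma> where "\<beta> \<in> underS l" "B = ?g \<beta>" "\<gamma> \<in> underS l" "C = ?g \<gamma>"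
        using BC by blast
      moreover from this have "underS \<beta> \<subseteq> underS \<gamma> \<or> underS \<gamma> \<subseteq> underS \<beta>"
        using underS_linear[of \<beta> \<gamma>] underS_mono underS_imp_Field by blast
      ultimately show ?thesis by blast
    qed
    then have "cl (\<Union>(?g ` underS l)) = \<Union>(cl ` ?g ` underS l)"
      by (rule chain[OF ne])
    moreover have "\<Union>(?g ` underS l) = N \<union> s ` underS l"
    proof
      show "\<Union>(?g ` underS l) \<subseteq> N \<union> s ` underS l"
        using underS_trans by blast
      show "N \<union> s ` underS l \<subseteq> \<Union>(?g ` underS l)"
        using l unfolding limit_ord_def by blast
    qed
    ultimately show ?thesis
      by (simp add: A_def image_image)
  qed
  \<comment> \<open>If \<open>i\<close> were never captured, minimality would give
    \<open>s \<alpha> \<le> i\<close> for every \<alpha>, and \<open>s\<close> would embed \<kappa>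
    into the smaller set \<open>under i\<close>.\<close>
  have cover: "\<exists>\<alpha>\<in>Field \<kappa>. i \<in> A \<alpha>" if i: "i \<in> Field \<kappa>" for i
  proof (rule ccontr)
    assume "\<not> ?thesis"
    then have "s \<alpha> \<in> under i" if "\<alpha> \<in> Field \<kappa>" for \<alpha>
      using s_least[OF that i] that by (auto simp: Order_Relation.under_def)
    then have "|Field \<kappa>| \<le>o |under i|"
      using s_inj[OF order_refl] by (intro card_of_ordLeqI[of s])
    then have "|Field \<kappa>| <o \<kappa>"
      using card_of_under[OF i] by (rule ordLeq_ordLess_trans)
    then show False
      using card_of_Field_ordIso[OF Card_order] not_ordLess_ordIso by blast
  qed
  define rank where "rank i = minim {\<alpha> \<in> Field \<kappa>. i \<in> A \<alpha>}" for i
  have rank_Field: "rank i \<in> Field \<kappa>" and rank_A: "i \<in> A (rank i)" if i: "i \<in> Field \<kappa>" for i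
    unfolding rank_def using cover[OF i] minim_Collect[of _ "\<lambda>\<alpha>. i \<in> A \<alpha>"] by blast+
  have A_iff: "i \<in> A \<alpha> \<longleftrightarrow> (rank i, \<alpha>) \<in> \<kappa>" if i: "i \<in> Field \<kappa>" and \<alpha>: "\<alpha> \<in> Field \<kappa>" for i \<alpha>
  proof
    assume "i \<in> A \<alpha>"
    then show "(rank i, \<alpha>) \<in> \<kappa>"
      unfolding rank_def using \<alpha> by (intro minim_Collect_le)
  next
    assume "(rank i, \<alpha>) \<in> \<kappa>"
    then have "rank i = \<alpha> \<or> rank i \<in> underS \<alpha>"
      by (auto simp: Order_Relation.underS_def)
    then show "i \<in> A \<alpha>"
      using rank_A[OF i] A_mono by blast
  qed
  define R where "R = {(i, j) \<in> Field \<kappa> \<times> Field \<kappa>.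
    rank i \<in> underS (rank j) \<or> rank i = rank j \<and> (i, j) \<in> \<kappa>}"
  have Field_R: "Field R = Field \<kappa>"
    using REFL by (auto simp: R_def Field_def refl_on_def)
  have "Well_order R"
    unfolding well_order_on_def linear_order_on_def partial_order_on_def preorder_on_def Field_R
  proof (intro conjI)
    show "R \<subseteq> Field \<kappa> \<times> Field \<kappa>"
      by (auto simp: R_def)
    show "refl_on (Field \<kappa>) R"
      using REFL by (auto simp: R_def refl_on_def)
    show "trans R"
    proof (rule transI)
      fix i j k assume "(i, j) \<in> R" "(j, k) \<in> R"
      then show "(i, k) \<in> R"
        using underS_trans[of "rank i" "rank j" "rank k"] transD[OF TRANS, of i j k]
        by (auto simp: R_def)
    qed
    show "antisym R"
    proof (rule antisymI)
      fix i j assume "(i, j) \<in> R" "(j, i) \<in> R"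
      then show "i = j"
        using underS_asym[of "rank i" "rank j"] underS_notIn[of "rank i" \<kappa>] antisymD[OF ANTISYM, of i j]
        by (auto simp: R_def)
    qed
    show "total_on (Field \<kappa>) R"
    proof (rule total_onI)
      fix i j assume ij: "i \<in> Field \<kappa>" "j \<in> Field \<kappa>"
      then show "(i, j) \<in> R \<or> (j, i) \<in> R"
        using underS_linear[of "rank i" "rank j"] rank_Field TOTALS by (auto simp: R_def)
    qed
    have "wf (inv_image ((\<kappa> - Id) <*lex*> (\<kappa> - Id)) (\<lambda>i. (rank i, i)))"
      by (intro wf_inv_image wf_lex_prod WF)
    moreover have "R - Id \<subseteq> inv_image ((\<kappa> - Id) <*lex*> (\<kappa> - Id)) (\<lambda>i. (rank i, i))"
      by (auto simp: R_def Order_Relation.underS_def in_inv_image)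
    ultimately show "wf (R - Id)"
      by (rule wf_subset)
  qed
  have underS_R: "|Order_Relation.underS R j| <o \<kappa>" if j: "j \<in> Field \<kappa>" for j
  proof -
    have "Order_Relation.underS R j \<subseteq> A (rank j)"
    proof
      fix i assume "i \<in> Order_Relation.underS R j"
      then have "i \<in> Field \<kappa>" "rank i \<in> underS (rank j) \<or> rank i = rank j"
        by (auto simp: R_def Order_Relation.underS_def)
      then show "i \<in> A (rank j)"
        using rank_A[of i] A_mono by auto
    qed
    then have "|Order_Relation.underS R j| \<le>o |A (rank j)|"
      by (rule card_of_mono1)
    then show ?thesis
      using card_A_less[OF rank_Field[OF j]] by (rule ordLeq_ordLess_trans)
  qed
  \<comment> \<open>Otherwise \<kappa> would be isomorphic to a proper initial segment of
    \<open>R\<close>, which has fewer than \<kappa> elements.\<close>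
  have "\<not> \<kappa> <o R"
  proof
    assume "\<kappa> <o R"
    then obtain j where j: "j \<in> Field R" "\<kappa> =o Restr R (Order_Relation.underS R j)"
      using ordLess_iff_ordIso_Restr[OF \<open>Well_order R\<close> WELL] by blast
    have "|Field \<kappa>| =o |Field (Restr R (Order_Relation.underS R j))|"
      using j(2) by (rule card_of_cong)
    moreover have "|Field (Restr R (Order_Relation.underS R j))| \<le>o |Order_Relation.underS R j|"
      by (rule card_of_mono1) (auto simp: Field_def)
    ultimately have "|Field \<kappa>| \<le>o |Order_Relation.underS R j|"
      by (rule ordIso_ordLeq_trans)
    then have "|Field \<kappa>| <o \<kappa>"
      using underS_R j(1) unfolding Field_R by (blast intro: ordLeq_ordLess_trans)
    then show False
      using card_of_Field_ordIso[OF Card_order] not_ordLess_ordIso by blast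
  qed
  then have "R \<le>o \<kappa>"
    using ordLess_or_ordLeq[OF WELL \<open>Well_order R\<close>] by blast
  moreover have "|Field \<kappa>| \<le>o R"
    using card_of_least[OF \<open>Well_order R\<close>] unfolding Field_R .
  then have "\<kappa> \<le>o R"
    by (rule ordIso_ordLeq_trans[OF ordIso_symmetric[OF card_of_Field_ordIso[OF Card_order]]])
  ultimately have "\<kappa> =o R"
    by (simp add: ordIso_iff_ordLeq)
  then obtain \<pi> where "iso \<kappa> R \<pi>"
    unfolding ordIso_def by blast
  then have \<pi>: "bij_betw \<pi> (Field \<kappa>) (Field \<kappa>)"
    and \<pi>_mono: "\<And>a b. a \<in> Field \<kappa> \<Longrightarrow> b \<in> Field \<kappa> \<Longrightarrow> (a, b) \<in> \<kappa> \<longleftrightarrow> (\<pi> a, \<pi> b) \<in> R"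
    unfolding iso_iff2 Field_R by blast+
  have \<pi>_Field: "\<pi> a \<in> Field \<kappa>" if "a \<in> Field \<kappa>" for a
    using \<pi> that by (auto simp: bij_betw_def)
  \<comment> \<open>Ranks do not decrease along \<open>R\<close>, so the preimage of
    \<open>A \<alpha>\<close> is closed downwards. It misses the preimage of
    \<open>s \<alpha>\<close>, hence is a strict initial segment; its end point becomes
    \<open>\<theta> \<alpha>\<close>.\<close>
  have "\<exists>t\<in>Field \<kappa>. {c \<in> Field \<kappa>. \<pi> c \<in> A \<alpha>} = underS t" if \<alpha>: "\<alpha> \<in> Field \<kappa>" for \<alpha>
  proof -
    have "ofilter {c \<in> Field \<kappa>. \<pi> c \<in> A \<alpha>}"
      unfolding ofilter_def
    proof (intro conjI ballI subsetI)
      fix c d assume c: "c \<in> {c \<in> Field \<kappa>. \<pi> c \<in> A \<alpha>}" and "d \<in> under c"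
      then have dc: "(d, c) \<in> \<kappa>" "d \<in> Field \<kappa>"
        by (auto simp: Order_Relation.under_def Field_def)
      then have "(\<pi> d, \<pi> c) \<in> R"
        using \<pi>_mono[of d c] c by blast
      then have "rank (\<pi> d) \<in> underS (rank (\<pi> c)) \<or> rank (\<pi> d) = rank (\<pi> c)"
        by (auto simp: R_def)
      then have "(rank (\<pi> d), rank (\<pi> c)) \<in> \<kappa>"
        using REFL rank_Field[OF \<pi>_Field[OF dc(2)]] by (auto simp: Order_Relation.underS_def refl_on_def)
      moreover have "(rank (\<pi> c), \<alpha>) \<in> \<kappa>"
        using A_iff[of "\<pi> c" \<alpha>] \<alpha> c \<pi>_Field by blast
      ultimately have "(rank (\<pi> d), \<alpha>) \<in> \<kappa>"
        by (rule transD[OF TRANS])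
      then show "d \<in> {c \<in> Field \<kappa>. \<pi> c \<in> A \<alpha>}"
        using A_iff[of "\<pi> d" \<alpha>] \<alpha> dc(2) \<pi>_Field by blast
    qed auto
    moreover have "s \<alpha> \<in> \<pi> ` Field \<kappa>"
      using s_in[OF \<alpha>] \<pi> by (simp add: bij_betw_def)
    then have "{c \<in> Field \<kappa>. \<pi> c \<in> A \<alpha>} \<noteq> Field \<kappa>"
      using s_notin[OF \<alpha>] by force
    ultimately show ?thesis
      using ofilter_underS_Field by blast
  qed
  then obtain \<theta> where \<theta>: "\<And>\<alpha>. \<alpha> \<in> Field \<kappa> \<Longrightarrow> \<theta> \<alpha> \<in> Field \<kappa>"
    "\<And>\<alpha>. \<alpha> \<in> Field \<kappa> \<Longrightarrow> underS (\<theta> \<alpha>) = {c \<in> Field \<kappa>. \<pi> c \<in> A \<alpha>}"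
    by metis
  have image: "\<pi> ` underS (\<theta> \<alpha>) = A \<alpha>" if "\<alpha> \<in> Field \<kappa>" for \<alpha>
  proof -
    have "\<pi> ` {c \<in> Field \<kappa>. \<pi> c \<in> A \<alpha>} = \<pi> ` Field \<kappa> \<inter> A \<alpha>"
      by blast
    then show ?thesis
      using \<theta>(2)[OF that] \<pi> A_Field[of \<alpha>] by (simp add: bij_betw_def inf.absorb2)
  qed
  show thesis
  proof (rule that[OF \<pi>])
    show "ord_strict_mono \<kappa> \<theta>"
      unfolding ord_strict_mono_def
    proof (intro conjI ballI)
      fix \<beta> \<alpha> assume "\<beta> \<in> Field \<kappa>" and \<alpha>: "\<alpha> \<in> underS \<beta>"
      then have F: "\<alpha> \<in> Field \<kappa>" "\<beta> \<in> Field \<kappa>"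
        using underS_imp_Field by blast+
      \<comment> \<open>The witness of strictness is \<open>s \<alpha>\<close>, which lies in
        \<open>A \<beta>\<close> but not in \<open>A \<alpha>\<close>.\<close>
      have "\<not> underS (\<theta> \<beta>) \<subseteq> underS (\<theta> \<alpha>)"
        using image[OF F(1)] image[OF F(2)] s_A[OF \<alpha>] s_notin[OF F(1)] by blast
      then show "\<theta> \<alpha> \<in> underS (\<theta> \<beta>)"
        using not_underS_iff[OF \<theta>(1)[OF F(1)] \<theta>(1)[OF F(2)]]
          underS_subset_iff[OF \<theta>(1)[OF F(2)] \<theta>(1)[OF F(1)]] by blast
    qed (use \<theta> in blast)
    show "ord_continuous \<kappa> \<theta>"
      unfolding ord_continuous_def
    proof (intro allI impI)
      fix l assume l: "limit_ord \<kappa> l"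
      then have lF: "l \<in> Field \<kappa>" "underS l \<subseteq> Field \<kappa>"
        by (auto simp: limit_ord_def underS_imp_Field)
      have "underS (\<theta> l) = (\<Union>\<alpha>\<in>underS l. underS (\<theta> \<alpha>))"
        using \<theta>(2)[OF lF(1)] \<theta>(2) lF(2) A_limit[OF l] by (auto simp: subset_iff)
      then show "\<theta> l = supr (\<theta> ` underS l)"
        using \<theta>(1) lF by (intro supr_eqI[symmetric]) auto
    qed
    fix \<alpha> assume \<alpha>: "\<alpha> \<in> Field \<kappa>"
    have "inj_on \<pi> (underS (\<theta> \<alpha>))"
      using \<pi> Order_Relation.underS_Field[of \<kappa> "\<theta> \<alpha>"] unfolding bij_betw_def by (blast intro: inj_on_subset)
    then have "bij_betw \<pi> (underS (\<theta> \<alpha>)) (A \<alpha>)"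
      using image[OF \<alpha>] by (simp add: bij_betw_def)
    then have "|underS (\<theta> \<alpha>)| =o |A \<alpha>|"
      by (rule card_of_ordIsoI)
    then show "|underS (\<theta> \<alpha>)| =o ord_card \<kappa> \<alpha>"
      using card_A[OF \<alpha>] by (rule ordIso_transitive)
    show "\<exists>B. \<pi> ` underS (\<theta> \<alpha>) = cl B"
      using image[OF \<alpha>] A_def by blast
  qed
qed

end

section \<open>Closed unbounded sets of countable ordinals\<close>

context uncountable_cardinal
begin

text \<open>Nothing below \<open>b\<close> bounds \<open>T\<close> strictly, so everything below
  \<open>b\<close> is at most some member of \<open>T\<close>. A strict bound keeps \<open>T\<close>
  inside the segment even if \<open>T\<close> has a greatest element.\<close>

lemma least_strict_upper_bound:
  assumes T: "T \<subseteq> Field \<kappa>" and u: "u \<in> Field \<kappa>" "T \<subseteq> underS u"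
  obtains b where "b \<in> Field \<kappa>" "T \<subseteq> underS b" "\<And>c. c \<in> underS b \<Longrightarrow> \<exists>t\<in>T. c \<in> under t"
    "\<And>v. v \<in> Field \<kappa> \<Longrightarrow> T \<subseteq> underS v \<Longrightarrow> (b, v) \<in> \<kappa>"
proof
  let ?b = "minim {b \<in> Field \<kappa>. T \<subseteq> underS b}"
  show b: "?b \<in> Field \<kappa>" "T \<subseteq> underS ?b"
    using minim_Collect[of u "\<lambda>b. T \<subseteq> underS b"] u by auto
  show least: "(?b, v) \<in> \<kappa>" if "v \<in> Field \<kappa>" "T \<subseteq> underS v" for v
    using that by (rule minim_Collect_le)
  fix c assume c: "c \<in> underS ?b"
  then have cF: "c \<in> Field \<kappa>"
    using underS_imp_Field by blast
  then have "\<not> T \<subseteq> underS c"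
    using least[of c] not_underS_iff[OF cF b(1)] c by blast
  then obtain t where "t \<in> T" "t \<notin> underS c"
    by blast
  then show "\<exists>t\<in>T. c \<in> under t"
    using not_underS_iff[of t c] T cF by (auto simp: Order_Relation.under_def)
qed

text \<open>Countably many countable initial segments cannot exhaust \<kappa>, and a point outside
  their union bounds \<open>B\<close>.\<close>

lemma countable_bounded:
  assumes cu: "\<forall>a\<in>Field \<kappa>. countable (underS a)" and B: "countable B" "B \<subseteq> Field \<kappa>"
  obtains b where "b \<in> Field \<kappa>" "B \<subseteq> underS b"
proof -
  have "countable (under a)" if a: "a \<in> B" for a
  proof -
    obtain b where "b \<in> Field \<kappa>" "a \<in> underS b"
      using ex_greater[OF subsetD[OF B(2) a]] by blast
    then show ?thesis
      using countable_subset[OF under_subset_underS[of a b]] cu by blast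
  qed
  then have "countable (\<Union>a\<in>B. under a)"
    using B(1) by blast
  then obtain c where c: "c \<in> Field \<kappa>" "c \<notin> (\<Union>a\<in>B. under a)"
    by (rule ex_not_in[OF countable_less])
  have "a \<in> underS c" if "a \<in> B" for a
    using not_underS_iff[of a c] c that B(2) by (auto simp: Order_Relation.under_def)
  with c(1) that show thesis by blast
qed

text \<open>The limit points closed under \<rho> form a club, and \<sigma> is its increasing
  enumeration. Their segments are infinite and countable, which is the required cardinality also at
  finite \<alpha>.\<close>

theorem club_enumeration:
  assumes cu: "\<forall>a\<in>Field \<kappa>. countable (underS a)"
    and \<rho>: "\<And>a. a \<in> Field \<kappa> \<Longrightarrow> \<rho> a \<in> Field \<kappa>"
  obtains \<sigma> where "ord_strict_mono \<kappa> \<sigma>" "ord_continuous \<kappa> \<sigma>"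
    "\<And>\<alpha>. \<alpha> \<in> Field \<kappa> \<Longrightarrow> |underS (\<sigma> \<alpha>)| =o ord_card \<kappa> \<alpha>"
    "\<And>\<alpha>. \<alpha> \<in> Field \<kappa> \<Longrightarrow> limit_ord \<kappa> (\<sigma> \<alpha>)"
    "\<And>\<alpha> a. \<alpha> \<in> Field \<kappa> \<Longrightarrow> a \<in> underS (\<sigma> \<alpha>) \<Longrightarrow> \<rho> a \<in> underS (\<sigma> \<alpha>)"
proof -
  define C where "C c \<longleftrightarrow> limit_ord \<kappa> c \<and> infinite (underS c) \<and> (\<forall>a\<in>underS c. \<rho> a \<in> underS c)" for c
  \<comment> \<open>One criterion serves both unboundedness and closure: below \<open>b\<close>
    there is a cofinal set \<open>T\<close> in which every \<open>t\<close> is followed by a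
    \<open>t'\<close> lying above the \<rho>-images of everything up to \<open>t\<close>.\<close>
  have C_sup: "C b" if b: "b \<in> Field \<kappa>" "T \<subseteq> underS b" "\<And>c. c \<in> underS b \<Longrightarrow> \<exists>t\<in>T. c \<in> under t"
    and inf: "infinite (underS b)"
    and T: "\<And>t. t \<in> T \<Longrightarrow> \<exists>t'\<in>T. t \<in> underS t' \<and> (\<forall>a\<in>under t. \<rho> a \<in> underS t')" for b T
  proof -
    have step: "\<exists>t\<in>T. c \<in> underS t \<and> \<rho> c \<in> underS t \<and> t \<in> underS b" if c: "c \<in> underS b" for c
    proof -
      obtain t where t: "t \<in> T" "c \<in> under t"
        using b(3)[OF c] by blast
      obtain t' where t': "t' \<in> T" "t \<in> underS t'" "\<forall>a\<in>under t. \<rho> a \<in> underS t'"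
        using T[OF t(1)] by blast
      then show ?thesis
        using t under_subset_underS[OF t'(2)] b(2) by blast
    qed
    have "underS b \<noteq> {}"
      using inf by auto
    moreover have "\<rho> c \<in> underS b" if "c \<in> underS b" for c
      using step[OF that] underS_trans[of "\<rho> c"] by blast
    ultimately show ?thesis
      unfolding C_def limit_ord_def using b(1) inf step by blast
  qed
  obtain N where N: "countable N" "infinite N" "N \<subseteq> Field \<kappa>"
    using infinite_countable_subset'[OF infinite_Field] by blast
  have "\<exists>b\<in>Field \<kappa>. under a \<union> \<rho> ` under a \<subseteq> underS b" if a: "a \<in> Field \<kappa>" for a
  proof -
    obtain b where "b \<in> Field \<kappa>" "a \<in> underS b"
      using ex_greater[OF a] by blast
    then have "countable (under a)"
      using countable_subset[OF under_subset_underS[of a b]] cu by blast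
    then have "countable (under a \<union> \<rho> ` under a)"
      by simp
    moreover have "under a \<union> \<rho> ` under a \<subseteq> Field \<kappa>"
      using \<rho> under_Field[of \<kappa> a] by blast
    ultimately obtain b where "b \<in> Field \<kappa>" "under a \<union> \<rho> ` under a \<subseteq> underS b"
      by (rule countable_bounded[OF cu])
    then show ?thesis by blast
  qed
  then obtain g where g: "\<And>a. a \<in> Field \<kappa> \<Longrightarrow> g a \<in> Field \<kappa>"
    "\<And>a. a \<in> Field \<kappa> \<Longrightarrow> under a \<union> \<rho> ` under a \<subseteq> underS (g a)"
    by metis
  have C_unbounded: "\<exists>c\<in>Field \<kappa>. C c \<and> B \<subseteq> underS c" if B: "countable B" "B \<subseteq> Field \<kappa>" for B
  proof -
    have "countable (N \<union> B)" "N \<union> B \<subseteq> Field \<kappa>"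
      using N B by auto
    then obtain z where z: "z \<in> Field \<kappa>" "N \<union> B \<subseteq> underS z"
      by (rule countable_bounded[OF cu])
    \<comment> \<open>Iterating \<open>g\<close> produces a cofinal sequence as demanded by
      \<open>C_sup\<close>. Its start lies above \<open>B\<close> and above \<open>N\<close>, and
      the latter makes the resulting segment infinite.\<close>
    define t where "t n = (g ^^ n) z" for n
    have t_Field: "t n \<in> Field \<kappa>" for n
      by (induction n) (auto simp: t_def z g)
    have t_Suc: "under (t n) \<union> \<rho> ` under (t n) \<subseteq> underS (t (Suc n))" for n
      using g(2)[OF t_Field[of n]] by (simp add: t_def)
    have self: "t n \<in> under (t n)" for n
      using t_Field REFL by (simp add: Order_Relation.under_def refl_on_def)
    have T: "countable (range t)" "range t \<subseteq> Field \<kappa>"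
      using t_Field by auto
    obtain u where u: "u \<in> Field \<kappa>" "range t \<subseteq> underS u"
      by (rule countable_bounded[OF cu T])
    obtain b where b: "b \<in> Field \<kappa>" "range t \<subseteq> underS b"
      "\<And>c. c \<in> underS b \<Longrightarrow> \<exists>t\<in>range t. c \<in> under t"
      by (rule least_strict_upper_bound[OF T(2) u]) iprover
    have "t 0 \<in> underS b"
      using b(2) by blast
    then have sub: "N \<union> B \<subseteq> underS b"
      using z(2) underS_mono[of z b] by (auto simp: t_def)
    have "C b"
    proof (rule C_sup[OF b])
      show "infinite (underS b)"
        using N(2) sub finite_subset by blast
      fix s assume "s \<in> range t"
      then obtain n where "s = t n" by blast
      then show "\<exists>t'\<in>range t. s \<in> underS t' \<and> (\<forall>a\<in>under s. \<rho> a \<in> underS t')"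
        using t_Suc[of n] self[of n] by (intro bexI[of _ "t (Suc n)"]) auto
    qed
    with b(1) sub show ?thesis by blast
  qed
  \<comment> \<open>Intersecting with \<open>Field \<kappa>\<close> makes the set non-empty before \<open>\<sigma>\<close> is known to stay in \<open>Field \<kappa>\<close>.\<close>
  obtain \<sigma> where \<sigma>: "\<And>\<alpha>. \<sigma> \<alpha> = minim {c \<in> Field \<kappa>. C c \<and> \<sigma> ` underS \<alpha> \<inter> Field \<kappa> \<subseteq> underS c}"
    using recursion_underS[of "\<lambda>S. minim {c \<in> Field \<kappa>. C c \<and> S \<inter> Field \<kappa> \<subseteq> underS c}"] by blast
  have ex: "\<exists>c. c \<in> Field \<kappa> \<and> (C c \<and> \<sigma> ` underS \<alpha> \<inter> Field \<kappa> \<subseteq> underS c)" if "\<alpha> \<in> Field \<kappa>" for \<alpha>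
    using C_unbounded[of "\<sigma> ` underS \<alpha> \<inter> Field \<kappa>"] cu that by auto
  have \<sigma>_Field: "\<sigma> \<alpha> \<in> Field \<kappa>" and \<sigma>_C: "C (\<sigma> \<alpha>)"
    and \<sigma>_ub: "\<sigma> ` underS \<alpha> \<inter> Field \<kappa> \<subseteq> underS (\<sigma> \<alpha>)" if \<alpha>: "\<alpha> \<in> Field \<kappa>" for \<alpha>
    using ex[OF \<alpha>] minim_Collect[of _ "\<lambda>c. C c \<and> \<sigma> ` underS \<alpha> \<inter> Field \<kappa> \<subseteq> underS c"]
    unfolding \<sigma>[of \<alpha>, symmetric] by blast+
  have \<sigma>_mono: "\<sigma> \<alpha> \<in> underS (\<sigma> \<beta>)" if "\<alpha> \<in> underS \<beta>" for \<alpha> \<beta>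
    using \<sigma>_ub[of \<beta>] \<sigma>_Field[of \<alpha>] that underS_imp_Field[OF that] by blast
  have closed: "\<rho> a \<in> underS (\<sigma> \<alpha>)" if "\<alpha> \<in> Field \<kappa>" "a \<in> underS (\<sigma> \<alpha>)" for \<alpha> a
    using \<sigma>_C[OF that(1)] that(2) by (auto simp: C_def)
  have continuous: "\<sigma> l = supr (\<sigma> ` underS l)" if l: "limit_ord \<kappa> l" for l
  proof -
    have lF: "l \<in> Field \<kappa>"
      using l by (simp add: limit_ord_def)
    have S: "\<sigma> ` underS l \<subseteq> Field \<kappa>"
      using \<sigma>_Field underS_imp_Field by blast
    have up: "\<exists>\<beta>\<in>underS l. \<alpha> \<in> underS \<beta>" if "\<alpha> \<in> underS l" for \<alpha>
      using l that by (auto simp: limit_ord_def)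
    have ub: "\<sigma> ` underS l \<subseteq> underS (\<sigma> l)"
      using \<sigma>_mono by blast
    obtain b where b: "b \<in> Field \<kappa>" "\<sigma> ` underS l \<subseteq> underS b"
      "\<And>c. c \<in> underS b \<Longrightarrow> \<exists>t\<in>\<sigma> ` underS l. c \<in> under t" "(b, \<sigma> l) \<in> \<kappa>"
      by (rule least_strict_upper_bound[OF S \<sigma>_Field[OF lF] ub]) (use \<sigma>_Field[OF lF] ub in iprover)
    \<comment> \<open>The least strict upper bound \<open>b\<close> of the earlier values already
      lies in the club, so the least admissible choice \<open>\<sigma> l\<close> is \<open>b\<close>
      itself.\<close>
    have "C b"
    proof (rule C_sup[OF b(1-3)])
      obtain \<alpha> where \<alpha>: "\<alpha> \<in> underS l"
        using l by (auto simp: limit_ord_def)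
      then have "underS (\<sigma> \<alpha>) \<subseteq> underS b"
        using b(2) underS_mono by blast
      moreover have "infinite (underS (\<sigma> \<alpha>))"
        using \<sigma>_C[of \<alpha>] underS_imp_Field[OF \<alpha>] by (simp add: C_def)
      ultimately show "infinite (underS b)"
        using finite_subset by blast
      fix t assume "t \<in> \<sigma> ` underS l"
      then obtain \<alpha> where \<alpha>: "\<alpha> \<in> underS l" "t = \<sigma> \<alpha>"
        by blast
      obtain \<beta> where \<beta>: "\<beta> \<in> underS l" "\<alpha> \<in> underS \<beta>"
        using up[OF \<alpha>(1)] by blast
      have t: "t \<in> underS (\<sigma> \<beta>)"
        using \<sigma>_mono[OF \<beta>(2)] \<alpha>(2) by simp
      have "\<rho> a \<in> underS (\<sigma> \<beta>)" if "a \<in> under t" for a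
        using closed[of \<beta> a] underS_imp_Field[OF \<beta>(1)] under_subset_underS[OF t] that by blast
      with t \<beta>(1) show "\<exists>t'\<in>\<sigma> ` underS l. t \<in> underS t' \<and> (\<forall>a\<in>under t. \<rho> a \<in> underS t')"
        by blast
    qed
    moreover have "\<sigma> ` underS l \<inter> Field \<kappa> \<subseteq> underS b"
      using b(2) by blast
    ultimately have "(\<sigma> l, b) \<in> \<kappa>"
      unfolding \<sigma>[of l] using b(1) by (intro minim_Collect_le conjI)
    with b(4) have eq: "\<sigma> l = b"
      using ANTISYM by (auto dest: antisymD)
    have "underS b = (\<Union>a\<in>\<sigma> ` underS l. underS a)"
    proof
      show "(\<Union>a\<in>\<sigma> ` underS l. underS a) \<subseteq> underS b"
        using b(2) underS_mono[of _ b] by blast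
      show "underS b \<subseteq> (\<Union>a\<in>\<sigma> ` underS l. underS a)"
      proof
        fix c assume "c \<in> underS b"
        then obtain \<alpha> where \<alpha>: "\<alpha> \<in> underS l" "c \<in> under (\<sigma> \<alpha>)"
          using b(3) by blast
        then obtain \<beta> where "\<beta> \<in> underS l" "\<alpha> \<in> underS \<beta>"
          using up by blast
        then show "c \<in> (\<Union>a\<in>\<sigma> ` underS l. underS a)"
          using \<alpha>(2) under_subset_underS[OF \<sigma>_mono[of \<alpha> \<beta>]] by blast
      qed
    qed
    then have "supr (\<sigma> ` underS l) = b"
      using S b(1) by (intro supr_eqI)
    with eq show ?thesis by simp
  qed
  show thesis
  proof (rule that)
    show "ord_strict_mono \<kappa> \<sigma>"
      unfolding ord_strict_mono_def using \<sigma>_Field \<sigma>_mono by blast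
    show "ord_continuous \<kappa> \<sigma>"
      unfolding ord_continuous_def using continuous by blast
    fix \<alpha> assume \<alpha>: "\<alpha> \<in> Field \<kappa>"
    show "limit_ord \<kappa> (\<sigma> \<alpha>)"
      using \<sigma>_C[OF \<alpha>] by (simp add: C_def)
    have "infinite (underS (\<sigma> \<alpha>))"
      using \<sigma>_C[OF \<alpha>] by (simp add: C_def)
    then have "Cinfinite |underS (\<sigma> \<alpha>)|"
      by (simp add: cinfinite_def Field_card_of card_of_card_order_on)
    then have "ord_card \<kappa> \<alpha> \<le>o |underS (\<sigma> \<alpha>)|"
      unfolding ord_card_def using cu \<alpha> by (intro csum_natLeq_le countable_card_of_le) auto
    moreover have "|underS (\<sigma> \<alpha>)| \<le>o ord_card \<kappa> \<alpha>"
      using bspec[OF cu \<sigma>_Field[OF \<alpha>]] Cinfinite_ord_card by (rule countable_card_of_le)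
    ultimately show "|underS (\<sigma> \<alpha>)| =o ord_card \<kappa> \<alpha>"
      by (simp add: ordIso_iff_ordLeq)
  qed (rule closed)
qed

end


section \<open>Projectional resolutions\<close>

text \<open>A finite combination uses indices from a single member of the chain. This yields both
  the limit condition and the density condition of a PRI.\<close>

lemma closed_span_UN_chain:
  assumes ne: "J \<noteq> {}" and chain: "\<And>i j. i \<in> J \<Longrightarrow> j \<in> J \<Longrightarrow> A i \<subseteq> A j \<or> A j \<subseteq> A i"
  shows "closed_span (x ` (\<Union>j\<in>J. A j)) = closure (\<Union>j\<in>J. closed_span (x ` A j))"
proof
  have "closed_span (x ` A j) \<subseteq> closed_span (x ` (\<Union>j\<in>J. A j))" if "j \<in> J" for j
    using that by (intro closed_span_mono) blast
  then show "closure (\<Union>j\<in>J. closed_span (x ` A j)) \<subseteq> closed_span (x ` (\<Union>j\<in>J. A j))"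
    by (intro closure_minimal closed_closed_span UN_least)
  have "span (x ` (\<Union>j\<in>J. A j)) \<subseteq> (\<Union>j\<in>J. closed_span (x ` A j))"
  proof
    fix v assume "v \<in> span (x ` (\<Union>j\<in>J. A j))"
    then obtain F where F: "finite F" "F \<subseteq> (\<Union>j\<in>J. A j)" "v \<in> span (x ` F)"
      by (rule span_image_finite)
    obtain l where l: "set l = F"
      using finite_list[OF F(1)] by blast
    have 1: "A ` J \<noteq> {}"
      using ne by simp
    have 2: "B \<subseteq> C \<or> C \<subseteq> B" if "B \<in> A ` J" "C \<in> A ` J" for B C
      using that chain by blast
    have 3: "l \<in> lists (\<Union>(A ` J))"
      using l F(2) by (auto simp: lists_eq_set)
    obtain B where B: "B \<in> A ` J" "l \<in> lists B"
      by (rule lists_Union_chain[OF 1 2 3])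
    then obtain j where j: "j \<in> J" "B = A j"
      by blast
    have "F \<subseteq> A j"
      using B(2) l j(2) by (auto simp: lists_eq_set)
    then have "span (x ` F) \<subseteq> closed_span (x ` A j)"
      by (meson image_mono order_trans span_le_closed_span span_mono)
    with F(3) j(1) show "v \<in> (\<Union>j\<in>J. closed_span (x ` A j))"
      by blast
  qed
  then show "closed_span (x ` (\<Union>j\<in>J. A j)) \<subseteq> closure (\<Union>j\<in>J. closed_span (x ` A j))"
    unfolding closed_span_def[of "x ` (\<Union>j\<in>J. A j)"] by (rule closure_mono)
qed

lemma M_basis_reindex:
  assumes e: "bij_betw e J I" and M: "M_basis I x f"
  shows "M_basis J (x \<circ> e) (f \<circ> e)"
proof -
  have im: "e ` J = I" and inj: "inj_on e J"
    using e by (auto simp: bij_betw_def)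
  have "blinfun_apply (f (e i)) (x (e j)) = (if i = j then 1 else 0)" if "i \<in> J" "j \<in> J" for i j
  proof -
    have "e i \<in> I" "e j \<in> I" "e i = e j \<longleftrightarrow> i = j"
      using im inj that by (auto dest: inj_onD)
    then show ?thesis
      using M by (simp add: M_basis_def)
  qed
  moreover have "(x \<circ> e) ` J = x ` I" "(f \<circ> e) ` J = f ` I"
    unfolding im[symmetric] by (simp_all add: image_comp)
  ultimately show ?thesis
    using M by (simp add: M_basis_def)
qed

section \<open>Resolutions from decoupled initial segments\<close>

locale dd_basis_cardinal = dd_basis "Field \<kappa>" x f + uncountable_cardinal \<kappa>
  for \<kappa> :: "'k rel" and x :: "'k \<Rightarrow> 'a::banach" and f :: "'k \<Rightarrow> 'a \<Rightarrow>\<^sub>L real" +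
  assumes dens_UNIV: "dens (UNIV :: 'a set) =o \<kappa>"
begin

text \<open>Since the operators enter only through their basis values, the argument covers
  projections built from a filtration as well as a subfamily of a given PRI.\<close>

lemma bimonotone_PRI_subordinated:
  fixes P :: "'k \<Rightarrow> 'a \<Rightarrow>\<^sub>L 'a"
  assumes \<theta>: "ord_strict_mono \<kappa> \<theta>" "ord_continuous \<kappa> \<theta>"
    and card: "\<And>\<alpha>. \<alpha> \<in> Field \<kappa> \<Longrightarrow> |underS (\<theta> \<alpha>)| =o ord_card \<kappa> \<alpha>"
    and dec: "\<And>\<alpha>. \<alpha> \<in> Field \<kappa> \<Longrightarrow> decoupled (underS (\<theta> \<alpha>)) (underS (\<theta> \<alpha>))"
    and P: "\<And>\<alpha> i. \<alpha> \<in> Field \<kappa> \<Longrightarrow> i \<in> Field \<kappa> \<Longrightarrow> P \<alpha> (x i) = (if i \<in> underS (\<theta> \<alpha>) then x i else 0)"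
  shows "bimonotone_PRI \<kappa> P" "subordinated \<kappa> x P"
proof -
  have \<theta>_Field: "\<theta> \<alpha> \<in> Field \<kappa>" if "\<alpha> \<in> Field \<kappa>" for \<alpha>
    using \<theta>(1) that by (simp add: ord_strict_mono_def)
  have \<theta>_less: "\<theta> \<alpha> \<in> underS (\<theta> \<beta>)" if "\<alpha> \<in> underS \<beta>" for \<alpha> \<beta>
    using \<theta>(1) that underS_imp_Field[OF that] by (simp add: ord_strict_mono_def)
  have sub: "underS (\<theta> \<alpha>) \<subseteq> underS (\<theta> \<beta>)" if "(\<alpha>, \<beta>) \<in> \<kappa>" for \<alpha> \<beta>
  proof (cases "\<alpha> = \<beta>")
    case False
    then have "\<alpha> \<in> underS \<beta>"
      using that by (simp add: Order_Relation.underS_def)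
    then show ?thesis
      by (rule underS_mono[OF \<theta>_less])
  qed simp
  have bi: "bicontractive (P \<alpha>)" "range (P \<alpha>) = closed_span (x ` underS (\<theta> \<alpha>))"
    if \<alpha>: "\<alpha> \<in> Field \<kappa>" for \<alpha>
  proof -
    \<comment> \<open>The cardinality condition includes \<aleph>0, so the segment is nonempty
      already at the first ordinal; it is proper because it misses
      \<open>\<theta> \<alpha>\<close>.\<close>
    have "underS (\<theta> \<alpha>) \<noteq> {}"
    proof
      assume empty: "underS (\<theta> \<alpha>) = {}"
      have "|{} :: 'k set| =o ord_card \<kappa> \<alpha>"
        using card[OF \<alpha>] unfolding empty .
      then have "Cinfinite |{} :: 'k set|"
        using Cinfinite_cong[OF ordIso_symmetric] Cinfinite_ord_card by blast
      then show False
        by (simp add: cinfinite_def Field_card_of)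
    qed
    moreover have "underS (\<theta> \<alpha>) \<subseteq> Field \<kappa>" "underS (\<theta> \<alpha>) \<noteq> Field \<kappa>"
      using underS_Field2[OF \<theta>_Field[OF \<alpha>]] by auto
    ultimately show "bicontractive (P \<alpha>)" "range (P \<alpha>) = closed_span (x ` underS (\<theta> \<alpha>))"
      using decoupled_bicontractive[OF dec[OF \<alpha>], of "P \<alpha>"] P[OF \<alpha>] by blast+
  qed
  have comp: "P \<alpha> o\<^sub>L P \<beta> = P (ord_min \<kappa> \<alpha> \<beta>)" if \<alpha>: "\<alpha> \<in> Field \<kappa>" and \<beta>: "\<beta> \<in> Field \<kappa>" for \<alpha> \<beta>
  proof (rule blinfun_eq_on_basis)
    fix i assume i: "i \<in> Field \<kappa>"
    have total: "(\<alpha>, \<beta>) \<notin> \<kappa> \<Longrightarrow> (\<beta>, \<alpha>) \<in> \<kappa>"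
      using TOTALS \<alpha> \<beta> by blast
    show "(P \<alpha> o\<^sub>L P \<beta>) (x i) = P (ord_min \<kappa> \<alpha> \<beta>) (x i)"
      using P[OF \<alpha> i] P[OF \<beta> i] sub[of \<alpha> \<beta>] sub[of \<beta> \<alpha>] total
      by (auto simp: ord_min_def blinfun.zero_right)
  qed
  have comp': "P \<beta> o\<^sub>L P \<alpha> = P (ord_min \<kappa> \<alpha> \<beta>)" if \<alpha>: "\<alpha> \<in> Field \<kappa>" and \<beta>: "\<beta> \<in> Field \<kappa>" for \<alpha> \<beta>
  proof -
    have "ord_min \<kappa> \<beta> \<alpha> = ord_min \<kappa> \<alpha> \<beta>"
      using TOTALS \<alpha> \<beta> antisymD[OF ANTISYM, of \<alpha> \<beta>] by (auto simp: ord_min_def)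
    then show ?thesis
      using comp[OF \<beta> \<alpha>] by simp
  qed
  have dens: "dens (range (P \<alpha>)) \<le>o ord_card \<kappa> \<alpha>" if \<alpha>: "\<alpha> \<in> Field \<kappa>" for \<alpha>
  proof -
    have "|x ` underS (\<theta> \<alpha>)| \<le>o |underS (\<theta> \<alpha>)|"
      by (rule card_of_image)
    then have "|x ` underS (\<theta> \<alpha>)| \<le>o ord_card \<kappa> \<alpha>"
      using card[OF \<alpha>] by (rule ordLeq_ordIso_trans)
    then show ?thesis
      unfolding bi(2)[OF \<alpha>] using Cinfinite_ord_card by (rule dens_closed_span)
  qed
  have chain: "underS (\<theta> \<alpha>) \<subseteq> underS (\<theta> \<beta>) \<or> underS (\<theta> \<beta>) \<subseteq> underS (\<theta> \<alpha>)"
    if "\<alpha> \<in> Field \<kappa>" "\<beta> \<in> Field \<kappa>" for \<alpha> \<beta>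
    using TOTALS that sub[of \<alpha> \<beta>] sub[of \<beta> \<alpha>] by blast
  have limit: "range (P l) = closure (\<Union>\<alpha>\<in>underS l. range (P \<alpha>))" if l: "limit_ord \<kappa> l" for l
  proof -
    have lF: "l \<in> Field \<kappa>" "underS l \<noteq> {}" "underS l \<subseteq> Field \<kappa>"
      using l underS_imp_Field by (auto simp: limit_ord_def)
    have "\<theta> l = supr (\<theta> ` underS l)"
      using \<theta>(2) l by (simp add: ord_continuous_def)
    moreover have "underS (supr (\<theta> ` underS l)) = (\<Union>a\<in>\<theta> ` underS l. underS a)"
    proof (rule underS_supr)
      show "\<theta> ` underS l \<subseteq> Field \<kappa>"
        using lF(3) \<theta>_Field by blast
      show "\<theta> l \<in> Field \<kappa>"
        using lF(1) by (rule \<theta>_Field)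
      show "(a, \<theta> l) \<in> \<kappa>" if "a \<in> \<theta> ` underS l" for a
        using that \<theta>_less by (auto simp: Order_Relation.underS_def)
    qed
    ultimately have "underS (\<theta> l) = (\<Union>\<alpha>\<in>underS l. underS (\<theta> \<alpha>))"
      by simp
    then have "range (P l) = closed_span (x ` (\<Union>\<alpha>\<in>underS l. underS (\<theta> \<alpha>)))"
      using bi(2)[OF lF(1)] by simp
    also have "\<dots> = closure (\<Union>\<alpha>\<in>underS l. closed_span (x ` underS (\<theta> \<alpha>)))"
      using lF(2,3) chain by (intro closed_span_UN_chain) blast+
    also have "(\<Union>\<alpha>\<in>underS l. closed_span (x ` underS (\<theta> \<alpha>))) = (\<Union>\<alpha>\<in>underS l. range (P \<alpha>))"
      using lF(3) bi(2) by (intro SUP_cong) auto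
    finally show ?thesis .
  qed
  \<comment> \<open>An index outside all segments would bound every
    \<open>\<theta> \<alpha>\<close>, but an injective map cannot squeeze \<kappa> into
    \<open>under i\<close>.\<close>
  have cover: "(\<Union>\<alpha>\<in>Field \<kappa>. underS (\<theta> \<alpha>)) = Field \<kappa>"
  proof
    show "(\<Union>\<alpha>\<in>Field \<kappa>. underS (\<theta> \<alpha>)) \<subseteq> Field \<kappa>"
      using underS_imp_Field by blast
    show "Field \<kappa> \<subseteq> (\<Union>\<alpha>\<in>Field \<kappa>. underS (\<theta> \<alpha>))"
    proof (rule subsetI, rule ccontr)
      fix i assume i: "i \<in> Field \<kappa>" "i \<notin> (\<Union>\<alpha>\<in>Field \<kappa>. underS (\<theta> \<alpha>))"
      have "\<theta> \<alpha> \<in> under i" if "\<alpha> \<in> Field \<kappa>" for \<alpha>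
        using not_underS_iff[OF i(1) \<theta>_Field[OF that]] i(2) that by (auto simp: Order_Relation.under_def)
      moreover have "inj_on \<theta> (Field \<kappa>)"
        using \<theta>_less underS_notIn by (intro inj_onI_underS) force+
      ultimately have "|Field \<kappa>| \<le>o |under i|"
        by (intro card_of_ordLeqI)
      then have "|Field \<kappa>| <o \<kappa>"
        using card_of_under[OF i(1)] by (rule ordLeq_ordLess_trans)
      then show False
        using card_of_Field_ordIso[OF Card_order] not_ordLess_ordIso by blast
    qed
  qed
  have "UNIV = closed_span (x ` (\<Union>\<alpha>\<in>Field \<kappa>. underS (\<theta> \<alpha>)))"
    using cover closed_span_basis by simp
  also have "\<dots> = closure (\<Union>\<alpha>\<in>Field \<kappa>. closed_span (x ` underS (\<theta> \<alpha>)))"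
    using infinite_Field chain by (intro closed_span_UN_chain) auto
  also have "(\<Union>\<alpha>\<in>Field \<kappa>. closed_span (x ` underS (\<theta> \<alpha>))) = (\<Union>\<alpha>\<in>Field \<kappa>. range (P \<alpha>))"
    using bi(2) by (intro SUP_cong) auto
  finally have whole: "closure (\<Union>\<alpha>\<in>Field \<kappa>. range (P \<alpha>)) = UNIV" ..
  have proj: "projection (P \<alpha>) \<and> norm (P \<alpha>) = 1" if "\<alpha> \<in> Field \<kappa>" for \<alpha>
    using bi(1)[OF that] by (simp add: bicontractive_def)
  show "bimonotone_PRI \<kappa> P"
    unfolding bimonotone_PRI_def PRI_def
    by (intro conjI ballI allI impI dens_UNIV comp comp' dens limit whole bi(1) proj)
  show "subordinated \<kappa> x P"
    unfolding subordinated_def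
    by (intro exI[of _ \<theta>] conjI ballI \<theta> card bi(2))
qed

text \<open>Decoupling depends only on the sets of vectors involved. For the permuted basis,
  therefore, the hulls of the filtration appear as decoupled initial segments.\<close>

theorem subordinated_up_to_permutation:
  obtains \<pi> P where "bij_betw \<pi> (Field \<kappa>) (Field \<kappa>)" "bimonotone_PRI \<kappa> P" "subordinated \<kappa> (x \<circ> \<pi>) P"
proof -
  obtain cl :: "'k set \<Rightarrow> 'k set" where ext: "\<And>A. A \<subseteq> cl A"
    and closed: "\<And>A. A \<subseteq> Field \<kappa> \<Longrightarrow> cl A \<subseteq> Field \<kappa>"
    and mono: "\<And>A B. A \<subseteq> B \<Longrightarrow> cl A \<subseteq> cl B" and dec: "\<And>A. decoupled (cl A) (cl A)"
    and card: "\<And>A. |cl A| \<le>o |A| +c natLeq"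
    and chain: "\<And>\<A>. \<A> \<noteq> {} \<Longrightarrow> (\<And>A B. A \<in> \<A> \<Longrightarrow> B \<in> \<A> \<Longrightarrow> A \<subseteq> B \<or> B \<subseteq> A) \<Longrightarrow> cl (\<Union>\<A>) = \<Union>(cl ` \<A>)"
    by (rule decoupling_hull) iprover
  obtain \<pi> \<theta> where \<pi>: "bij_betw \<pi> (Field \<kappa>) (Field \<kappa>)" and \<theta>: "ord_strict_mono \<kappa> \<theta>" "ord_continuous \<kappa> \<theta>"
    and card_\<theta>: "\<And>\<alpha>. \<alpha> \<in> Field \<kappa> \<Longrightarrow> |underS (\<theta> \<alpha>)| =o ord_card \<kappa> \<alpha>"
    and cl_\<theta>: "\<And>\<alpha>. \<alpha> \<in> Field \<kappa> \<Longrightarrow> \<exists>B. \<pi> ` underS (\<theta> \<alpha>) = cl B"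
    by (rule filtration_enumeration[OF ext closed mono card chain]) iprover+
  interpret p: dd_basis_cardinal \<kappa> "x \<circ> \<pi>" "f \<circ> \<pi>"
    by unfold_locales
      (intro M_basis_reindex[OF \<pi> M_basis] property_C condition_dd nonseparable dens_UNIV)+
  have pdec: "p.decoupled (underS (\<theta> \<alpha>)) (underS (\<theta> \<alpha>))" if \<alpha>: "\<alpha> \<in> Field \<kappa>" for \<alpha>
  proof -
    obtain B where B: "\<pi> ` underS (\<theta> \<alpha>) = cl B"
      using cl_\<theta>[OF \<alpha>] by blast
    have "\<pi> ` (Field \<kappa> - underS (\<theta> \<alpha>)) = Field \<kappa> - cl B"
      using \<pi> Order_Relation.underS_Field[of \<kappa> "\<theta> \<alpha>"] unfolding bij_betw_def B[symmetric]
      by (metis inj_on_image_set_diff subset_refl Diff_subset)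
    then show ?thesis
      using dec[of B] unfolding decoupled_def p.decoupled_def image_comp[symmetric] B by simp
  qed
  have "\<exists>Q :: 'a \<Rightarrow>\<^sub>L 'a. \<forall>i\<in>Field \<kappa>. Q ((x \<circ> \<pi>) i) = (if i \<in> underS (\<theta> \<alpha>) then (x \<circ> \<pi>) i else 0)"
    if \<alpha>: "\<alpha> \<in> Field \<kappa>" for \<alpha>
    by (rule p.decoupled_projection[OF pdec[OF \<alpha>] Order_Relation.underS_Field]) blast
  then obtain P :: "'k \<Rightarrow> 'a \<Rightarrow>\<^sub>L 'a" where P: "\<And>\<alpha> i. \<alpha> \<in> Field \<kappa> \<Longrightarrow> i \<in> Field \<kappa> \<Longrightarrow>
      P \<alpha> ((x \<circ> \<pi>) i) = (if i \<in> underS (\<theta> \<alpha>) then (x \<circ> \<pi>) i else 0)"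
    by metis
  show thesis
    using \<pi> p.bimonotone_PRI_subordinated[OF \<theta> card_\<theta> pdec P] by (rule that)
qed

end

section \<open>Coarsening a given resolution\<close>

context dd_basis_cardinal
begin

text \<open>The map \<rho> collects three demands on each \<alpha>: room for the hull of the indices
  up to \<alpha>, a stage whose projection fixes \<open>x \<alpha>\<close>, and a bound on the basis
  vectors not killed by \<open>P \<alpha>\<close>. At a limit closed under \<rho>, the given
  projection keeps exactly the basis vectors with smaller index.\<close>

theorem bimonotone_coarsening:
  fixes P :: "'k \<Rightarrow> 'a \<Rightarrow>\<^sub>L 'a"
  assumes PRI: "PRI \<kappa> P" and cu: "\<forall>a\<in>Field \<kappa>. countable (underS a)"
  obtains Q where "coarsening \<kappa> P Q" "bimonotone_PRI \<kappa> Q" "subordinated \<kappa> x Q"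
proof -
  have proj: "projection (P \<alpha>)" "norm (P \<alpha>) = 1" if "\<alpha> \<in> Field \<kappa>" for \<alpha>
    using PRI that by (auto simp: PRI_def)
  have comp: "P \<alpha> o\<^sub>L P \<beta> = P (ord_min \<kappa> \<alpha> \<beta>)" "P \<beta> o\<^sub>L P \<alpha> = P (ord_min \<kappa> \<alpha> \<beta>)"
    if "\<alpha> \<in> Field \<kappa>" "\<beta> \<in> Field \<kappa>" for \<alpha> \<beta>
    using PRI that unfolding PRI_def by blast+
  have limit: "range (P l) = closure (\<Union>\<alpha>\<in>underS l. range (P \<alpha>))" if "limit_ord \<kappa> l" for l
    using PRI that unfolding PRI_def by blast
  have whole: "closure (\<Union>\<alpha>\<in>Field \<kappa>. range (P \<alpha>)) = UNIV"
    using PRI unfolding PRI_def by blast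
  have dens: "dens (range (P \<alpha>)) \<le>o ord_card \<kappa> \<alpha>" if "\<alpha> \<in> Field \<kappa>" for \<alpha>
    using PRI that unfolding PRI_def by blast
  have le1: "norm (P \<alpha> v) \<le> norm v" if "\<alpha> \<in> Field \<kappa>" for \<alpha> v
    using norm_blinfun[of "P \<alpha>" v] proj(2)[OF that] by simp
  have PP: "P \<alpha> (P \<beta> v) = P \<alpha> v" "P \<beta> (P \<alpha> v) = P \<alpha> v" if "(\<alpha>, \<beta>) \<in> \<kappa>" for \<alpha> \<beta> v
  proof -
    have F: "\<alpha> \<in> Field \<kappa>" "\<beta> \<in> Field \<kappa>"
      using that by (auto simp: Field_def)
    have "ord_min \<kappa> \<alpha> \<beta> = \<alpha>"
      using that by (simp add: ord_min_def)
    then show "P \<alpha> (P \<beta> v) = P \<alpha> v" "P \<beta> (P \<alpha> v) = P \<alpha> v"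
      using comp[OF F] by (metis blinfun_apply_blinfun_compose)+
  qed
  have fixed: "P \<beta> v = v" if "v \<in> range (P \<alpha>)" "(\<alpha>, \<beta>) \<in> \<kappa>" for \<alpha> \<beta> v
    using that PP(2) by auto
  have closed_fixed: "closed {v. P \<alpha> v = v}" for \<alpha>
    by (intro closed_Collect_eq continuous_intros)
  obtain cl :: "'k set \<Rightarrow> 'k set" where ext: "\<And>A. A \<subseteq> cl A"
    and closed: "\<And>A. A \<subseteq> Field \<kappa> \<Longrightarrow> cl A \<subseteq> Field \<kappa>"
    and dec: "\<And>A. decoupled (cl A) (cl A)" and card: "\<And>A. |cl A| \<le>o |A| +c natLeq"
    and chain: "\<And>\<A>. \<A> \<noteq> {} \<Longrightarrow> (\<And>A B. A \<in> \<A> \<Longrightarrow> B \<in> \<A> \<Longrightarrow> A \<subseteq> B \<or> B \<subseteq> A) \<Longrightarrow> cl (\<Union>\<A>) = \<Union>(cl ` \<A>)"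
    by (rule decoupling_hull) iprover
  have cu_under: "countable (under a)" if a: "a \<in> Field \<kappa>" for a
  proof -
    obtain b where "b \<in> Field \<kappa>" "a \<in> underS b"
      using ex_greater[OF a] by blast
    then show ?thesis
      using countable_subset[OF under_subset_underS[of a b]] cu by blast
  qed
  have countable_cl: "countable (cl A)" if A: "countable A" for A
  proof -
    have "|A| +c natLeq \<le>o natLeq"
      using A natLeq_Cinfinite unfolding countable_iff_card_of by (rule csum_natLeq_le)
    with card have "|cl A| \<le>o natLeq"
      by (rule ordLeq_transitive)
    then show ?thesis
      by (simp add: countable_iff_card_of)
  qed
  \<comment> \<open>A vector is the limit of a sequence from the ranges, and the countably many
    stages involved have an upper bound; so the closure over all stages adds no vectors.\<close>
  have ex_fixed: "\<exists>b\<in>Field \<kappa>. P b v = v" for v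
  proof -
    have "v \<in> closure (\<Union>\<alpha>\<in>Field \<kappa>. range (P \<alpha>))"
      using whole by simp
    then obtain u where u: "\<And>n::nat. u n \<in> (\<Union>\<alpha>\<in>Field \<kappa>. range (P \<alpha>))" "u \<longlonglongrightarrow> v"
      unfolding closure_sequential by blast
    then have "\<forall>n. \<exists>\<gamma>. \<gamma> \<in> Field \<kappa> \<and> u n \<in> range (P \<gamma>)"
      by blast
    then obtain \<gamma> where \<gamma>: "\<And>n. \<gamma> n \<in> Field \<kappa>" "\<And>n. u n \<in> range (P (\<gamma> n))"
      by metis
    have "countable (range \<gamma>)" "range \<gamma> \<subseteq> Field \<kappa>"
      using \<gamma>(1) by auto
    then obtain b where b: "b \<in> Field \<kappa>" "range \<gamma> \<subseteq> underS b"
      by (rule countable_bounded[OF cu])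
    have "(\<gamma> n, b) \<in> \<kappa>" for n
      using b(2) by (auto simp: Order_Relation.underS_def)
    then have "P b (u n) = u n" for n
      using fixed[OF \<gamma>(2)] by blast
    then have "v \<in> {v. P b v = v}"
      using closed_sequentially[OF closed_fixed[of b] _ u(2)] by simp
    with b(1) show ?thesis by blast
  qed
  \<comment> \<open>The range of \<open>P \<alpha>\<close> is separable, so countably many
    functionals separate its points from 0. Composed with \<open>P \<alpha>\<close> they have
    countable supports, and outside these \<open>P \<alpha>\<close> kills the basis vectors.\<close>
  have countable_image_support: "countable {i \<in> Field \<kappa>. P \<alpha> (x i) \<noteq> 0}" if \<alpha>: "\<alpha> \<in> Field \<kappa>" for \<alpha>
  proof -
    have "ord_card \<kappa> \<alpha> \<le>o natLeq"
      unfolding ord_card_def using cu \<alpha>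
      by (intro csum_natLeq_le natLeq_Cinfinite) (simp flip: countable_iff_card_of)
    with dens[OF \<alpha>] have "dens (range (P \<alpha>)) \<le>o natLeq"
      by (rule ordLeq_transitive)
    then obtain D where D: "countable D" "range (P \<alpha>) \<subseteq> closure D"
      by (rule countable_dense_subset)
    have "\<exists>g :: 'a \<Rightarrow>\<^sub>L real. (\<forall>v. \<bar>g v\<bar> \<le> norm v) \<and> g d = norm d" for d :: 'a
      by (rule Hahn_Banach_norm[of d]) blast
    then obtain g :: "'a \<Rightarrow> 'a \<Rightarrow>\<^sub>L real" where g: "\<And>d v. \<bar>g d v\<bar> \<le> norm v" "\<And>d. g d d = norm d"
      by metis
    have zero: "v = 0" if v: "v \<in> range (P \<alpha>)" "\<And>d. d \<in> D \<Longrightarrow> g d v = 0" for v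
    proof (rule ccontr)
      assume "v \<noteq> 0"
      then obtain d where d: "d \<in> D" "dist d v < norm v / 2"
        using subsetD[OF D(2) v(1)] unfolding closure_approachable by (meson half_gt_zero zero_less_norm_iff)
      have "norm d \<le> norm (d - v)"
        using g(1)[of d "d - v"] g(2)[of d] v(2)[OF d(1)] by (simp add: blinfun.diff_right)
      then show False
        using d(2) norm_triangle_sub[of v d] by (simp add: dist_norm norm_minus_commute)
    qed
    have "{i \<in> Field \<kappa>. P \<alpha> (x i) \<noteq> 0} \<subseteq> (\<Union>d\<in>D. {i \<in> Field \<kappa>. (g d o\<^sub>L P \<alpha>) (x i) \<noteq> 0})"
      using zero by auto
    moreover have "countable (\<Union>d\<in>D. {i \<in> Field \<kappa>. (g d o\<^sub>L P \<alpha>) (x i) \<noteq> 0})"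
      using D(1) countable_support by (intro countable_UN)
    ultimately show ?thesis
      by (rule countable_subset)
  qed
  have "\<exists>b. b \<in> Field \<kappa> \<and> cl (under \<alpha>) \<subseteq> underS b \<and> P b (x \<alpha>) = x \<alpha> \<and>
      (\<forall>i\<in>Field \<kappa>. i \<notin> underS b \<longrightarrow> P \<alpha> (x i) = 0)" if \<alpha>: "\<alpha> \<in> Field \<kappa>" for \<alpha>
  proof -
    obtain \<gamma> where \<gamma>: "\<gamma> \<in> Field \<kappa>" "P \<gamma> (x \<alpha>) = x \<alpha>"
      using ex_fixed by blast
    let ?B = "insert \<gamma> (cl (under \<alpha>) \<union> {i \<in> Field \<kappa>. P \<alpha> (x i) \<noteq> 0})"
    have "countable ?B" "?B \<subseteq> Field \<kappa>"
      using countable_cl[OF cu_under[OF \<alpha>]] countable_image_support[OF \<alpha>] \<gamma>(1)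
        closed[OF under_Field[of \<kappa> \<alpha>]] by auto
    then obtain b where b: "b \<in> Field \<kappa>" "?B \<subseteq> underS b"
      by (rule countable_bounded[OF cu])
    have "(\<gamma>, b) \<in> \<kappa>"
      using b(2) by (simp add: Order_Relation.underS_def)
    moreover have "x \<alpha> \<in> range (P \<gamma>)"
      using \<gamma>(2) by (metis rangeI)
    ultimately have "P b (x \<alpha>) = x \<alpha>"
      using fixed by blast
    then show ?thesis
      using b by (intro exI[of _ b]) auto
  qed
  then obtain \<rho> where \<rho>: "\<And>\<alpha>. \<alpha> \<in> Field \<kappa> \<Longrightarrow> \<rho> \<alpha> \<in> Field \<kappa>"
    "\<And>\<alpha>. \<alpha> \<in> Field \<kappa> \<Longrightarrow> cl (under \<alpha>) \<subseteq> underS (\<rho> \<alpha>)"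
    "\<And>\<alpha>. \<alpha> \<in> Field \<kappa> \<Longrightarrow> P (\<rho> \<alpha>) (x \<alpha>) = x \<alpha>"
    "\<And>\<alpha> i. \<alpha> \<in> Field \<kappa> \<Longrightarrow> i \<in> Field \<kappa> \<Longrightarrow> i \<notin> underS (\<rho> \<alpha>) \<Longrightarrow> P \<alpha> (x i) = 0"
    by metis
  obtain \<sigma> where \<sigma>: "ord_strict_mono \<kappa> \<sigma>" "ord_continuous \<kappa> \<sigma>"
    and card_\<sigma>: "\<And>\<alpha>. \<alpha> \<in> Field \<kappa> \<Longrightarrow> |underS (\<sigma> \<alpha>)| =o ord_card \<kappa> \<alpha>"
    and limit_\<sigma>: "\<And>\<alpha>. \<alpha> \<in> Field \<kappa> \<Longrightarrow> limit_ord \<kappa> (\<sigma> \<alpha>)"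
    and closed_\<sigma>: "\<And>\<alpha> a. \<alpha> \<in> Field \<kappa> \<Longrightarrow> a \<in> underS (\<sigma> \<alpha>) \<Longrightarrow> \<rho> a \<in> underS (\<sigma> \<alpha>)"
    by (rule club_enumeration[OF cu \<rho>(1)]) iprover+
  \<comment> \<open>The segment below \<open>l\<close> is the union of the chain of
    \<open>under a\<close> with \<open>a\<close> below \<open>l\<close>. The hull commutes with this
    union, and the hull of \<open>under a\<close> stays below \<open>\<rho> a\<close>, hence below
    \<open>l\<close>.\<close>
  have dec_limit: "decoupled (underS l) (underS l)"
    if l: "limit_ord \<kappa> l" "\<And>a. a \<in> underS l \<Longrightarrow> \<rho> a \<in> underS l" for l
  proof -
    have ne: "under ` underS l \<noteq> {}"
      using l(1) by (simp add: limit_ord_def)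
    have ch: "A \<subseteq> B \<or> B \<subseteq> A" if AB: "A \<in> under ` underS l" "B \<in> under ` underS l" for A B
    proof -
      obtain a b where "a \<in> underS l" "A = under a" "b \<in> underS l" "B = under b"
        using AB by blast
      moreover from this have "(a, b) \<in> \<kappa> \<or> (b, a) \<in> \<kappa>"
        using TOTALS underS_imp_Field by blast
      ultimately show ?thesis
        using under_incr[OF TRANS] by blast
    qed
    have un: "\<Union>(under ` underS l) = underS l"
    proof
      show "\<Union>(under ` underS l) \<subseteq> underS l"
        using under_subset_underS by blast
      show "underS l \<subseteq> \<Union>(under ` underS l)"
        using Refl_under_in[OF REFL] underS_imp_Field by blast
    qed
    have "cl (underS l) = \<Union>(cl ` under ` underS l)"
      using chain[OF ne ch] unfolding un by blast
    also have "\<dots> \<subseteq> underS l"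
    proof (intro UN_least, clarify)
      fix a c assume a: "a \<in> underS l" and "c \<in> cl (under a)"
      then have "c \<in> underS (\<rho> a)"
        using \<rho>(2)[of a] underS_imp_Field[OF a] by blast
      then show "c \<in> underS l"
        using underS_trans[of c "\<rho> a" l] l(2)[OF a] by blast
    qed
    finally have "cl (underS l) = underS l"
      using ext by blast
    then show ?thesis
      using dec[of "underS l"] by simp
  qed
  have P_limit: "P l (x i) = (if i \<in> underS l then x i else 0)"
    if l: "limit_ord \<kappa> l" "\<And>a. a \<in> underS l \<Longrightarrow> \<rho> a \<in> underS l" and i: "i \<in> Field \<kappa>" for l i
  proof (cases "i \<in> underS l")
    case True
    then have "(\<rho> i, l) \<in> \<kappa>"
      using l(2) by (auto simp: Order_Relation.underS_def)
    moreover have "x i \<in> range (P (\<rho> i))"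
      using \<rho>(3)[OF i] by (metis rangeI)
    ultimately have "P l (x i) = x i"
      by (intro fixed)
    with True show ?thesis
      by simp
  next
    case False
    define v where "v = P l (x i)"
    have zero: "P \<alpha> v = 0" if \<alpha>: "\<alpha> \<in> underS l" for \<alpha>
    proof -
      have "i \<notin> underS (\<rho> \<alpha>)"
        using False underS_trans[of i "\<rho> \<alpha>" l] l(2)[OF \<alpha>] by blast
      then have "P \<alpha> (x i) = 0"
        using \<rho>(4)[OF _ i] underS_imp_Field[OF \<alpha>] by blast
      moreover have "(\<alpha>, l) \<in> \<kappa>"
        using \<alpha> by (simp add: Order_Relation.underS_def)
      ultimately show ?thesis
        unfolding v_def using PP(1) by simp
    qed
    have "v \<in> closure (\<Union>\<alpha>\<in>underS l. range (P \<alpha>))"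
      unfolding v_def using limit[OF l(1)] by blast
    then obtain u where u: "\<And>n::nat. u n \<in> (\<Union>\<alpha>\<in>underS l. range (P \<alpha>))" "u \<longlonglongrightarrow> v"
      unfolding closure_sequential by blast
    \<comment> \<open>Since \<open>P \<alpha>\<close> fixes \<open>u n\<close> and kills
      \<open>v\<close>, it maps \<open>u n - v\<close> to \<open>u n\<close>; contractivity gives
      the bound. As \<open>u\<close> converges to \<open>v\<close>, this forces
      \<open>v = 0\<close>.\<close>
    have "norm (u n) \<le> norm (u n - v)" for n
    proof -
      obtain \<alpha> where \<alpha>: "\<alpha> \<in> underS l" "u n \<in> range (P \<alpha>)"
        using u(1)[of n] by blast
      then have F: "\<alpha> \<in> Field \<kappa>"
        using underS_imp_Field by blast
      have "P \<alpha> (u n) = u n"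
        using fixed[OF \<alpha>(2)] REFL F by (auto simp: refl_on_def)
      then have "u n = P \<alpha> (u n - v)"
        using zero[OF \<alpha>(1)] by (simp add: blinfun.diff_right)
      then show ?thesis
        using le1[OF F, of "u n - v"] by simp
    qed
    moreover have "(\<lambda>n. norm (u n - v)) \<longlonglongrightarrow> norm (v - v)"
      by (intro tendsto_norm tendsto_diff u(2) tendsto_const)
    ultimately have "norm v \<le> norm (v - v)"
      using LIMSEQ_le[OF tendsto_norm[OF u(2)]] by blast
    then show ?thesis
      using False by (simp add: v_def)
  qed
  define Q where "Q = P \<circ> \<sigma>"
  have Q: "Q \<alpha> (x i) = (if i \<in> underS (\<sigma> \<alpha>) then x i else 0)"
    if "\<alpha> \<in> Field \<kappa>" "i \<in> Field \<kappa>" for \<alpha> i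
    unfolding Q_def comp_apply using that by (intro P_limit limit_\<sigma> closed_\<sigma>)
  have dec_\<sigma>: "decoupled (underS (\<sigma> \<alpha>)) (underS (\<sigma> \<alpha>))" if "\<alpha> \<in> Field \<kappa>" for \<alpha>
    using that by (intro dec_limit limit_\<sigma> closed_\<sigma>)
  have "bimonotone_PRI \<kappa> Q" "subordinated \<kappa> x Q"
    using bimonotone_PRI_subordinated[OF \<sigma> card_\<sigma> dec_\<sigma> Q] by blast+
  moreover from this have "coarsening \<kappa> P Q"
    unfolding coarsening_def bimonotone_PRI_def using \<sigma>(1) by (auto simp: Q_def)
  ultimately show thesis
    using that by blast
qed

end

section \<open>The first uncountable cardinal and the three conclusions\<close>

lemma countable_underS_aleph1:
  fixes \<kappa> :: "'k rel"
  assumes \<kappa>: "Card_order \<kappa>" "\<kappa> =o cardSuc natLeq" and a: "a \<in> Field \<kappa>"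
  shows "countable (underS \<kappa> a)"
proof -
  have "|underS \<kappa> a| <o cardSuc natLeq"
    using card_of_underS[OF \<kappa>(1) a] \<kappa>(2) by (rule ordLess_ordIso_trans)
  then have "|underS \<kappa> a| \<le>o natLeq"
    using cardSuc_ordLeq_ordLess[OF natLeq_Card_order card_of_Card_order] by blast
  then show ?thesis
    by (simp add: countable_iff_card_of)
qed

theorem theorem5p1:
  fixes \<kappa> :: "'k rel"
  assumes "Card_order \<kappa>" and "natLeq <o \<kappa>" and "regularCard \<kappa>"
    and "WLD TYPE('a::banach)"
    and "dens (UNIV :: 'a::banach set) =o \<kappa>"
    and "condition_dd TYPE('a::banach)"
  shows "(bicontractive_SCP TYPE('a::banach) \<and>
          (\<forall>Y :: 'a::banach set. subspace Y \<and> dens Y <o dens (UNIV :: 'a::banach set) \<longrightarrow>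
             (\<exists>Z. bicontractively_complemented Z \<and> Y \<subseteq> Z \<and> dens Z =o dens Y)))
       \<and> (\<forall>(I :: 'i set) (x :: 'i \<Rightarrow> 'a::banach) f. M_basis I x f \<longrightarrow>
             (\<exists>\<pi> P. bij_betw \<pi> (Field \<kappa>) I \<and> bimonotone_PRI \<kappa> P \<and> subordinated \<kappa> (x \<circ> \<pi>) P))
       \<and> (dens (UNIV :: 'a::banach set) =o cardSuc natLeq \<longrightarrow>
             (\<forall>(x :: 'k \<Rightarrow> 'a::banach) f P. M_basis (Field \<kappa>) x f \<and> PRI \<kappa> P \<longrightarrow>
                (\<exists>Q. coarsening \<kappa> P Q \<and> bimonotone_PRI \<kappa> Q \<and> subordinated \<kappa> x Q)))"
proof -
  have C: "property_C TYPE('a)"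
    using assms(4) by (simp add: WLD_def)
  have nonsep: "natLeq <o dens (UNIV :: 'a set)"
    using assms(2) ordIso_symmetric[OF assms(5)] by (rule ordLess_ordIso_trans)
  have cardinal: "uncountable_cardinal \<kappa>"
  proof unfold_locales
    have "cinfinite \<kappa>"
      using ordLess_imp_ordLeq[OF assms(2)] natLeq_cinfinite by (rule cinfinite_mono)
    then show "infinite (Field \<kappa>)"
      by (simp add: cinfinite_def)
  qed (fact assms)+
  have basis_cardinal: "dd_basis_cardinal \<kappa> x f" if "M_basis (Field \<kappa>) x f" for x :: "'k \<Rightarrow> 'a" and f
    using dd_basis.intro[OF that C assms(6) nonsep] cardinal assms(5)
    by (intro dd_basis_cardinal.intro dd_basis_cardinal_axioms.intro)
  have part1: "bicontractive_SCP TYPE('a) \<and>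
      (\<forall>Y :: 'a set. subspace Y \<and> dens Y <o dens (UNIV :: 'a set) \<longrightarrow>
         (\<exists>Z. bicontractively_complemented Z \<and> Y \<subseteq> Z \<and> dens Z =o dens Y))"
  proof -
    obtain I :: "'a set" and x :: "'a \<Rightarrow> 'a" and f where "M_basis I x f"
      using assms(4) unfolding WLD_def by blast
    then interpret dd_basis I x f
      using C assms(6) nonsep by (rule dd_basis.intro)
    have "\<exists>Z. bicontractively_complemented Z \<and> Y \<subseteq> Z \<and> dens Z =o dens Y"
      if "dens Y <o dens (UNIV :: 'a set)" for Y :: "'a set"
      by (rule bicontractively_complemented_superspace[OF that]) blast
    then show ?thesis
      using bicontractive_SCP by blast
  qed
  have part2: "\<exists>\<pi> P. bij_betw \<pi> (Field \<kappa>) I \<and> bimonotone_PRI \<kappa> P \<and> subordinated \<kappa> (x \<circ> \<pi>) P"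
    if M: "M_basis I x f" for I :: "'i set" and x :: "'i \<Rightarrow> 'a" and f
  proof -
    interpret dd_basis I x f
      using M C assms(6) nonsep by (rule dd_basis.intro)
    have "|I| =o \<kappa>"
      using card_basis assms(5) by (rule ordIso_transitive)
    then have "|Field \<kappa>| =o |I|"
      using card_of_Field_ordIso[OF assms(1)] by (blast intro: ordIso_transitive ordIso_symmetric)
    \<comment> \<open>The basis is moved to \<open>Field \<kappa>\<close>, where the filtration is
      available; the re-indexing finally returned is \<open>e \<circ> \<pi>\<close>.\<close>
    then obtain e where e: "bij_betw e (Field \<kappa>) I"
      using card_of_ordIso by blast
    interpret k: dd_basis_cardinal \<kappa> "x \<circ> e" "f \<circ> e"
      using M_basis_reindex[OF e M] by (rule basis_cardinal)
    obtain \<pi> P where \<pi>: "bij_betw \<pi> (Field \<kappa>) (Field \<kappa>)" "bimonotone_PRI \<kappa> P" "subordinated \<kappa> (x \<circ> e \<circ> \<pi>) P"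
      by (rule k.subordinated_up_to_permutation)
    have "bij_betw (e \<circ> \<pi>) (Field \<kappa>) I"
      using \<pi>(1) e by (rule bij_betw_trans)
    with \<pi>(2,3) show ?thesis
      by (intro exI[of _ "e \<circ> \<pi>"] exI[of _ P]) (simp add: comp_assoc)
  qed
  have part3: "\<exists>Q. coarsening \<kappa> P Q \<and> bimonotone_PRI \<kappa> Q \<and> subordinated \<kappa> x Q"
    if dens: "dens (UNIV :: 'a set) =o cardSuc natLeq" and "M_basis (Field \<kappa>) x f" "PRI \<kappa> P"
    for x :: "'k \<Rightarrow> 'a" and f and P :: "'k \<Rightarrow> 'a \<Rightarrow>\<^sub>L 'a"
  proof -
    interpret k: dd_basis_cardinal \<kappa> x f
      using \<open>M_basis (Field \<kappa>) x f\<close> by (rule basis_cardinal)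
    have "\<kappa> =o cardSuc natLeq"
      using ordIso_symmetric[OF assms(5)] dens by (rule ordIso_transitive)
    then have "\<forall>a\<in>Field \<kappa>. countable (underS \<kappa> a)"
      using countable_underS_aleph1[OF assms(1)] by blast
    then show ?thesis
      by (rule k.bimonotone_coarsening[OF \<open>PRI \<kappa> P\<close>]) blast
  qed
  from part1 part2 part3 show ?thesis
    by (intro conjI allI impI) blast+
qed

end
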